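(* For all $g\geq 3$, the space $\overline{m_g^u(3)}$ is connected.
   Context: Let $\Sigma_g$ be the closed oriented surface of genus $g\ge 2$, $\Gamma=\pi_1\Sigma_g=\langle a_1,b_1,\ldots,a_g,b_g\mid \prod_i[a_i,b_i]=1\rangle$, $S=\{a_i^{\pm1},b_i^{\pm1}\}$. Let $R_g(3)=\mathrm{Hom}(\Gamma,\mathrm{Isom}^+(\mathbb H^3))$, topologized as a subset of $\mathrm{Isom}^+(\mathbb H^3)^S$. $m_g^o(3)\subset R_g(3)/\mathrm{Isom}^+(\mathbb H^3)$ is the subspace (induced topology; it is Hausdorff and locally compact) of conjugacy classes of representations having either no, or at least two, global fixed points in $\partial\mathbb H^3$. $m_g^u(3)$ is the quotient of $m_g^o(3)$ by conjugation by $\mathrm{Isom}(\mathbb H^3)$. Compactification. For $[\rho]\in m_g^u(3)$ put $d(\rho)=\min_{x\in\mathbb H^3}\max_{s\in S}d(x,\rho(s)x)$, $\ell(\rho)=\max(1,d(\rho))$, and regard $[\rho]$ as the equivariant isometry class of the action $\rho$ on $(\mathbb H^3,d_{\mathbb H^3}/\ell(\rho))$. Let $\mathcal T(\Gamma)$ be the set of equivariant isometry classes of minimal isometric actions (no proper nonempty invariant subtree) of $\Gamma$ on $\mathbb R$-trees $T$ not reduced to a point, with $\min_{x\in T}\max_{s\in S}d(x,s x)=1$, and such that either $T$ is a line or $\Gamma$ fixes no end of $T$. For a Gromov hyperbolic space $X$, $\delta(X)$ is its best hyperbolicity constant (least $\delta$ such that in each geodesic triangle each side lies in the $\delta$-neighbourhood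 of the two others; so $\delta=0$ for trees). Equip $m_g^u(3)\cup\mathcal T(\Gamma)$ with the topology having as basis the sets $U'_{K,\varepsilon,P}(\rho,X,d)$, where $\varepsilon>0$, $K=\{x_1,\dots,x_p\}\subset X$ and $P\subset\Gamma$ are finite: it consists of those $(\rho',X',d')$ for which there are $x_1',\dots,x_p'\in X'$ with $|d(\rho(\gamma)x_i,\rho(\eta)x_j)-d'(\rho'(\gamma)x_i',\rho'(\eta)x_j')|<\varepsilon$ for all $\gamma,\eta\in P$ and all $i,j$, and $|\delta(X)-\delta(X')|<\varepsilon$. Then $\overline{m_g^u(3)}$ is the closure of $m_g^u(3)$ in this space. *)

theory Defs
  imports "HOL-Analysis.Analysis" "HOL-Algebra.Group_Action"
begin

section \<open>Groups given by a presentation\<close>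

text \<open>A letter is a generator together with a flag; the flag \<^term>\<open>True\<close> marks the
  formal inverse.\<close>

type_synonym 'a word = "('a \<times> bool) list"

definition words_over :: "'a set \<Rightarrow> 'a word set" where
  "words_over X = lists (X \<times> UNIV)"

definition word_inv :: "'a word \<Rightarrow> 'a word" where
  "word_inv w = rev (map (\<lambda>(x, b). (x, \<not> b)) w)"

inductive word_eq :: "'a set \<Rightarrow> 'a word set \<Rightarrow> 'a word \<Rightarrow> 'a word \<Rightarrow> bool"
  for X :: "'a set" and R :: "'a word set" where
  word_refl: "u \<in> words_over X \<Longrightarrow> word_eq X R u u"
| word_sym: "word_eq X R u v \<Longrightarrow> word_eq X R v u"
| word_trans: "word_eq X R u v \<Longrightarrow> word_eq X R v w \<Longrightarrow> word_eq X R u w"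
| word_cancel: "u \<in> words_over X \<Longrightarrow> v \<in> words_over X \<Longrightarrow> x \<in> X \<Longrightarrow>
    word_eq X R (u @ [(x, b), (x, \<not> b)] @ v) (u @ v)"
| word_relator: "u \<in> words_over X \<Longrightarrow> v \<in> words_over X \<Longrightarrow> r \<in> R \<Longrightarrow> r \<in> words_over X \<Longrightarrow>
    word_eq X R (u @ r @ v) (u @ v)"

definition word_rel :: "'a set \<Rightarrow> 'a word set \<Rightarrow> ('a word \<times> 'a word) set" where
  "word_rel X R = {(u, v). word_eq X R u v}"

definition presented_group :: "'a set \<Rightarrow> 'a word set \<Rightarrow> 'a word set monoid" where
  "presented_group X R =
    \<lparr>carrier = words_over X // word_rel X R,
     mult = (\<lambda>U V. \<Union>u\<in>U. \<Union>v\<in>V. word_rel X R `` {u @ v}),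
     one = word_rel X R `` {[]}\<rparr>"

lemma words_over_simps [simp]:
  "[] \<in> words_over X"
  "u @ v \<in> words_over X \<longleftrightarrow> u \<in> words_over X \<and> v \<in> words_over X"
  "(x, b) # u \<in> words_over X \<longleftrightarrow> x \<in> X \<and> u \<in> words_over X"
  by (auto simp: words_over_def)

lemma word_eq_in_words:
  "word_eq X R u v \<Longrightarrow> u \<in> words_over X \<and> v \<in> words_over X"
  by (induction rule: word_eq.induct) auto

lemma word_eq_context:
  assumes "word_eq X R u v" "p \<in> words_over X" "q \<in> words_over X"
  shows "word_eq X R (p @ u @ q) (p @ v @ q)"
  using assms
proof (induction rule: word_eq.induct)
  case (word_cancel u v x b)
  then show ?case
    using word_eq.word_cancel[of "p @ u" X "v @ q" x R b] by simp
next
  case (word_relator u v r)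
  then show ?case
    using word_eq.word_relator[of "p @ u" X "v @ q" r R] by simp
qed (auto intro: word_eq.intros)

lemma word_eq_append:
  assumes "word_eq X R u u'" "word_eq X R v v'"
  shows "word_eq X R (u @ v) (u' @ v')"
  using word_eq_context[OF assms(1), of "[]" v] word_eq_context[OF assms(2), of u' "[]"]
    word_eq_in_words[OF assms(1)] word_eq_in_words[OF assms(2)]
  by (auto intro: word_eq.word_trans)

lemma equiv_word_rel: "equiv (words_over X) (word_rel X R)"
proof (rule equivI)
  show "word_rel X R \<subseteq> words_over X \<times> words_over X"
    by (auto simp: word_rel_def dest: word_eq_in_words)
  show "refl_on (words_over X) (word_rel X R)"
    by (auto simp: word_rel_def refl_on_def intro: word_eq.word_refl)
  show "sym (word_rel X R)"
    by (auto simp: word_rel_def intro!: symI intro: word_eq.word_sym)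
  show "trans (word_rel X R)"
    by (auto simp: word_rel_def intro!: transI intro: word_eq.word_trans)
qed

lemma word_inv_words [simp]: "w \<in> words_over X \<Longrightarrow> word_inv w \<in> words_over X"
  by (auto simp: words_over_def word_inv_def in_lists_conv_set)

lemma word_inv_left: "w \<in> words_over X \<Longrightarrow> word_eq X R (word_inv w @ w) []"
proof (induction w)
  case Nil
  then show ?case by (auto simp: word_inv_def intro: word_eq.word_refl)
next
  case (Cons a w)
  obtain x b where a: "a = (x, b)" by force
  have "word_eq X R (word_inv w @ [(x, \<not> b), (x, \<not> \<not> b)] @ w) (word_inv w @ w)"
    using Cons.prems a by (intro word_eq.word_cancel) auto
  then show ?case
    using Cons a by (auto simp: word_inv_def intro: word_eq.word_trans)
qed

lemma mult_presented_class:
  assumes "u \<in> words_over X" "v \<in> words_over X"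
  shows "mult (presented_group X R) (word_rel X R `` {u}) (word_rel X R `` {v})
    = word_rel X R `` {u @ v}"
proof -
  have "word_rel X R `` {u @ v} = word_rel X R `` {u' @ v'}"
    if "(u, u') \<in> word_rel X R" "(v, v') \<in> word_rel X R" for u v u' v'
    using that by (intro equiv_class_eq[OF equiv_word_rel])
      (auto simp: word_rel_def intro: word_eq_append)
  then have "congruent2 (word_rel X R) (word_rel X R) (\<lambda>u v. word_rel X R `` {u @ v})"
    by (intro congruent2I') auto
  from UN_equiv_class2[OF equiv_word_rel equiv_word_rel this assms] show ?thesis
    by (simp add: presented_group_def)
qed

lemma group_presented_group: "group (presented_group X R)"
proof (rule groupI)
  let ?G = "presented_group X R" and ?c = "\<lambda>u. word_rel X R `` {u}"
  have car: "\<exists>u\<in>words_over X. a = ?c u" if "a \<in> carrier ?G" for a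
    using that by (auto simp: presented_group_def elim: quotientE)
  have cls: "?c u \<in> carrier ?G" if "u \<in> words_over X" for u
    using that by (auto simp: presented_group_def intro: quotientI)
  have one: "\<one>\<^bsub>?G\<^esub> = ?c []" by (simp add: presented_group_def)
  show "\<one>\<^bsub>?G\<^esub> \<in> carrier ?G" by (simp add: one cls)
  fix a assume "a \<in> carrier ?G"
  then obtain u where u: "u \<in> words_over X" "a = ?c u" using car by blast
  show "\<one>\<^bsub>?G\<^esub> \<otimes>\<^bsub>?G\<^esub> a = a" by (simp add: one u mult_presented_class)
  show "\<exists>y\<in>carrier ?G. y \<otimes>\<^bsub>?G\<^esub> a = \<one>\<^bsub>?G\<^esub>"
  proof
    have "(word_inv u @ u, []) \<in> word_rel X R"
      using word_inv_left[OF u(1)] by (simp add: word_rel_def)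
    then show "?c (word_inv u) \<otimes>\<^bsub>?G\<^esub> a = \<one>\<^bsub>?G\<^esub>"
      using u equiv_class_eq[OF equiv_word_rel] by (simp add: one mult_presented_class)
  qed (simp add: cls u)
  fix b assume "b \<in> carrier ?G"
  then obtain v where v: "v \<in> words_over X" "b = ?c v" using car by blast
  show "a \<otimes>\<^bsub>?G\<^esub> b \<in> carrier ?G" using u v by (simp add: mult_presented_class cls)
  fix c assume "c \<in> carrier ?G"
  then obtain w where w: "w \<in> words_over X" "c = ?c w" using car by blast
  show "a \<otimes>\<^bsub>?G\<^esub> b \<otimes>\<^bsub>?G\<^esub> c = a \<otimes>\<^bsub>?G\<^esub> (b \<otimes>\<^bsub>?G\<^esub> c)"
    using u v w by (simp add: mult_presented_class)
qed

section \<open>The surface group\<close>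

datatype surface_gen = GenA nat | GenB nat

type_synonym surface_elt = "surface_gen word set"

definition surface_gens :: "nat \<Rightarrow> surface_gen set" where
  "surface_gens g = GenA ` {1..g} \<union> GenB ` {1..g}"

definition surface_relator :: "nat \<Rightarrow> surface_gen word" where
  "surface_relator g =
    concat (map (\<lambda>i. [(GenA i, False), (GenB i, False), (GenA i, True), (GenB i, True)]) [1..<Suc g])"

definition surface_group :: "nat \<Rightarrow> surface_elt monoid" where
  "surface_group g = presented_group (surface_gens g) {surface_relator g}"

definition generating_set :: "nat \<Rightarrow> surface_elt set" where
  "generating_set g =
    {word_rel (surface_gens g) {surface_relator g} `` {[(x, b)]} | x b. x \<in> surface_gens g}"

section \<open>Metric notions\<close>

definition geodesic_segment ::
    "'a set \<Rightarrow> ('a \<Rightarrow> 'a \<Rightarrow> real) \<Rightarrow> 'a \<Rightarrow> 'a \<Rightarrow> 'a set \<Rightarrow> bool" where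
  "geodesic_segment X d x y s \<longleftrightarrow>
    (\<exists>c. c \<in> {0..d x y} \<rightarrow> X \<and> c 0 = x \<and> c (d x y) = y \<and>
      (\<forall>t\<in>{0..d x y}. \<forall>u\<in>{0..d x y}. d (c t) (c u) = \<bar>t - u\<bar>) \<and> s = c ` {0..d x y})"

definition in_neighbourhood ::
    "('a \<Rightarrow> 'a \<Rightarrow> real) \<Rightarrow> real \<Rightarrow> 'a set \<Rightarrow> 'a set \<Rightarrow> bool" where
  "in_neighbourhood d \<delta> s A \<longleftrightarrow> (\<forall>p\<in>s. \<exists>q\<in>A. d p q \<le> \<delta>)"

definition thin_triangles :: "'a set \<Rightarrow> ('a \<Rightarrow> 'a \<Rightarrow> real) \<Rightarrow> real \<Rightarrow> bool" where
  "thin_triangles X d \<delta> \<longleftrightarrow>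
    (\<forall>x\<in>X. \<forall>y\<in>X. \<forall>z\<in>X. \<forall>s1 s2 s3.
      geodesic_segment X d x y s1 \<and> geodesic_segment X d y z s2 \<and> geodesic_segment X d z x s3 \<longrightarrow>
      in_neighbourhood d \<delta> s1 (s2 \<union> s3) \<and> in_neighbourhood d \<delta> s2 (s3 \<union> s1) \<and>
      in_neighbourhood d \<delta> s3 (s1 \<union> s2))"

definition hyp_const :: "'a set \<Rightarrow> ('a \<Rightarrow> 'a \<Rightarrow> real) \<Rightarrow> real" where
  "hyp_const X d = Inf {\<delta>. 0 \<le> \<delta> \<and> thin_triangles X d \<delta>}"

definition geodesic_rays :: "'a set \<Rightarrow> ('a \<Rightarrow> 'a \<Rightarrow> real) \<Rightarrow> (real \<Rightarrow> 'a) set" where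
  "geodesic_rays X d =
    {r \<in> {0..} \<rightarrow>\<^sub>E X. \<forall>t\<in>{0..}. \<forall>u\<in>{0..}. d (r t) (r u) = \<bar>t - u\<bar>}"

section \<open>Hyperbolic 3-space\<close>

definition H3 :: "(real^3) set" where
  "H3 = {x. 0 < x $ 3}"

text \<open>The upper half-space metric. It is set to 0 off \<^term>\<open>H3\<close> because
  \<^locale>\<open>Metric_space\<close> asks for a symmetric and nonnegative function on the whole type.\<close>

definition hdist :: "real^3 \<Rightarrow> real^3 \<Rightarrow> real" where
  "hdist x y =
    (if x \<in> H3 \<and> y \<in> H3 then arcosh (1 + (norm (x - y))\<^sup>2 / (2 * x $ 3 * y $ 3)) else 0)"

lemma Metric_space_H3: "Metric_space H3 hdist"
proof
  have ge1: "1 \<le> 1 + (norm (x - y))\<^sup>2 / (2 * x $ 3 * y $ 3)" if "x \<in> H3" "y \<in> H3" for x y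
    using that by (simp add: H3_def)
  show "0 \<le> hdist x y" for x y
    using ge1 by (simp add: hdist_def arcosh_nonneg_real del: le_add_same_cancel1)
  show "hdist x y = hdist y x" for x y
    by (simp add: hdist_def norm_minus_commute mult.commute mult.left_commute)
  show "hdist x y = 0 \<longleftrightarrow> x = y" if "x \<in> H3" "y \<in> H3" for x y
    using that ge1[OF that] by (auto simp: hdist_def H3_def)
  fix x y z assume xyz: "x \<in> H3" "y \<in> H3" "z \<in> H3"
  define C where "C = (\<lambda>x y :: real^3. 1 + (norm (x - y))\<^sup>2 / (2 * x $ 3 * y $ 3))"
  define p where "p = (\<lambda>x :: real^3. vector [(x $ 1 - y $ 1) / x $ 3, (x $ 2 - y $ 2) / x $ 3,
    ((x $ 1 - y $ 1)\<^sup>2 + (x $ 2 - y $ 2)\<^sup>2 + (x $ 3)\<^sup>2 - (y $ 3)\<^sup>2) / (2 * x $ 3 * y $ 3)] :: real^3)"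
  have pos: "0 < x $ 3" "0 < y $ 3" "0 < z $ 3" using xyz by (auto simp: H3_def)
  have nrm: "(norm (u - v))\<^sup>2 = (u $ 1 - v $ 1)\<^sup>2 + (u $ 2 - v $ 2)\<^sup>2 + (u $ 3 - v $ 3)\<^sup>2"
    for u v :: "real^3"
    unfolding power2_norm_eq_inner by (simp add: inner_vec_def sum_3 power2_eq_square)
  have inner: "p u \<bullet> p v = C u y * C v y - C u v" if "0 < u $ 3" "0 < v $ 3" for u v
    using that pos unfolding p_def C_def nrm
    by (simp add: inner_vec_def sum_3 field_simps power2_eq_square)
  have C1: "1 \<le> C x y" "1 \<le> C y z" "1 \<le> C x z" "1 \<le> C z y" "C z y = C y z" "C x x = 1" "C z z = 1"
    using xyz by (auto simp: C_def H3_def norm_minus_commute mult.commute mult.left_commute)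
  have d: "hdist x y = arcosh (C x y)" "hdist y z = arcosh (C y z)" "hdist x z = arcosh (C x z)"
    using xyz by (auto simp: hdist_def C_def)
  have "norm (p x) = sqrt ((C x y)\<^sup>2 - 1)" "norm (p z) = sqrt ((C y z)\<^sup>2 - 1)"
    using C1 inner pos by (auto simp: norm_eq_sqrt_inner power2_eq_square)
  then have "- (p x \<bullet> p z) \<le> sqrt ((C x y)\<^sup>2 - 1) * sqrt ((C y z)\<^sup>2 - 1)"
    using Cauchy_Schwarz_ineq2[of "p x" "p z"] by simp
  then have "C x z \<le> cosh (hdist x y + hdist y z)"
    using C1 inner[of x z] pos by (simp add: d cosh_add sinh_arcosh_real)
  moreover have "0 \<le> hdist x y + hdist y z"
    using C1 by (simp add: d arcosh_nonneg_real)
  ultimately show "hdist x z \<le> hdist x y + hdist y z"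
    using C1 by (smt (verit, best) arcosh_cosh_real arcosh_real_strict_mono d(3))
qed

definition isom_H3 :: "(real^3 \<Rightarrow> real^3) monoid" where
  "isom_H3 = BijGroup H3 \<lparr>carrier :=
    {f \<in> Bij H3. \<forall>x\<in>H3. \<forall>y\<in>H3. hdist (f x) (f y) = hdist x y}\<rparr>"

definition orientation_preserving :: "(real^3 \<Rightarrow> real^3) \<Rightarrow> bool" where
  "orientation_preserving f \<longleftrightarrow>
    (\<forall>x\<in>H3. \<exists>f'. (f has_derivative f') (at x) \<and> 0 < det (matrix f'))"

definition isom_plus_H3 :: "(real^3 \<Rightarrow> real^3) monoid" where
  "isom_plus_H3 = isom_H3 \<lparr>carrier := {f \<in> carrier isom_H3. orientation_preserving f}\<rparr>"

definition asymptotic :: "((real \<Rightarrow> real^3) \<times> (real \<Rightarrow> real^3)) set" where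
  "asymptotic = {(r, r'). r \<in> geodesic_rays H3 hdist \<and> r' \<in> geodesic_rays H3 hdist \<and>
    (\<exists>C. \<forall>t\<ge>0. hdist (r t) (r' t) \<le> C)}"

definition boundary_H3 :: "(real \<Rightarrow> real^3) set set" where
  "boundary_H3 = geodesic_rays H3 hdist // asymptotic"

text \<open>Rays are extensional functions on \<^term>\<open>{0::real..}\<close>, so the action on classes of
  rays is by images under post-composition.\<close>

definition fixes_ray_class ::
    "nat \<Rightarrow> (surface_elt \<Rightarrow> 'a \<Rightarrow> 'a) \<Rightarrow> (real \<Rightarrow> 'a) set \<Rightarrow> bool" where
  "fixes_ray_class g \<rho> \<xi> \<longleftrightarrow>
    (\<forall>\<gamma>\<in>carrier (surface_group g). (\<lambda>r. compose {0..} (\<rho> \<gamma>) r) ` \<xi> = \<xi>)"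

section \<open>Isometric actions of the surface group\<close>

type_synonym 'a gamma_space =
  "'a set \<times> ('a \<Rightarrow> 'a \<Rightarrow> real) \<times> (surface_elt \<Rightarrow> 'a \<Rightarrow> 'a)"

definition isometric_action :: "nat \<Rightarrow> 'a gamma_space \<Rightarrow> bool" where
  "isometric_action g = (\<lambda>(X, d, \<rho>).
    Metric_space X d \<and> group_action (surface_group g) X \<rho> \<and>
    (\<forall>\<gamma>\<in>carrier (surface_group g). \<forall>x\<in>X. \<forall>y\<in>X. d (\<rho> \<gamma> x) (\<rho> \<gamma> y) = d x y))"

definition equivariantly_isometric ::
    "nat \<Rightarrow> 'a gamma_space \<Rightarrow> 'a gamma_space \<Rightarrow> bool" where
  "equivariantly_isometric g = (\<lambda>(X, d, \<rho>) (X', d', \<rho>').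
    \<exists>f. bij_betw f X X' \<and> (\<forall>x\<in>X. \<forall>y\<in>X. d' (f x) (f y) = d x y) \<and>
      (\<forall>\<gamma>\<in>carrier (surface_group g). \<forall>x\<in>X. f (\<rho> \<gamma> x) = \<rho>' \<gamma> (f x)))"

definition isometry_class :: "nat \<Rightarrow> 'a gamma_space \<Rightarrow> 'a gamma_space set" where
  "isometry_class g Y = {Z. isometric_action g Z \<and> equivariantly_isometric g Y Z}"

definition max_displacement :: "nat \<Rightarrow> 'a gamma_space \<Rightarrow> 'a \<Rightarrow> real" where
  "max_displacement g = (\<lambda>(X, d, \<rho>) x. Max ((\<lambda>s. d x (\<rho> s x)) ` generating_set g))"

section \<open>Representations in the isometry group of hyperbolic 3-space\<close>

type_synonym representation = "surface_elt \<Rightarrow> real^3 \<Rightarrow> real^3"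

definition rep_space :: "nat \<Rightarrow> representation set" where
  "rep_space g =
    hom (surface_group g) isom_plus_H3 \<inter> extensional (carrier (surface_group g))"

definition conjugate :: "nat \<Rightarrow> (real^3 \<Rightarrow> real^3) \<Rightarrow> representation \<Rightarrow> representation" where
  "conjugate g h \<rho> = (\<lambda>\<gamma>\<in>carrier (surface_group g).
    h \<otimes>\<^bsub>isom_H3\<^esub> \<rho> \<gamma> \<otimes>\<^bsub>isom_H3\<^esub> inv\<^bsub>isom_H3\<^esub> h)"

definition fixed_points_at_infinity :: "nat \<Rightarrow> representation \<Rightarrow> (real \<Rightarrow> real^3) set set" where
  "fixed_points_at_infinity g \<rho> = {\<xi> \<in> boundary_H3. fixes_ray_class g \<rho> \<xi>}"

definition conjugacy_class :: "nat \<Rightarrow> representation \<Rightarrow> representation set" where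
  "conjugacy_class g \<rho> = {conjugate g h \<rho> | h. h \<in> carrier isom_plus_H3}"

definition m_o :: "nat \<Rightarrow> representation set set" where
  "m_o g = {conjugacy_class g \<rho> | \<rho>. \<rho> \<in> rep_space g \<and>
    (fixed_points_at_infinity g \<rho> = {} \<or>
      (\<exists>\<xi>\<in>fixed_points_at_infinity g \<rho>. \<exists>\<eta>\<in>fixed_points_at_infinity g \<rho>. \<xi> \<noteq> \<eta>))}"

text \<open>The isometry group acts by conjugation on conjugacy classes under its
  orientation-preserving subgroup; the points of \<open>m_u\<close> are the orbits.\<close>

definition m_u :: "nat \<Rightarrow> representation set set set" where
  "m_u g = {(\<lambda>h. conjugate g h ` C) ` carrier isom_H3 | C. C \<in> m_o g}"

text \<open>For representations whose classes lie in \<^term>\<open>m_o g\<close> this infimum is attained.\<close>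

definition min_displacement :: "nat \<Rightarrow> representation \<Rightarrow> real" where
  "min_displacement g \<rho> = (INF x\<in>H3. max_displacement g (H3, hdist, \<rho>) x)"

definition rescaled_H3 :: "nat \<Rightarrow> representation \<Rightarrow> (real^3) gamma_space" where
  "rescaled_H3 g \<rho> = (H3, \<lambda>x y. hdist x y / max 1 (min_displacement g \<rho>), \<rho>)"

lemma isometric_action_rescaled_H3:
  assumes "\<rho> \<in> rep_space g"
  shows "isometric_action g (rescaled_H3 g \<rho>)"
proof -
  interpret Metric_space H3 hdist by (rule Metric_space_H3)
  define l where "l = max 1 (min_displacement g \<rho>)"
  have "0 < l" by (simp add: l_def)
  then have "Metric_space H3 (\<lambda>x y. hdist x y / l)"
    by unfold_locales
      (auto simp: commute simp flip: add_divide_distrib intro!: divide_right_mono triangle)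
  moreover have hom: "\<rho> \<in> hom (surface_group g) isom_plus_H3"
    using assms by (simp add: rep_space_def)
  then have "\<rho> \<in> hom (surface_group g) (BijGroup H3)"
    by (auto simp: hom_def isom_plus_H3_def isom_H3_def BijGroup_def)
  then have "group_action (surface_group g) H3 \<rho>"
    by (simp add: group_action_def group_hom_def group_hom_axioms_def group_BijGroup
        surface_group_def group_presented_group)
  moreover have "hdist (\<rho> \<gamma> x) (\<rho> \<gamma> y) = hdist x y"
    if "\<gamma> \<in> carrier (surface_group g)" "x \<in> H3" "y \<in> H3" for \<gamma> x y
    using hom_in_carrier[OF hom that(1)] that by (simp add: isom_plus_H3_def isom_H3_def)
  ultimately show ?thesis
    by (simp add: isometric_action_def rescaled_H3_def l_def)
qed

definition hyperbolic_point :: "nat \<Rightarrow> representation set set \<Rightarrow> (real^3) gamma_space set" where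
  "hyperbolic_point g c = (\<Union>\<rho>\<in>\<Union>c. isometry_class g (rescaled_H3 g \<rho>))"

definition hyperbolic_points :: "nat \<Rightarrow> (real^3) gamma_space set set" where
  "hyperbolic_points g = hyperbolic_point g ` m_u g"

section \<open>Actions on real trees\<close>

definition real_tree :: "'a set \<Rightarrow> ('a \<Rightarrow> 'a \<Rightarrow> real) \<Rightarrow> bool" where
  "real_tree X d \<longleftrightarrow> Metric_space X d \<and> X \<noteq> {} \<and>
    (\<forall>x\<in>X. \<forall>y\<in>X. \<exists>s. geodesic_segment X d x y s \<and>
      (\<forall>p. pathin (Metric_space.mtopology X d) p \<and> inj_on p {0..1} \<and> p 0 = x \<and> p 1 = y
        \<longrightarrow> p ` {0..1} = s))"

definition is_line :: "'a set \<Rightarrow> ('a \<Rightarrow> 'a \<Rightarrow> real) \<Rightarrow> bool" where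
  "is_line X d \<longleftrightarrow> (\<exists>f. bij_betw f (UNIV :: real set) X \<and> (\<forall>s t. d (f s) (f t) = \<bar>s - t\<bar>))"

definition cofinal_rays ::
    "'a set \<Rightarrow> ('a \<Rightarrow> 'a \<Rightarrow> real) \<Rightarrow> ((real \<Rightarrow> 'a) \<times> (real \<Rightarrow> 'a)) set" where
  "cofinal_rays X d = {(r, r'). r \<in> geodesic_rays X d \<and> r' \<in> geodesic_rays X d \<and>
    (\<exists>a\<ge>0. \<exists>b\<ge>0. \<forall>t\<ge>0. r (a + t) = r' (b + t))}"

definition tree_ends :: "'a set \<Rightarrow> ('a \<Rightarrow> 'a \<Rightarrow> real) \<Rightarrow> (real \<Rightarrow> 'a) set set" where
  "tree_ends X d = geodesic_rays X d // cofinal_rays X d"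

definition minimal_action :: "nat \<Rightarrow> 'a gamma_space \<Rightarrow> bool" where
  "minimal_action g = (\<lambda>(X, d, \<rho>).
    \<forall>Y. Y \<subseteq> X \<and> real_tree Y d \<and> (\<forall>\<gamma>\<in>carrier (surface_group g). \<rho> \<gamma> ` Y \<subseteq> Y) \<longrightarrow> Y = X)"

definition admissible_tree_action :: "nat \<Rightarrow> 'a gamma_space \<Rightarrow> bool" where
  "admissible_tree_action g = (\<lambda>(X, d, \<rho>).
    isometric_action g (X, d, \<rho>) \<and> real_tree X d \<and> (\<exists>x\<in>X. \<exists>y\<in>X. x \<noteq> y) \<and>
    minimal_action g (X, d, \<rho>) \<and>
    (\<exists>x\<in>X. max_displacement g (X, d, \<rho>) x = 1) \<and>
    (\<forall>x\<in>X. 1 \<le> max_displacement g (X, d, \<rho>) x) \<and>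
    (is_line X d \<or> \<not> (\<exists>\<xi>\<in>tree_ends X d. fixes_ray_class g \<rho> \<xi>)))"

text \<open>A tree with a minimal action of a countable group is the union of the countably many
  segments joining points of one orbit, hence has at most the cardinality of the continuum.
  So every equivariant isometry class is realized by a tree whose underlying set is contained
  in \<^typ>\<open>real^3\<close>, the type that also carries \<^term>\<open>H3\<close>.\<close>

definition tree_points :: "nat \<Rightarrow> (real^3) gamma_space set set" where
  "tree_points g = isometry_class g ` Collect (admissible_tree_action g)"

section \<open>The compactification\<close>

definition points :: "nat \<Rightarrow> (real^3) gamma_space set set" where
  "points g = hyperbolic_points g \<union> tree_points g"

definition approximates :: "'a set \<Rightarrow> real \<Rightarrow> surface_elt set \<Rightarrow>
    'a gamma_space \<Rightarrow> 'a gamma_space \<Rightarrow> bool" where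
  "approximates K \<epsilon> P = (\<lambda>(X, d, \<rho>) (X', d', \<rho>').
    (\<exists>f \<in> K \<rightarrow> X'. \<forall>\<gamma>\<in>P. \<forall>\<eta>\<in>P. \<forall>x\<in>K. \<forall>y\<in>K.
      \<bar>d (\<rho> \<gamma> x) (\<rho> \<eta> y) - d' (\<rho>' \<gamma> (f x)) (\<rho>' \<eta> (f y))\<bar> < \<epsilon>) \<and>
    \<bar>hyp_const X d - hyp_const X' d'\<bar> < \<epsilon>)"

definition basic_nbhd :: "nat \<Rightarrow> (real^3) set \<Rightarrow> real \<Rightarrow> surface_elt set \<Rightarrow>
    (real^3) gamma_space \<Rightarrow> (real^3) gamma_space set set" where
  "basic_nbhd g K \<epsilon> P Y = {c \<in> points g. \<exists>Z\<in>c. approximates K \<epsilon> P Y Z}"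

definition basic_nbhds :: "nat \<Rightarrow> (real^3) gamma_space set set set" where
  "basic_nbhds g = {basic_nbhd g K \<epsilon> P Y | K \<epsilon> P Y.
    0 < \<epsilon> \<and> Y \<in> \<Union>(points g) \<and> finite K \<and> K \<subseteq> fst Y \<and>
    finite P \<and> P \<subseteq> carrier (surface_group g)}"

text \<open>The sets in \<^term>\<open>basic_nbhds g\<close> form a basis: if \<open>Z\<close> lies in finitely many of them, the
  defining strict inequalities leave some slack, and enlarging \<open>P\<close> and collecting the finitely
  many image points in \<open>Z\<close> gives a basic neighbourhood of \<open>Z\<close> inside all of them. So the
  generated topology is the one having them as basis.\<close>

definition points_topology :: "nat \<Rightarrow> (real^3) gamma_space set topology" where
  "points_topology g = topology_generated_by (basic_nbhds g)"

definition compactification :: "nat \<Rightarrow> (real^3) gamma_space set topology" where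
  "compactification g =
    subtopology (points_topology g) (points_topology g closure_of hyperbolic_points g)"

end

theory Submission
  imports Defs "HOL-Computational_Algebra.Polynomial"
begin

text \<open>A representation is a tuple of matrices in \<open>GL\<^sub>2\<close> up to scalars satisfying the surface relation
  up to a sign \<open>e\<close>. Tuples with the same sign are joined by polynomial curves: if \<open>[A\<^sub>i, B\<^sub>i] \<noteq> 1\<close> one
  moves all other matrices along straight lines, and then \<open>B\<^sub>i\<close> and \<open>A\<^sub>i\<close> can be solved for one after
  the other from linear equations; if all commutators are trivial the handles move independently.
  A curve leaves the admissible representations in finitely many parameters only, so what remains
  of the complex line is connected. The representations of sign \<open>1\<close> and those of sign \<open>- 1\<close> have a
  common limit: the line on which \<open>a\<^sub>2\<close> translates and \<open>b\<^sub>1\<close> reverses the orientation.\<close>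

section \<open>Complex two by two matrices\<close>

text \<open>The sign \<open>e\<close> is constant along every continuous family of representations,
  so the two kinds can only meet at a point that is not hyperbolic. A line serves because a
  half-turn about an axis is invisible on that axis: a commuting pair of lifts and an anticommuting
  one have the same limit. A second obstacle is that representations with exactly one fixed point at
  infinity are excluded. Irreducibility is therefore certified by the determinant of a commutator of
  two generators, which is polynomial. Invertible matrices with adjugates for inverses keep all
  words polynomial, with neither divisions nor square roots. The linear equations arise since the
  relation, solved for one handle, reads \<open>d A B = K B A\<close>, which is linear in
  \<open>A\<close> and in \<open>B\<close> separately. Genus at least 3 leaves a third handle to
  certify irreducibility while two others pass from commuting to noncommuting pairs with inverse
  commutators. Since the metrics are rescaled by the minimal displacement, a family of matrices
  gives a continuous family of points only once that displacement is known to be continuous; this is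
  where excluding a single fixed point enters.\<close>

datatype m2 = M2 (e11: complex) (e12: complex) (e21: complex) (e22: complex)

instantiation m2 :: ring_1
begin
definition "0 = M2 0 0 0 0"
definition "1 = M2 1 0 0 1"
definition "A + B = M2 (e11 A + e11 B) (e12 A + e12 B) (e21 A + e21 B) (e22 A + e22 B)"
definition "- A = M2 (- e11 A) (- e12 A) (- e21 A) (- e22 A)"
definition "A - B = M2 (e11 A - e11 B) (e12 A - e12 B) (e21 A - e21 B) (e22 A - e22 B)"
definition "A * B = M2 (e11 A * e11 B + e12 A * e21 B) (e11 A * e12 B + e12 A * e22 B)
  (e21 A * e11 B + e22 A * e21 B) (e21 A * e12 B + e22 A * e22 B)"
instance
  by standard (auto simp: zero_m2_def one_m2_def plus_m2_def uminus_m2_def minus_m2_def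
      times_m2_def algebra_simps)
end

definition cm :: "complex \<Rightarrow> m2" where "cm c = M2 c 0 0 c"
definition sc :: "complex \<Rightarrow> m2 \<Rightarrow> m2" where
  "sc c A = M2 (c * e11 A) (c * e12 A) (c * e21 A) (c * e22 A)"
text \<open>The adjugate stands in for the inverse: up to a scalar the two agree, and its entries
  are linear in those of \<open>A\<close>, so a word in the generators stays polynomial in a
  parameter.\<close>

definition adj :: "m2 \<Rightarrow> m2" where "adj A = M2 (e22 A) (- e12 A) (- e21 A) (e11 A)"
definition star :: "m2 \<Rightarrow> m2" where
  "star A = M2 (cnj (e11 A)) (cnj (e21 A)) (cnj (e12 A)) (cnj (e22 A))"
definition tr :: "m2 \<Rightarrow> complex" where "tr A = e11 A + e22 A"
definition dt :: "m2 \<Rightarrow> complex" where "dt A = e11 A * e22 A - e12 A * e21 A"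
text \<open>The squared Hilbert-Schmidt norm; it measures how far a matrix moves the base point of
  the half-space.\<close>

definition nrm2 :: "m2 \<Rightarrow> real" where
  "nrm2 A = (cmod (e11 A))\<^sup>2 + (cmod (e12 A))\<^sup>2 + (cmod (e21 A))\<^sup>2 + (cmod (e22 A))\<^sup>2"

lemmas m2_defs = zero_m2_def one_m2_def plus_m2_def uminus_m2_def minus_m2_def times_m2_def
  cm_def adj_def star_def tr_def dt_def

lemma m2_eq_iff: "A = B \<longleftrightarrow> e11 A = e11 B \<and> e12 A = e12 B \<and> e21 A = e21 B \<and> e22 A = e22 B"
  by (cases A; cases B) auto

lemma m2_sel [simp]:
  "e11 (A + B) = e11 A + e11 B" "e12 (A + B) = e12 A + e12 B"
  "e21 (A + B) = e21 A + e21 B" "e22 (A + B) = e22 A + e22 B"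
  "e11 (A - B) = e11 A - e11 B" "e12 (A - B) = e12 A - e12 B"
  "e21 (A - B) = e21 A - e21 B" "e22 (A - B) = e22 A - e22 B"
  "e11 (- A) = - e11 A" "e12 (- A) = - e12 A" "e21 (- A) = - e21 A" "e22 (- A) = - e22 A"
  "e11 (A * B) = e11 A * e11 B + e12 A * e21 B" "e12 (A * B) = e11 A * e12 B + e12 A * e22 B"
  "e21 (A * B) = e21 A * e11 B + e22 A * e21 B" "e22 (A * B) = e21 A * e12 B + e22 A * e22 B"
  "e11 0 = 0" "e12 0 = 0" "e21 0 = 0" "e22 0 = 0"
  "e11 1 = 1" "e12 1 = 0" "e21 1 = 0" "e22 1 = 1"
  "e11 (cm c) = c" "e12 (cm c) = 0" "e21 (cm c) = 0" "e22 (cm c) = c"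
  "e11 (adj A) = e22 A" "e12 (adj A) = - e12 A" "e21 (adj A) = - e21 A" "e22 (adj A) = e11 A"
  "e11 (star A) = cnj (e11 A)" "e12 (star A) = cnj (e21 A)"
  "e21 (star A) = cnj (e12 A)" "e22 (star A) = cnj (e22 A)"
  by (simp_all add: m2_defs)

lemma sc_sel [simp]: "e11 (sc c A) = c * e11 A" "e12 (sc c A) = c * e12 A"
  "e21 (sc c A) = c * e21 A" "e22 (sc c A) = c * e22 A"
  by (simp_all add: sc_def)

lemma sc_simps [simp]:
  "cm c * A = sc c A" "A * cm c = sc c A" "A * sc c B = sc c (A * B)" "sc c A * B = sc c (A * B)"
  "sc a (sc b A) = sc (a * b) A" "sc a (cm b) = cm (a * b)" "sc 1 A = A" "sc 0 A = 0" "sc c 0 = 0"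
  "sc c 1 = cm c" "dt (sc c A) = c\<^sup>2 * dt A" "tr (sc c A) = c * tr A" "adj (sc c A) = sc c (adj A)"
  "star (sc c A) = sc (cnj c) (star A)" "- sc c A = sc (- c) A"
  by (simp_all add: m2_eq_iff dt_def tr_def power2_eq_square algebra_simps)

lemma sc_distrib: "sc c (A + B) = sc c A + sc c B" "sc c (A - B) = sc c A - sc c B"
  "sc (a + b) A = sc a A + sc b A" "sc (a - b) A = sc a A - sc b A"
  by (simp_all add: m2_eq_iff algebra_simps)

lemma sc_cancel: "c \<noteq> 0 \<Longrightarrow> sc c A = sc c B \<longleftrightarrow> A = B" "sc c A = 0 \<longleftrightarrow> c = 0 \<or> A = 0"
  by (auto simp: m2_eq_iff)

lemma cm_simps [simp]:
  "cm a + cm b = cm (a + b)" "cm a - cm b = cm (a - b)" "- cm a = cm (- a)"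
  "cm 0 = 0" "cm 1 = 1" "dt (cm a) = a\<^sup>2" "adj (cm a) = cm a" "star (cm a) = cm (cnj a)"
  "cm a = cm b \<longleftrightarrow> a = b" "tr (cm a) = 2 * a" "cm a = 0 \<longleftrightarrow> a = 0"
  by (simp_all add: m2_eq_iff dt_def tr_def power2_eq_square algebra_simps)

lemma dt_simps [simp]: "dt (A * B) = dt A * dt B" "dt (adj A) = dt A" "dt (star A) = cnj (dt A)" "dt 1 = 1" "dt 0 = 0"
  by (simp_all add: dt_def algebra_simps)

lemma adj_simps [simp]:
  "adj (A * B) = adj B * adj A" "adj (adj A) = A" "adj 1 = 1" "adj 0 = 0"
  "adj (A + B) = adj A + adj B" "adj (A - B) = adj A - adj B" "adj (star A) = star (adj A)"
  by (simp_all add: m2_eq_iff algebra_simps)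

lemma star_simps [simp]: "star (A * B) = star B * star A" "star (star A) = A" "star 1 = 1"
  by (simp_all add: m2_eq_iff algebra_simps)

lemma adj_mult [simp]: "A * adj A = cm (dt A)" "adj A * A = cm (dt A)"
  "A * (adj A * B) = sc (dt A) B" "adj A * (A * B) = sc (dt A) B"
  by (simp_all add: m2_eq_iff dt_def algebra_simps)

lemma adj_eq: "adj A = cm (tr A) - A"
  by (simp add: m2_eq_iff tr_def)

lemma cayley: "A * A = sc (tr A) A - cm (dt A)"
  by (simp add: m2_eq_iff tr_def dt_def algebra_simps)

lemma tr_simps [simp]: "tr (A + B) = tr A + tr B" "tr (A - B) = tr A - tr B" "tr (adj A) = tr A" "tr 0 = 0"
  "tr 1 = 2"
  by (simp_all add: tr_def algebra_simps)

lemma tr_comm: "tr (A * B) = tr (B * A)"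
  by (simp add: tr_def algebra_simps)

lemma mult_left_cancel_m2: assumes "dt A \<noteq> 0" shows "A * B = A * C \<longleftrightarrow> B = C"
proof
  assume "A * B = A * C"
  then have "adj A * (A * B) = adj A * (A * C)" by simp
  then show "B = C" using assms by (simp add: sc_cancel)
qed simp

lemma mult_right_cancel_m2: assumes "dt A \<noteq> 0" shows "B * A = C * A \<longleftrightarrow> B = C"
proof
  assume "B * A = C * A"
  then have "B * A * adj A = C * A * adj A" by simp
  then show "B = C" using assms by (simp add: mult.assoc sc_cancel)
qed simp

lemma nrm2_eq: "of_real (nrm2 A) = tr (A * star A)"
  unfolding nrm2_def tr_def of_real_add of_real_power complex_norm_square[symmetric]
  by (simp add: complex_norm_square[symmetric])

lemma nrm2_star [simp]: "nrm2 (star A) = nrm2 A" "nrm2 (adj A) = nrm2 A"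
  by (simp_all add: nrm2_def)

lemma nrm2_cm [simp]: "nrm2 (sc c A) = (cmod c)\<^sup>2 * nrm2 A"
  by (simp add: nrm2_def norm_mult power_mult_distrib algebra_simps)

section \<open>The action on the upper half-space\<close>

text \<open>A point \<open>(z, t)\<close> corresponds to a positive Hermitian matrix of determinant 1, on which
  \<open>M\<close> acts by \<open>H \<mapsto> M H M\<^sup>* / |det M|\<close>.\<close>

definition cz :: "real^3 \<Rightarrow> complex" where "cz x = Complex (x $ 1) (x $ 2)"

definition herm :: "real^3 \<Rightarrow> m2" where
  "herm x = M2 (of_real (((cmod (cz x))\<^sup>2 + (x $ 3)\<^sup>2) / x $ 3)) (cz x / of_real (x $ 3))
     (cnj (cz x) / of_real (x $ 3)) (of_real (1 / x $ 3))"

definition unherm :: "m2 \<Rightarrow> real^3" where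
  "unherm H = vector [Re (e12 H / e22 H), Im (e12 H / e22 H), 1 / Re (e22 H)]"

definition act :: "m2 \<Rightarrow> real^3 \<Rightarrow> real^3" where
  "act M x = unherm (sc (of_real (1 / cmod (dt M))) (M * herm x * star M))"

lemma vec3_eq: "x = y \<longleftrightarrow> x $ 1 = y $ 1 \<and> x $ 2 = y $ 2 \<and> x $ 3 = (y :: real^3) $ 3"
  by (simp add: vec_eq_iff forall_3)

lemma cz_eq: "x = y \<longleftrightarrow> cz x = cz y \<and> x $ 3 = y $ 3"
  by (auto simp: vec3_eq cz_def)

lemma mult_cnj_cmod: "z * cnj z = of_real ((cmod z)\<^sup>2)"
  by (simp only: complex_norm_square)

lemma cmod_sq: "complex_of_real (cmod z) * complex_of_real (cmod z) = z * cnj z"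
  "complex_of_real (cmod z) * (complex_of_real (cmod z) * w) = z * cnj z * w"
  by (simp_all add: mult_cnj_cmod power2_eq_square)

text \<open>In a Hermitian matrix of determinant 1 the entries \<open>e12\<close> and
  \<open>e22\<close> determine \<open>e21\<close> by symmetry and \<open>e11\<close> by the
  determinant. So \<open>unherm\<close>, which reads only those two, loses nothing, and the sign of
  \<open>e22\<close> makes the height positive.\<close>

lemma herm_unherm:
  assumes "star H = H" "dt H = 1" "0 < Re (e22 H)"
  shows "unherm H \<in> H3" "herm (unherm H) = H"
proof -
  define t z where "t = Re (e22 H)" and "z = e12 H"
  have "e22 (star H) = e22 H" "e21 (star H) = e21 H" by (simp_all only: assms(1))
  then have "cnj (e22 H) = e22 H" and c: "cnj z = e21 H" by (simp_all add: z_def)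
  then have t: "e22 H = of_real t" by (metis t_def Reals_cnj_iff of_real_Re)
  have tp: "0 < t" using assms by (simp add: t_def)
  have "e11 H * e22 H - z * cnj z = 1"
    using assms(2) c by (simp add: dt_def z_def)
  then have d: "e11 H * of_real t = 1 + of_real ((cmod z)\<^sup>2)"
    by (simp add: t mult_cnj_cmod algebra_simps)
  have e: "e11 H = of_real ((1 + (cmod z)\<^sup>2) / t)"
    using tp d by (simp add: nonzero_eq_divide_eq)
  have u3: "unherm H $ 3 = 1 / t" by (simp add: unherm_def t_def)
  then show "unherm H \<in> H3" using tp by (simp add: H3_def)
  have cu: "cz (unherm H) = z / of_real t" by (simp add: unherm_def cz_def t z_def complex_eq_iff)
  have "((cmod (cz (unherm H)))\<^sup>2 + (unherm H $ 3)\<^sup>2) / unherm H $ 3 = (1 + (cmod z)\<^sup>2) / t"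
    using tp by (simp add: cu u3 norm_divide field_simps power2_eq_square)
  then have "e11 (herm (unherm H)) = e11 H"
    by (simp add: herm_def e)
  moreover have "e12 (herm (unherm H)) = e12 H" "e21 (herm (unherm H)) = e21 H" "e22 (herm (unherm H)) = e22 H"
    using tp by (simp_all add: herm_def cu u3 c t z_def[symmetric])
  ultimately show "herm (unherm H) = H"
    by (simp add: m2_eq_iff)
qed

lemma unherm_herm: "x \<in> H3 \<Longrightarrow> unherm (herm x) = x"
  by (simp add: vec3_eq unherm_def herm_def H3_def cz_def)

lemma herm_inj: "x \<in> H3 \<Longrightarrow> y \<in> H3 \<Longrightarrow> herm x = herm y \<longleftrightarrow> x = y"
  using unherm_herm by metis

lemma herm_props:
  assumes "x \<in> H3"
  shows "star (herm x) = herm x" "dt (herm x) = 1" "0 < Re (e22 (herm x))"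
proof -
  have t: "0 < x $ 3" using assms by (simp add: H3_def)
  show "star (herm x) = herm x" by (simp add: m2_eq_iff herm_def)
  have "dt (herm x) = of_real (((cmod (cz x))\<^sup>2 + (x $ 3)\<^sup>2) / x $ 3) * of_real (1 / x $ 3)
    - of_real ((cmod (cz x))\<^sup>2) / of_real (x $ 3 * x $ 3)"
    by (simp add: herm_def dt_def mult_cnj_cmod)
  also have "\<dots> = of_real (((cmod (cz x))\<^sup>2 + (x $ 3)\<^sup>2) / x $ 3 * (1 / x $ 3) - (cmod (cz x))\<^sup>2 / (x $ 3 * x $ 3))"
    by simp
  also have "((cmod (cz x))\<^sup>2 + (x $ 3)\<^sup>2) / x $ 3 * (1 / x $ 3) - (cmod (cz x))\<^sup>2 / (x $ 3 * x $ 3) = 1"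
    using t by (simp add: field_simps power2_eq_square)
  finally show "dt (herm x) = 1" by simp
  show "0 < Re (e22 (herm x))" using t by (simp add: herm_def)
qed

text \<open>Divided by \<open>cmod (dt M)\<close> this is the reciprocal height of the image point,
  the denominator in the Poincare extension of a Moebius map. Its positivity keeps the image inside
  the half-space.\<close>

lemma e22_conj_herm:
  assumes "x \<in> H3"
  shows "e22 (M * herm x * star M) =
    of_real (((cmod (e21 M * cz x + e22 M))\<^sup>2 + (cmod (e21 M))\<^sup>2 * (x $ 3)\<^sup>2) / x $ 3)"
proof -
  have t: "0 < x $ 3" using assms by (simp add: H3_def)
  define u v z t where uv: "u = e21 M" "v = e22 M" "z = cz x" "t = complex_of_real (x $ 3)"
  have t0: "t \<noteq> 0" using t by (simp add: uv)
  have "e22 (M * herm x * star M) = (u * ((z * cnj z + t * t) / t) + v * (cnj z / t)) * cnj u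
     + (u * (z / t) + v * (1 / t)) * cnj v"
    by (simp add: herm_def uv power2_eq_square cmod_sq)
  also have "\<dots> = ((u * z + v) * cnj (u * z + v) + u * cnj u * (t * t)) / t"
    using t0 by (simp add: field_simps)
  also have "\<dots> = of_real (((cmod (e21 M * cz x + e22 M))\<^sup>2 + (cmod (e21 M))\<^sup>2 * (x $ 3)\<^sup>2) / x $ 3)"
    by (simp add: uv power2_eq_square cmod_sq)
  finally show ?thesis .
qed

lemma herm_act:
  assumes "dt M \<noteq> 0" "x \<in> H3"
  shows "act M x \<in> H3" "herm (act M x) = sc (of_real (1 / cmod (dt M))) (M * herm x * star M)"
proof -
  define H where "H = sc (of_real (1 / cmod (dt M))) (M * herm x * star M)"
  have p: "0 < cmod (dt M)" using assms by simp
  have "star (M * herm x * star M) = M * herm x * star M"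
    using herm_props(1)[OF assms(2)] by (simp add: mult.assoc)
  then have "star H = H"
    unfolding H_def by (simp only: sc_simps complex_cnj_complex_of_real)
  moreover have "dt H = of_real ((1 / cmod (dt M))\<^sup>2 * (cmod (dt M))\<^sup>2)"
    using assms by (simp add: H_def herm_props mult_cnj_cmod)
  then have "dt H = 1" using p by (simp add: power_divide)
  moreover have "0 < Re (e22 H)"
  proof -
    have "e21 M \<noteq> 0 \<or> e22 M \<noteq> 0" using assms by (auto simp: dt_def)
    then have "0 < (cmod (e21 M * cz x + e22 M))\<^sup>2 + (cmod (e21 M))\<^sup>2 * (x $ 3)\<^sup>2"
      using assms by (cases "e21 M = 0") (auto intro!: add_nonneg_pos simp: H3_def)
    then have "0 < Re (e22 (M * herm x * star M))"
      using assms unfolding e22_conj_herm[OF assms(2)] by (simp add: H3_def)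
    then show ?thesis using p unfolding H_def sc_sel by (simp del: m2_sel)
  qed
  ultimately show "act M x \<in> H3" "herm (act M x) = H"
    using herm_unherm[of H] by (simp_all add: act_def H_def)
qed

definition jpt :: "real^3" where "jpt = vector [0, 0, 1]"
definition vp :: "real \<Rightarrow> real^3" where "vp u = vector [0, 0, u]"

lemma vp_simps [simp]: "vp u $ 1 = 0" "vp u $ 2 = 0" "vp u $ 3 = u" "cz (vp u) = 0" "vp u \<in> H3 \<longleftrightarrow> 0 < u"
  "vp u = vp v \<longleftrightarrow> u = v"
  by (auto simp: vp_def cz_def H3_def vec3_eq complex_eq_iff)

lemma jpt_eq: "jpt = vp 1" by (simp add: jpt_def vp_def)

lemma jpt_H3 [simp]: "jpt \<in> H3" by (simp add: jpt_eq)

lemma herm_vp: "u \<noteq> 0 \<Longrightarrow> herm (vp u) = M2 (of_real u) 0 0 (of_real (1 / u))"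
  by (simp add: herm_def power2_eq_square)

lemma herm_jpt [simp]: "herm jpt = 1"
  by (simp add: jpt_eq herm_vp m2_eq_iff)

lemma act_mult:
  assumes "dt M \<noteq> 0" "dt N \<noteq> 0" "x \<in> H3"
  shows "act (M * N) x = act M (act N x)"
proof -
  have N: "act N x \<in> H3" using herm_act assms by blast
  have MN: "dt (M * N) \<noteq> 0" using assms by simp
  have "herm (act (M * N) x) = herm (act M (act N x))"
    unfolding herm_act(2)[OF MN assms(3)] herm_act(2)[OF assms(1) N] herm_act(2)[OF assms(2,3)]
    by (simp add: mult.assoc norm_mult)
  then show ?thesis using herm_inj herm_act N assms MN by metis
qed

lemma act_cm: "c \<noteq> 0 \<Longrightarrow> x \<in> H3 \<Longrightarrow> act (cm c) x = x"
proof -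
  assume "c \<noteq> 0" "x \<in> H3"
  then have "herm (act (cm c) x) = herm x"
    by (simp add: herm_act norm_power mult_cnj_cmod mult.commute[of "cnj c"])
  then show ?thesis using herm_inj herm_act \<open>x \<in> H3\<close> \<open>c \<noteq> 0\<close> by (metis cm_simps(6) zero_eq_power2)
qed

lemma act_1 [simp]: "x \<in> H3 \<Longrightarrow> act 1 x = x"
  using act_cm[of 1] by simp

lemma act_scale: "c \<noteq> 0 \<Longrightarrow> dt M \<noteq> 0 \<Longrightarrow> x \<in> H3 \<Longrightarrow> act (sc c M) x = act M x"
  using act_mult[of "cm c" M x] act_cm herm_act by simp

lemma act_in [simp]: "dt M \<noteq> 0 \<Longrightarrow> x \<in> H3 \<Longrightarrow> act M x \<in> H3"
  by (rule herm_act)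

lemma act_adj [simp]: "dt M \<noteq> 0 \<Longrightarrow> x \<in> H3 \<Longrightarrow> act (adj M) (act M x) = x"
  "dt M \<noteq> 0 \<Longrightarrow> x \<in> H3 \<Longrightarrow> act M (act (adj M) x) = x"
  by (simp_all flip: act_mult add: act_cm)

section \<open>Hyperbolic distance in terms of matrices\<close>

lemma norm_vec3: "(norm (x - y))\<^sup>2 = (cmod (cz x - cz y))\<^sup>2 + (x $ 3 - y $ 3)\<^sup>2" for x y :: "real^3"
proof -
  have "(cmod (cz x - cz y))\<^sup>2 = (x $ 1 - y $ 1)\<^sup>2 + (x $ 2 - y $ 2)\<^sup>2"
    by (simp add: cmod_power2 cz_def)
  then show ?thesis using power2_norm_eq_inner[of "x - y"]
    by (simp add: inner_vec_def sum_3 power2_eq_square)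
qed

lemma hdist_sym: "hdist x y = hdist y x" and hdist_nonneg [simp]: "0 \<le> hdist x y"
  and hdist_0: "x \<in> H3 \<Longrightarrow> y \<in> H3 \<Longrightarrow> hdist x y = 0 \<longleftrightarrow> x = y"
  and hdist_triangle: "x \<in> H3 \<Longrightarrow> y \<in> H3 \<Longrightarrow> z \<in> H3 \<Longrightarrow> hdist x z \<le> hdist x y + hdist y z"
  using Metric_space_H3 by (auto simp: Metric_space_def)

lemma hdist_self [simp]: "x \<in> H3 \<Longrightarrow> hdist x x = 0"
  using hdist_0 by blast

lemma cosh_hdist:
  assumes "x \<in> H3" "y \<in> H3"
  shows "2 * cosh (hdist x y) = ((cmod (cz x - cz y))\<^sup>2 + (x $ 3)\<^sup>2 + (y $ 3)\<^sup>2) / (x $ 3 * y $ 3)"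
proof -
  have p: "0 < x $ 3" "0 < y $ 3" using assms by (auto simp: H3_def)
  then have "1 \<le> 1 + (norm (x - y))\<^sup>2 / (2 * x $ 3 * y $ 3)" by simp
  then have "cosh (hdist x y) = 1 + (norm (x - y))\<^sup>2 / (2 * x $ 3 * y $ 3)"
    using assms by (simp add: hdist_def cosh_arcosh_real)
  then show ?thesis
    using p unfolding norm_vec3 by (simp add: field_simps power2_eq_square)
qed

text \<open>\<open>tr (H * adj K)\<close> is the bilinear form with value \<open>2 * dt H\<close> on
  the diagonal, the Minkowski form on Hermitian matrices. Invariance of the distance under
  \<open>act\<close> then comes down to cyclicity of the trace.\<close>

lemma cosh_hdist_tr:
  assumes "x \<in> H3" "y \<in> H3"
  shows "of_real (2 * cosh (hdist x y)) = tr (herm x * adj (herm y))"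
proof -
  have p: "0 < x $ 3" "0 < y $ 3" using assms by (auto simp: H3_def)
  define a b s t where ab: "a = cz x" "b = cz y" "s = complex_of_real (x $ 3)" "t = complex_of_real (y $ 3)"
  have st: "s \<noteq> 0" "t \<noteq> 0" using p by (simp_all add: ab)
  have "of_real (2 * cosh (hdist x y)) = ((a - b) * cnj (a - b) + s * s + t * t) / (s * t)"
    unfolding cosh_hdist[OF assms] by (simp add: ab power2_eq_square cmod_sq)
  also have "\<dots> = (a * cnj a + s * s) / s * (1 / t) - a / s * (cnj b / t) - cnj a / s * (b / t) + 1 / s * ((b * cnj b + t * t) / t)"
    using st by (simp add: field_simps)
  also have "\<dots> = tr (herm x * adj (herm y))"
    by (simp add: tr_def herm_def ab power2_eq_square cmod_sq)
  finally show ?thesis .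
qed

lemma hdist_eq_cosh: "hdist x y = hdist z w \<longleftrightarrow> cosh (hdist x y) = cosh (hdist z w)"
  by (metis cosh_real_nonneg_le_iff hdist_nonneg order_antisym order_refl)

lemma hdist_act [simp]:
  assumes "dt M \<noteq> 0" "x \<in> H3" "y \<in> H3"
  shows "hdist (act M x) (act M y) = hdist x y"
proof -
  let ?r = "complex_of_real (1 / cmod (dt M))"
  have a: "star M * (adj (star M) * Y) = sc (cnj (dt M)) Y" for Y
    by (metis adj_mult(3) dt_simps(3))
  have "herm (act M x) * adj (herm (act M y)) = sc (?r * ?r * cnj (dt M)) (M * (herm x * (adj (herm y) * adj M)))"
    using assms a by (simp add: herm_act mult.assoc del: adj_simps(7))
  then have "tr (herm (act M x) * adj (herm (act M y))) = ?r * ?r * cnj (dt M) * tr (M * (herm x * (adj (herm y) * adj M)))"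
    by simp
  also have "tr (M * (herm x * (adj (herm y) * adj M))) = dt M * tr (herm x * adj (herm y))"
    unfolding tr_comm[of M] by (simp add: mult.assoc)
  also have "?r * ?r * cnj (dt M) * (dt M * tr (herm x * adj (herm y))) = ?r * ?r * (dt M * cnj (dt M)) * tr (herm x * adj (herm y))"
    by simp
  also have "\<dots> = tr (herm x * adj (herm y))"
    using assms unfolding mult_cnj_cmod by (simp add: power2_eq_square)
  finally have "complex_of_real (2 * cosh (hdist (act M x) (act M y))) = of_real (2 * cosh (hdist x y))"
    using assms cosh_hdist_tr act_in by metis
  then show ?thesis
    unfolding of_real_eq_iff hdist_eq_cosh by simp
qed

text \<open>Bounded displacement thereby becomes an inequality between continuous functions of the
  matrix entries.\<close>

lemma hdist_jpt: "dt M \<noteq> 0 \<Longrightarrow> 2 * cosh (hdist jpt (act M jpt)) = nrm2 M / cmod (dt M)"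
proof -
  assume d: "dt M \<noteq> 0"
  let ?r = "complex_of_real (1 / cmod (dt M))"
  have "complex_of_real (2 * cosh (hdist jpt (act M jpt))) = tr (adj (herm (act M jpt)))"
    using d cosh_hdist_tr[of jpt "act M jpt"] by simp
  also have "adj (herm (act M jpt)) = sc ?r (star (adj M) * adj M)"
    using d by (simp add: herm_act)
  also have "tr \<dots> = of_real (1 / cmod (dt M) * nrm2 M)"
    unfolding sc_simps tr_comm[of "star (adj M)"] by (simp flip: nrm2_eq)
  finally show ?thesis unfolding of_real_eq_iff by simp
qed

lemma hdist_disp:
  assumes "dt M \<noteq> 0" "dt g \<noteq> 0"
  shows "2 * cosh (hdist (act g jpt) (act M (act g jpt))) = nrm2 (adj g * M * g) / (cmod (dt M) * (cmod (dt g))\<^sup>2)"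
proof -
  have "hdist (act g jpt) (act M (act g jpt)) = hdist (act (adj g) (act g jpt)) (act (adj g) (act M (act g jpt)))"
    using assms by (simp del: act_adj)
  also have "act (adj g) (act M (act g jpt)) = act (adj g * M * g) jpt"
    using assms by (simp add: act_mult)
  finally show ?thesis using assms hdist_jpt[of "adj g * M * g"]
    by (simp add: norm_mult power2_eq_square mult_ac)
qed

section \<open>Transitivity on points and on pairs of points\<close>

lemma act_trans:
  assumes "x \<in> H3"
  obtains g where "dt g \<noteq> 0" "x = act g jpt"
proof
  let ?t = "complex_of_real (x $ 3)"
  \<comment> \<open>The similarity that multiplies by the height of \<open>x\<close> and then
    translates by its horizontal coordinate.\<close>
  let ?g = "M2 ?t (cz x) 0 1"
  have t: "0 < x $ 3" using assms by (simp add: H3_def)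
  show d: "dt ?g \<noteq> 0" using t by (simp add: dt_def)
  have "dt ?g = ?t" by (simp add: dt_def)
  then have "herm (act ?g jpt) = herm x"
    using t d by (simp add: herm_act m2_eq_iff)
      (simp add: herm_def power2_eq_square cmod_sq add.commute divide_simps)
  then show "x = act ?g jpt" using herm_inj assms d act_in jpt_H3 by metis
qed

lemma hdist_vp: "0 < u \<Longrightarrow> 0 < v \<Longrightarrow> hdist (vp u) (vp v) = \<bar>ln u - ln v\<bar>"
proof -
  assume uv: "0 < u" "0 < v"
  have "2 * cosh (hdist (vp u) (vp v)) = 2 * cosh (ln (u / v))"
    using uv by (subst cosh_hdist) (simp_all add: cosh_ln_real field_simps power2_eq_square)
  then have "cosh (hdist (vp u) (vp v)) = cosh \<bar>ln u - ln v\<bar>"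
    using uv by (simp add: ln_div)
  then show ?thesis
    by (metis abs_ge_zero cosh_real_nonneg_le_iff hdist_nonneg order_antisym order_refl)
qed

text \<open>Dropping the horizontal term in \<open>cosh_hdist\<close> decreases it: moving points
  horizontally onto the vertical axis does not increase distances. Displacements are later bounded
  from below by this.\<close>

lemma hdist_height:
  assumes "x \<in> H3" "y \<in> H3"
  shows "\<bar>ln (x $ 3) - ln (y $ 3)\<bar> \<le> hdist x y"
proof -
  have p: "0 < x $ 3" "0 < y $ 3" using assms by (auto simp: H3_def)
  have "cosh (hdist (vp (x $ 3)) (vp (y $ 3))) \<le> cosh (hdist x y)"
    using p cosh_hdist[OF assms] cosh_hdist[of "vp (x $ 3)" "vp (y $ 3)"]
      divide_right_mono[of "(x $ 3)\<^sup>2 + (y $ 3)\<^sup>2" "(cmod (cz x - cz y))\<^sup>2 + (x $ 3)\<^sup>2 + (y $ 3)\<^sup>2" "x $ 3 * y $ 3"]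
    by simp
  then show ?thesis
    using p cosh_real_nonneg_le_iff[of "hdist (vp (x $ 3)) (vp (y $ 3))" "hdist x y"] by (simp only: hdist_vp hdist_nonneg simp_thms)
qed

text \<open>The second point is reached by diagonalizing its Hermitian matrix: \<open>v = (h\<^sub>1\<^sub>2, \<lambda> - h\<^sub>1\<^sub>1)\<close> is
  an eigenvector.\<close>

lemma sphere_trans:
  assumes "y \<in> H3"
  obtains M \<tau> where "dt M \<noteq> 0" "1 \<le> \<tau>" "act M jpt = jpt" "act M (vp \<tau>) = y"
proof -
  define H where "H = herm y"
  define a d z where adz: "a = Re (e11 H)" "d = Re (e22 H)" "z = e12 H"
  have y3: "0 < y $ 3" using assms by (simp add: H3_def)
  have H: "H = M2 (of_real a) z (cnj z) (of_real d)" unfolding adz H_def by (simp add: m2_eq_iff herm_def)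
  have ap: "0 < a" "0 < d" using y3 by (simp_all add: adz H_def herm_def add_nonneg_pos)
  have "dt H = 1" using herm_props assms by (simp add: H_def)
  then have "complex_of_real (a * d - (cmod z)\<^sup>2) = 1" by (simp add: H dt_def mult_cnj_cmod)
  then have det: "a * d - (cmod z)\<^sup>2 = 1" by (metis of_real_eq_1_iff)
  define T where "T = a + d"
  have "(a - d)\<^sup>2 + 4 * (cmod z)\<^sup>2 \<ge> 0" by simp
  then have T2: "T\<^sup>2 - 4 \<ge> 0" using det by (simp add: T_def power2_eq_square algebra_simps)
  obtain s where s: "0 \<le> s" "s\<^sup>2 = T\<^sup>2 - 4"
    using T2 by (metis real_sqrt_ge_zero real_sqrt_pow2)
  \<comment> \<open>The larger eigenvalue of \<open>H\<close>; it becomes the height \<tau> of the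
    point on the axis.\<close>
  define l where "l = (T + s) / 2"
  have Tp: "0 < T" using ap by (simp add: T_def)
  then have T2': "T \<ge> 2" using T2 power2_le_imp_le[of 2 T] by simp
  then have l1: "1 \<le> l" using s(1) T2' unfolding l_def by simp
  have "2 * l - T = s" by (simp add: l_def field_simps)
  then have "(2 * l - T)\<^sup>2 = T\<^sup>2 - 4" using s(2) by simp
  then have l: "l\<^sup>2 - T * l + 1 = 0" by (simp add: power2_eq_square algebra_simps)
  \<comment> \<open>Orthogonal columns of equal length make \<open>M\<close> fix \<open>jpt\<close>;
    being eigenvectors of \<open>H\<close>, they make it carry \<open>vp l\<close> to
    \<open>y\<close>.\<close>
  have key: "\<exists>M. dt M \<noteq> 0 \<and> (\<exists>r>0. M * star M = cm (of_real r)) \<and> H * M = M * M2 (of_real l) 0 0 (of_real (1 / l))"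
  \<comment> \<open>For \<open>z = 0\<close> the eigenvector of the general case may vanish;
    \<open>H\<close> is then diagonal and only the order of its two entries is in question.\<close>
  proof (cases "z = 0")
    case True
    then have "a * d = 1" using det by simp
    then have d: "d = 1 / a" using ap by (simp add: field_simps)
    have "(2 * l - T)\<^sup>2 = (a - d)\<^sup>2" using \<open>(2 * l - T)\<^sup>2 = T\<^sup>2 - 4\<close> \<open>a * d = 1\<close>
      by (simp add: T_def power2_eq_square algebra_simps)
    then have "2 * l - T = a - d \<or> 2 * l - T = d - a" by (simp add: power2_eq_iff)
    then have "l = a \<or> l = d" by (auto simp: T_def)
    then show ?thesis
    proof
      assume "l = a"
      then show ?thesis using d True by (intro exI[of _ 1] conjI exI[of _ 1]) (auto simp: H)
    next
      assume "l = d"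
      then have "a = 1 / l" using d ap by simp
      then show ?thesis using \<open>l = d\<close> True
        by (intro exI[of _ "M2 0 1 1 0"] conjI exI[of _ 1]) (auto simp: H m2_eq_iff dt_def)
    qed
  next
    case False
    define w where "w = complex_of_real (l - a)"
    let ?M = "M2 z (- cnj w) w (cnj z)"
    have cw: "cnj w = w" by (simp add: w_def)
    have d: "dt ?M = of_real ((cmod z)\<^sup>2 + (l - a)\<^sup>2)"
      by (simp add: dt_def cw) (simp add: w_def cmod_sq power2_eq_square)
    have rp: "0 < (cmod z)\<^sup>2 + (l - a)\<^sup>2" using False by (simp add: add_pos_nonneg)
    have MM: "?M * star ?M = cm (of_real ((cmod z)\<^sup>2 + (l - a)\<^sup>2))"
      by (simp add: m2_eq_iff cw) (simp add: w_def cmod_sq power2_eq_square algebra_simps)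
    define L A D where "L = complex_of_real l" and "A = complex_of_real a" and "D = complex_of_real d"
    have L0: "L \<noteq> 0" using l1 by (simp add: L_def)
    have "complex_of_real (l\<^sup>2 - T * l + 1) = 0" using l by simp
    then have Leq: "L * L = (A + D) * L - 1" by (simp add: L_def A_def D_def T_def power2_eq_square algebra_simps)
    have zz: "z * cnj z = A * D - 1"
    proof -
      have "complex_of_real ((cmod z)\<^sup>2) = of_real (a * d - 1)"
        using det by (intro arg_cong[where f = of_real]) linarith
      then show ?thesis unfolding mult_cnj_cmod by (simp add: A_def D_def)
    qed
    have w: "w = L - A" by (simp add: w_def L_def A_def)
    have iL: "1 / L = A + D - L" using L0 Leq by (simp add: field_simps)
    have "H * ?M = ?M * M2 L 0 0 (1 / L)"
      unfolding iL cw unfolding w H by (simp add: m2_eq_iff A_def[symmetric] D_def[symmetric] zz)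
        (simp add: algebra_simps Leq zz)
    moreover have "dt ?M \<noteq> 0" unfolding d of_real_eq_0_iff using False by (simp add: add_pos_nonneg less_imp_neq[symmetric])
    ultimately show ?thesis using rp MM unfolding L_def by (metis of_real_1 of_real_divide)
  qed
  then obtain M r where M: "dt M \<noteq> 0" "0 < r" "M * star M = cm (of_real r)"
    "H * M = M * M2 (of_real l) 0 0 (of_real (1 / l))" by blast
  have "dt (M * star M) = of_real (r\<^sup>2)" using M(3) by simp
  then have "complex_of_real ((cmod (dt M))\<^sup>2) = of_real (r\<^sup>2)" by (simp add: mult_cnj_cmod)
  then have r: "cmod (dt M) = r" using M(2) by (simp only: of_real_eq_iff) (simp add: power2_eq_iff_nonneg)
  have "herm (act M jpt) = herm jpt"
    using M r by (simp add: herm_act mult.assoc)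
  then have 1: "act M jpt = jpt" using herm_inj M(1) act_in jpt_H3 by metis
  have "herm (act M (vp l)) = sc (of_real (1 / r)) (H * (M * star M))"
    using M(1) l1 by (simp add: herm_act r herm_vp mult.assoc[symmetric] M(4))
  also have "\<dots> = H" using M(2) by (simp add: M(3))
  finally have "act M (vp l) = y" using herm_inj M(1) act_in assms l1 by (simp add: H_def)
  then show ?thesis using that M(1) l1 1 by blast
qed

text \<open>Once the first point is moved to \<open>jpt\<close>, the stabilizer of
  \<open>jpt\<close> is transitive on the spheres about it.\<close>

lemma two_point:
  assumes "x \<in> H3" "y \<in> H3"
  obtains M where "dt M \<noteq> 0" "act M jpt = x" "act M (vp (exp (hdist x y))) = y"
proof -
  obtain g where g: "dt g \<noteq> 0" "x = act g jpt" using act_trans assms by blast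
  obtain N \<tau> where N: "dt N \<noteq> 0" "1 \<le> \<tau>" "act N jpt = jpt" "act N (vp \<tau>) = act (adj g) y"
    using sphere_trans[of "act (adj g) y"] g assms by auto
  have M: "dt (g * N) \<noteq> 0" "act (g * N) jpt = x" "act (g * N) (vp \<tau>) = y"
    using g N assms by (simp_all add: act_mult)
  have "hdist x y = hdist jpt (vp \<tau>)" using M N(2) hdist_act[OF M(1), of jpt "vp \<tau>"] by simp
  also have "\<dots> = ln \<tau>" using N(2) by (simp add: jpt_eq hdist_vp)
  finally have "\<tau> = exp (hdist x y)" using N(2) by simp
  then show ?thesis using that[OF M(1,2)] M(3) by simp
qed

lemma cz_act: "cz (act M x) = e12 (M * herm x * star M) / e22 (M * herm x * star M)"
  if "dt M \<noteq> 0" "x \<in> H3"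
  using that by (simp add: act_def unherm_def cz_def complex_eq_iff del: m2_sel)

lemma height_act:
  assumes "dt M \<noteq> 0" "x \<in> H3"
  shows "act M x $ 3 = cmod (dt M) * x $ 3 / ((cmod (e21 M * cz x + e22 M))\<^sup>2 + (cmod (e21 M))\<^sup>2 * (x $ 3)\<^sup>2)"
  by (simp add: act_def unherm_def e22_conj_herm[OF assms(2)] del: m2_sel)

lemma act_affine:
  assumes "a \<noteq> 0" "x \<in> H3"
  shows "cz (act (M2 a b 0 1) x) = a * cz x + b" "act (M2 a b 0 1) x $ 3 = cmod a * x $ 3"
proof -
  have d: "dt (M2 a b 0 1) \<noteq> 0" using assms by (simp add: dt_def)
  have t: "0 < x $ 3" using assms by (simp add: H3_def)
  show "cz (act (M2 a b 0 1) x) = a * cz x + b"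
    unfolding cz_act[OF d assms(2)] using t by (simp add: herm_def field_simps)
  show "act (M2 a b 0 1) x $ 3 = cmod a * x $ 3"
    unfolding height_act[OF d assms(2)] by (simp add: dt_def)
qed

lemma act_flip:
  assumes "x \<in> H3"
  shows "cz (act (M2 0 1 1 0) x) = cnj (cz x) / of_real ((cmod (cz x))\<^sup>2 + (x $ 3)\<^sup>2)"
    "act (M2 0 1 1 0) x $ 3 = x $ 3 / ((cmod (cz x))\<^sup>2 + (x $ 3)\<^sup>2)"
proof -
  have d: "dt (M2 0 1 1 0) \<noteq> 0" by (simp add: dt_def)
  have t: "0 < x $ 3" using assms by (simp add: H3_def)
  show "cz (act (M2 0 1 1 0) x) = cnj (cz x) / of_real ((cmod (cz x))\<^sup>2 + (x $ 3)\<^sup>2)"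
    unfolding cz_act[OF d assms] using t by (simp add: herm_def)
  show "act (M2 0 1 1 0) x $ 3 = x $ 3 / ((cmod (cz x))\<^sup>2 + (x $ 3)\<^sup>2)"
    unfolding height_act[OF d assms] by (simp add: dt_def)
qed

text \<open>The points \<open>x\<close> and \<open>y\<close> lie on the same spheres about two
  points of the axis. Subtracting the two equations eliminates \<open>R\<close> and
  \<open>S\<close>, and \<open>u \<noteq> 1\<close> keeps the remaining factor
  \<open>u\<^sup>2 - 1\<close> from vanishing.\<close>

lemma height_from_dist:
  assumes H: "x \<in> H3" "y \<in> H3" "0 < u" "u \<noteq> 1"
    and 1: "hdist jpt x = hdist jpt y" and u: "hdist (vp u) x = hdist (vp u) y"
  shows "x $ 3 = y $ 3" "cmod (cz x) = cmod (cz y)"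
proof -
  define R S s t where R: "R = (cmod (cz x))\<^sup>2 + (x $ 3)\<^sup>2" "S = (cmod (cz y))\<^sup>2 + (y $ 3)\<^sup>2"
    and st: "s = x $ 3" "t = y $ 3"
  have p: "0 < s" "0 < t" using H by (auto simp: H3_def st)
  have "2 * cosh (hdist jpt x) = 2 * cosh (hdist jpt y)" "2 * cosh (hdist (vp u) x) = 2 * cosh (hdist (vp u) y)"
    using 1 u by simp_all
  then have "(R + 1) / s = (S + 1) / t" "(R + u\<^sup>2) / (u * s) = (S + u\<^sup>2) / (u * t)"
    using H by (simp_all add: cosh_hdist jpt_eq R st add_ac)
  then have "(R + 1) / s = (S + 1) / t" "u * ((R + u\<^sup>2) / (u * s)) = u * ((S + u\<^sup>2) / (u * t))"
    by simp_all
  then have "(R + 1) / s = (S + 1) / t" "(R + u\<^sup>2) / s = (S + u\<^sup>2) / t"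
    using H(3) by simp_all
  then have e: "(R + 1) * t = (S + 1) * s" "(R + u\<^sup>2) * t = (S + u\<^sup>2) * s"
    using p by (simp_all only: frac_eq_eq less_imp_neq[symmetric] not_False_eq_True simp_thms)
  then have "(u\<^sup>2 - 1) * t = (u\<^sup>2 - 1) * s" by (simp add: algebra_simps)
  moreover have "u\<^sup>2 \<noteq> 1" using H by (simp add: power2_eq_1_iff)
  ultimately have "s = t" by simp
  then show "x $ 3 = y $ 3" by (simp add: st)
  have "R = S" using e \<open>s = t\<close> p by simp
  then show "cmod (cz x) = cmod (cz y)" using \<open>x $ 3 = y $ 3\<close> by (simp add: R)
qed

section \<open>Classification of the isometries\<close>

definition refl_H3 :: "real^3 \<Rightarrow> real^3" where "refl_H3 x = vector [x $ 1, - (x $ 2), x $ 3]"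

lemma refl_H3_simps [simp]: "cz (refl_H3 x) = cnj (cz x)" "refl_H3 x $ 3 = x $ 3" "refl_H3 x \<in> H3 \<longleftrightarrow> x \<in> H3"
  by (simp_all add: refl_H3_def cz_def complex_eq_iff H3_def)

text \<open>After composition with some \<open>act M\<close> the map fixes two points of the axis,
  and after a rotation also a point off it. Heights and horizontal Euclidean distances are then
  preserved, which leaves the identity and one reflection; the image of a single further point
  decides between them.\<close>

lemma isometry_cases:
  assumes f: "\<And>x. x \<in> H3 \<Longrightarrow> f x \<in> H3" and iso: "\<And>x y. x \<in> H3 \<Longrightarrow> y \<in> H3 \<Longrightarrow> hdist (f x) (f y) = hdist x y"
  obtains M where "dt M \<noteq> 0" "(\<forall>x\<in>H3. f x = act M x) \<or> (\<forall>x\<in>H3. f x = act M (refl_H3 x))"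
proof -
  have "hdist (f jpt) (f (vp 2)) = ln 2" using iso[of jpt "vp 2"] by (simp add: jpt_eq hdist_vp)
  then obtain M where M: "dt M \<noteq> 0" "act M jpt = f jpt" "act M (vp 2) = f (vp 2)"
    using two_point[of "f jpt" "f (vp 2)"] f by auto
  define h where "h = (\<lambda>x. act (adj M) (f x))"
  have hH: "h x \<in> H3" if "x \<in> H3" for x using that M f by (simp add: h_def)
  have hi: "hdist (h x) (h y) = hdist x y" if "x \<in> H3" "y \<in> H3" for x y
    using that M f iso by (simp add: h_def)
  have fix1: "h jpt = jpt" "h (vp 2) = vp 2" using M by (simp_all add: h_def flip: M(2,3))
  have hh: "h x $ 3 = x $ 3" "cmod (cz (h x)) = cmod (cz x)" if "x \<in> H3" for x
    using height_from_dist[of "h x" x 2] that hH hi[of jpt x] hi[of "vp 2" x] fix1 by auto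
  \<comment> \<open>Test points at height 1 over the complex numbers \<open>1\<close> and
    \<open>\<i>\<close>.\<close>
  define p q where "p = (vector [1, 0, 1] :: real^3)" and "q = (vector [0, 1, 1] :: real^3)"
  have pq: "p \<in> H3" "q \<in> H3" "cz p = 1" "cz q = \<i>" "p $ 3 = 1" "q $ 3 = 1"
    by (simp_all add: p_def q_def H3_def cz_def complex_eq_iff)
  define c where "c = cz (h p)"
  have c: "cmod c = 1" using hh(2)[OF pq(1)] pq by (simp add: c_def)
  then have c0: "c \<noteq> 0" by auto
  have cc: "c * cnj c = 1" unfolding mult_cnj_cmod by (simp add: c)
  \<comment> \<open>The rotation about the axis that brings the image of \<open>p\<close> back to
    \<open>p\<close>.\<close>
  let ?R = "M2 (cnj c) 0 0 1"
  have Rd: "dt ?R \<noteq> 0" using c0 by (simp add: dt_def)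
  define k where "k = (\<lambda>x. act ?R (h x))"
  have kc: "cz (k x) = cnj c * cz (h x)" "k x $ 3 = x $ 3" if "x \<in> H3" for x
    using act_affine[of "cnj c" "h x" 0] that c0 c hH hh by (simp_all add: k_def)
  have kH: "k x \<in> H3" if "x \<in> H3" for x using that hH Rd by (simp add: k_def)
  have ki: "hdist (k x) (k y) = hdist x y" if "x \<in> H3" "y \<in> H3" for x y
    using that hi hH Rd by (simp add: k_def)
  have kp: "k p = p" using kc[OF pq(1)] cc by (simp add: cz_eq c_def[symmetric] pq mult.commute)
  have kn: "cmod (cz (k x)) = cmod (cz x)" if "x \<in> H3" for x
    using kc(1)[OF that] hh(2)[OF that] c by (simp add: norm_mult)
  have dist: "cmod (cz (k x) - cz (k y)) = cmod (cz x - cz y)" if "x \<in> H3" "y \<in> H3" for x y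
  proof -
    have "2 * cosh (hdist (k x) (k y)) = 2 * cosh (hdist x y)" using ki that by simp
    moreover have "x $ 3 \<noteq> 0" "y $ 3 \<noteq> 0" using that by (auto simp: H3_def)
    ultimately show ?thesis
      using that kH by (simp add: cosh_hdist kc)
  qed
  have re: "Re (cz (k x)) = Re (cz x)" if "x \<in> H3" for x
  proof -
    have "(cmod (cz (k x) - 1))\<^sup>2 = (cmod (cz x - 1))\<^sup>2" using dist[OF that pq(1)] kp pq by simp
    moreover have "(cmod (cz (k x)))\<^sup>2 = (cmod (cz x))\<^sup>2" using kn that by simp
    ultimately show ?thesis unfolding cmod_power2 by (simp add: power2_eq_square algebra_simps)
  qed
  have im: "(Im (cz (k x)))\<^sup>2 = (Im (cz x))\<^sup>2" if "x \<in> H3" for x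
  proof -
    have "(cmod (cz (k x)))\<^sup>2 = (cmod (cz x))\<^sup>2" using kn that by simp
    then show ?thesis using re[OF that] unfolding cmod_power2 by simp
  qed
  have "Re (cz (k q)) = 0" "(Im (cz (k q)))\<^sup>2 = 1" using re[OF pq(2)] im[OF pq(2)] pq by simp_all
  then have "cz (k q) = \<i> \<or> cz (k q) = - \<i>"
    by (auto simp: complex_eq_iff power2_eq_1_iff)
  moreover have "k x = x" if "cz (k q) = \<i>" "x \<in> H3" for x
  proof -
    have "(cmod (cz (k x) - \<i>))\<^sup>2 = (cmod (cz x - \<i>))\<^sup>2" using dist[OF that(2) pq(2)] that pq by simp
    then have "Im (cz (k x)) = Im (cz x)" using re[OF that(2)] im[OF that(2)]
      unfolding cmod_power2 by (simp add: power2_eq_square algebra_simps)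
    then show ?thesis using re[OF that(2)] kc(2)[OF that(2)] by (simp add: cz_eq complex_eq_iff)
  qed
  moreover have "k x = refl_H3 x" if "cz (k q) = - \<i>" "x \<in> H3" for x
  proof -
    have "(cmod (cz (k x) + \<i>))\<^sup>2 = (cmod (cz x - \<i>))\<^sup>2" using dist[OF that(2) pq(2)] that pq by simp
    then have "Im (cz (k x)) = - Im (cz x)" using re[OF that(2)] im[OF that(2)]
      unfolding cmod_power2 by (simp add: power2_eq_square algebra_simps)
    then show ?thesis using re[OF that(2)] kc(2)[OF that(2)] by (simp add: cz_eq complex_eq_iff)
  qed
  moreover have fk: "f x = act (M * adj ?R) (k x)" if "x \<in> H3" for x
  proof -
    have "act (M * adj ?R) (k x) = act M (act (adj ?R) (k x))"
      using act_mult[OF M(1), of "adj ?R" "k x"] kH[OF that] Rd dt_simps(2)[of ?R] by argo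
    also have "act (adj ?R) (k x) = h x" unfolding k_def by (rule act_adj(1)[OF Rd hH[OF that]])
    also have "act M (h x) = f x" unfolding h_def by (rule act_adj(2)[OF M(1) f[OF that]])
    finally show ?thesis ..
  qed
  moreover have "dt (M * adj ?R) \<noteq> 0" using M(1) Rd by (simp del: m2_sel)
  ultimately show ?thesis
    using that[of "M * adj ?R"] by metis
qed

section \<open>Orientation\<close>

definition jac_pos :: "(real^3 \<Rightarrow> real^3) \<Rightarrow> real^3 \<Rightarrow> bool" where
  "jac_pos f x \<longleftrightarrow> (\<exists>f'. (f has_derivative f') (at x) \<and> 0 < det (matrix f'))"

lemma orientation_preserving_jac: "orientation_preserving f \<longleftrightarrow> (\<forall>x\<in>H3. jac_pos f x)"
  by (simp add: orientation_preserving_def jac_pos_def)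

lemma open_H3: "open H3"
  unfolding H3_def by (rule open_halfspace_component_gt_cart)

lemma jac_pos_cong:
  assumes "x \<in> H3" "\<And>y. y \<in> H3 \<Longrightarrow> f y = h y" "jac_pos f x"
  shows "jac_pos h x"
  using assms has_derivative_transform_within_open[OF _ open_H3] unfolding jac_pos_def by metis

lemma jac_pos_comp:
  assumes "jac_pos f x" "jac_pos h (f x)"
  shows "jac_pos (\<lambda>x. h (f x)) x"
proof -
  obtain f' h' where d: "(f has_derivative f') (at x)" "0 < det (matrix f')"
    "(h has_derivative h') (at (f x))" "0 < det (matrix h')"
    using assms by (auto simp: jac_pos_def)
  have "((\<lambda>x. h (f x)) has_derivative (\<lambda>y. h' (f' y))) (at x)"
    using d by (metis has_derivative_compose)
  moreover have "matrix (\<lambda>y. h' (f' y)) = matrix h' ** matrix f'"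
    using d matrix_compose[of f' h'] has_derivative_linear
    by (metis (no_types, lifting) ext comp_apply)
  then have "0 < det (matrix (\<lambda>y. h' (f' y)))" using d by (simp add: det_mul)
  ultimately show ?thesis unfolding jac_pos_def by blast
qed

lemma not_jac_pos_refl: "\<not> jac_pos refl_H3 x"
proof
  assume "jac_pos refl_H3 x"
  then obtain f' where f': "(refl_H3 has_derivative f') (at x)" "0 < det (matrix f')"
    by (auto simp: jac_pos_def)
  have "linear refl_H3"
    by (rule linearI) (simp_all add: refl_H3_def vec3_eq)
  then have "(refl_H3 has_derivative refl_H3) (at x)"
    by (simp add: bounded_linear_imp_has_derivative linear_conv_bounded_linear)
  then have "f' = refl_H3" using f'(1) has_derivative_unique by blast
  moreover have "det (matrix refl_H3) = -1"
    by (simp add: det_3 matrix_def refl_H3_def axis_def)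
  ultimately show False using f' by simp
qed

lemma jac_pos_affine:
  assumes "a \<noteq> 0" "x \<in> H3"
  shows "jac_pos (act (M2 a b 0 1)) x"
proof -
  define L where "L = (\<lambda>x :: real^3. vector [Re a * x $ 1 - Im a * x $ 2, Im a * x $ 1 + Re a * x $ 2, cmod a * x $ 3] :: real^3)"
  define v where "v = (vector [Re b, Im b, 0] :: real^3)"
  have "linear L" by (rule linearI) (simp_all add: L_def vec3_eq algebra_simps)
  then have "((\<lambda>x. L x + v) has_derivative L) (at x)"
    by (auto intro!: derivative_eq_intros bounded_linear_imp_has_derivative simp: linear_conv_bounded_linear)
  moreover have "det (matrix L) = cmod a * (cmod a)\<^sup>2"
    by (simp add: det_3 matrix_def L_def axis_def cmod_power2) (simp add: power2_eq_square algebra_simps)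
  ultimately have jp: "jac_pos (\<lambda>x. L x + v) x" using assms by (auto simp: jac_pos_def)
  have eq: "L y + v = act (M2 a b 0 1) y" if "y \<in> H3" for y
  proof -
    have "cz (L y + v) = a * cz y + b" by (simp add: L_def v_def cz_def complex_eq_iff)
    then show ?thesis using act_affine[OF assms(1) that, of b] by (simp add: cz_eq L_def v_def)
  qed
  show ?thesis by (rule jac_pos_cong[OF assms(2) eq jp])
qed

text \<open>The map is the inversion in the unit sphere composed with the reflection
  \<open>S\<close>, and both reverse orientation. In the determinant the bracket equals 1 because
  \<open>r\<close> is the reciprocal of the squared norm of \<open>x\<close>.\<close>

lemma jac_pos_flip:
  assumes "x \<in> H3"
  shows "jac_pos (act (M2 0 1 1 0)) x"
proof -
  define N where "N = (\<lambda>x :: real^3. (x $ 1)\<^sup>2 + (x $ 2)\<^sup>2 + (x $ 3)\<^sup>2)"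
  define S where "S = (\<lambda>x :: real^3. vector [x $ 1, - (x $ 2), x $ 3] :: real^3)"
  define m where "m = (\<lambda>h :: real^3. 2 * x $ 1 * h $ 1 + 2 * x $ 2 * h $ 2 + 2 * x $ 3 * h $ 3)"
  define L where "L = (\<lambda>h. (1 / N x) *\<^sub>R S h + (- m h / (N x)\<^sup>2) *\<^sub>R S x)"
  have Np: "0 < N x" using assms by (auto simp: N_def H3_def intro!: add_nonneg_pos)
  have "linear S" by (rule linearI) (simp_all add: S_def vec3_eq)
  then have dS: "(S has_derivative S) (at x)"
    by (simp add: bounded_linear_imp_has_derivative linear_conv_bounded_linear)
  have dN: "(N has_derivative m) (at x)"
    unfolding N_def m_def by (auto intro!: derivative_eq_intros
        bounded_linear_imp_has_derivative[OF bounded_linear_vec_nth] simp: power2_eq_square algebra_simps)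
  have "((\<lambda>x. (1 / N x) *\<^sub>R S x) has_derivative L) (at x)"
    unfolding L_def using Np
    by (auto intro!: derivative_eq_intros dN dS simp: power2_eq_square divide_simps)
  moreover have "0 < det (matrix L)"
  proof -
    define a b c r where abcr: "a = x $ 1" "b = x $ 2" "c = x $ 3" "r = 1 / N x"
    have r: "r * (a * a + b * b + c * c) = 1" "0 < r"
      using Np by (simp_all add: abcr) (simp add: N_def power2_eq_square)
    have r2: "inverse (N x) = r" "1 / N x = r" "1 / (N x)\<^sup>2 = r * r" by (simp_all add: abcr power2_eq_square field_simps)
    have Lh: "L h = r *\<^sub>R S h + (- (2 * a * h $ 1 + 2 * b * h $ 2 + 2 * c * h $ 3) * (r * r)) *\<^sub>R S x" for h
      by (simp add: L_def m_def abcr power2_eq_square)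
    have "matrix L $ 1 $ 1 = r - 2 * a * a * r * r" "matrix L $ 1 $ 2 = - 2 * a * b * r * r"
      "matrix L $ 1 $ 3 = - 2 * a * c * r * r" "matrix L $ 2 $ 1 = 2 * a * b * r * r"
      "matrix L $ 2 $ 2 = - r + 2 * b * b * r * r" "matrix L $ 2 $ 3 = 2 * b * c * r * r"
      "matrix L $ 3 $ 1 = - 2 * a * c * r * r" "matrix L $ 3 $ 2 = - 2 * b * c * r * r"
      "matrix L $ 3 $ 3 = r - 2 * c * c * r * r"
      by (simp_all add: matrix_def Lh S_def axis_def abcr(1-3)[symmetric])
    note entries = this
    have "det (matrix L) = (2 * (r * (a * a + b * b + c * c)) - 1) * (r * (r * r))"
      unfolding det_3 entries by (simp add: algebra_simps)
    then show ?thesis using r by simp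
  qed
  ultimately have jp: "jac_pos (\<lambda>x. (1 / N x) *\<^sub>R S x) x" unfolding jac_pos_def by blast
  have eq: "(1 / N y) *\<^sub>R S y = act (M2 0 1 1 0) y" if "y \<in> H3" for y
  proof -
    have "(cmod (cz y))\<^sup>2 + (y $ 3)\<^sup>2 = N y" by (simp add: cz_def cmod_power2 N_def)
    moreover have "cz ((1 / N y) *\<^sub>R S y) = cnj (cz y) / of_real (N y)"
      by (simp add: S_def cz_def complex_eq_iff)
    ultimately show ?thesis using act_flip[OF that] by (simp add: cz_eq S_def)
  qed
  show ?thesis by (rule jac_pos_cong[OF assms eq jp])
qed

text \<open>Bruhat decomposition: for \<open>c = 0\<close> the map is affine up to scale, and
  otherwise the matrix factors into an affine map, the flip and another affine map.\<close>

lemma jac_pos_act: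
  assumes "dt M \<noteq> 0" "x \<in> H3"
  shows "jac_pos (act M) x"
proof -
  have comp: "jac_pos (act (P * Q)) x" if "dt P \<noteq> 0" "dt Q \<noteq> 0" "x \<in> H3" "\<And>x. x \<in> H3 \<Longrightarrow> jac_pos (act P) x"
    "jac_pos (act Q) x" for P Q x
    using jac_pos_cong[OF that(3) _ jac_pos_comp[OF that(5)], of "act P" "act (P * Q)"] that
    by (simp add: act_mult)
  obtain a b c d where M: "M = M2 a b c d" by (cases M)
  show ?thesis
  proof (cases "c = 0")
    case True
    have "M = sc d (M2 (a / d) (b / d) 0 1)" "d \<noteq> 0" "a / d \<noteq> 0" using assms(1) True by (auto simp: M m2_eq_iff dt_def)
    then have eq: "act (M2 (a / d) (b / d) 0 1) y = act M y" if "y \<in> H3" for y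
      using that act_scale[of d "M2 (a / d) (b / d) 0 1" y] by (simp add: dt_def)
    show ?thesis by (rule jac_pos_cong[OF assms(2) eq jac_pos_affine[OF \<open>a / d \<noteq> 0\<close> assms(2)]])
  next
    case False
    define u where "u = b - a * d / c"
    have u: "u \<noteq> 0" using assms(1) False by (auto simp: M dt_def u_def field_simps)
    have Meq: "M = M2 u (a / c) 0 1 * (M2 0 1 1 0 * M2 c d 0 1)"
      using False by (simp add: M m2_eq_iff u_def)
    have "dt (M2 0 1 1 0) \<noteq> 0" "dt (M2 c d 0 1) \<noteq> 0" "dt (M2 u (a / c) 0 1) \<noteq> 0"
      using False u by (auto simp: dt_def)
    then show ?thesis unfolding Meq
      using comp[of "M2 0 1 1 0" "M2 c d 0 1" x] comp[of "M2 u (a / c) 0 1" "M2 0 1 1 0 * M2 c d 0 1" x]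
        jac_pos_flip jac_pos_affine False u assms(2) by simp
  qed
qed

section \<open>Representations as tuples of matrices\<close>

abbreviation mob :: "m2 \<Rightarrow> real^3 \<Rightarrow> real^3" where "mob M \<equiv> restrict (act M) H3"

lemma bij_act: "dt M \<noteq> 0 \<Longrightarrow> bij_betw (act M) H3 H3"
  by (rule bij_betwI[where g = "act (adj M)"]) auto

lemma mob_Bij: "dt M \<noteq> 0 \<Longrightarrow> mob M \<in> Bij H3"
  by (simp add: Bij_def bij_act)

lemma group_isom_H3: "group isom_H3"
proof -
  interpret B: group "BijGroup H3" by (rule group_BijGroup)
  let ?C = "{f \<in> Bij H3. \<forall>x\<in>H3. \<forall>y\<in>H3. hdist (f x) (f y) = hdist x y}"
  have fH: "f x \<in> H3" if "f \<in> Bij H3" "x \<in> H3" for f x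
    using that by (auto simp: Bij_def bij_betw_def)
  have "subgroup ?C (BijGroup H3)"
  proof (rule B.subgroupI)
    show "?C \<subseteq> carrier (BijGroup H3)" by (auto simp: BijGroup_def)
    have "mob 1 \<in> ?C" using mob_Bij[of 1] by simp
    then show "?C \<noteq> {}" by blast
  next
    fix f assume f: "f \<in> ?C"
    then have b: "bij_betw f H3 H3" by (simp add: Bij_def)
    have "hdist (inv_into H3 f x) (inv_into H3 f y) = hdist x y" if "x \<in> H3" "y \<in> H3" for x y
    proof -
      have "inv_into H3 f x \<in> H3" "inv_into H3 f y \<in> H3"
        using that bij_betw_apply[OF bij_betw_inv_into[OF b]] by auto
      then have "hdist (f (inv_into H3 f x)) (f (inv_into H3 f y)) = hdist (inv_into H3 f x) (inv_into H3 f y)"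
        using f by blast
      then show ?thesis using that bij_betw_inv_into_right[OF b] by simp
    qed
    then show "inv\<^bsub>BijGroup H3\<^esub> f \<in> ?C"
      using f restrict_inv_into_Bij[of f H3] by (simp add: inv_BijGroup)
  next
    fix f h assume "f \<in> ?C" "h \<in> ?C"
    then show "f \<otimes>\<^bsub>BijGroup H3\<^esub> h \<in> ?C"
      using fH compose_Bij[of f H3 h] by (simp add: BijGroup_def compose_def)
  qed
  then show ?thesis unfolding isom_H3_def by (rule B.subgroup_imp_group)
qed

lemma isom_H3_simps:
  "f \<in> carrier isom_H3 \<Longrightarrow> x \<in> H3 \<Longrightarrow> f x \<in> H3"
  "f \<in> carrier isom_H3 \<Longrightarrow> x \<in> H3 \<Longrightarrow> y \<in> H3 \<Longrightarrow> hdist (f x) (f y) = hdist x y"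
  "f \<in> carrier isom_H3 \<Longrightarrow> bij_betw f H3 H3"
  "f \<in> carrier isom_H3 \<Longrightarrow> f \<in> extensional H3"
  "f \<in> carrier isom_H3 \<Longrightarrow> h \<in> carrier isom_H3 \<Longrightarrow> f \<otimes>\<^bsub>isom_H3\<^esub> h = compose H3 f h"
  "\<one>\<^bsub>isom_H3\<^esub> = (\<lambda>x\<in>H3. x)"
  by (auto simp: isom_H3_def BijGroup_def Bij_def bij_betw_def)

lemma mob_isom: "dt M \<noteq> 0 \<Longrightarrow> mob M \<in> carrier isom_H3"
  by (simp add: isom_H3_def mob_Bij)

lemma mob_isom_plus: "dt M \<noteq> 0 \<Longrightarrow> mob M \<in> carrier isom_plus_H3"
  using jac_pos_cong[OF _ _ jac_pos_act[of M]]
  by (simp add: isom_plus_H3_def mob_isom orientation_preserving_jac)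

lemma isom_plus_mob:
  assumes "f \<in> carrier isom_plus_H3"
  obtains M where "dt M \<noteq> 0" "f = mob M"
proof -
  have f: "f \<in> carrier isom_H3" and j: "jac_pos f x" if "x \<in> H3" for x
    using assms that by (auto simp: isom_plus_H3_def orientation_preserving_jac)
  have f: "f \<in> carrier isom_H3" using f[of jpt] by simp
  obtain M where M: "dt M \<noteq> 0" "(\<forall>x\<in>H3. f x = act M x) \<or> (\<forall>x\<in>H3. f x = act M (refl_H3 x))"
    using isometry_cases[of f] isom_H3_simps(1,2)[OF f] by metis
  \<comment> \<open>Otherwise undoing \<open>M\<close> would give the reflection a positive
    Jacobian.\<close>
  have "\<not> (\<forall>x\<in>H3. f x = act M (refl_H3 x))"
  proof
    assume a: "\<forall>x\<in>H3. f x = act M (refl_H3 x)"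
    have d: "dt (adj M) \<noteq> 0" using M by simp
    have "jac_pos (act (adj M)) (f jpt)"
      using jac_pos_act[OF d] isom_H3_simps(1)[OF f] by simp
    then have c: "jac_pos (\<lambda>x. act (adj M) (f x)) jpt"
      using jac_pos_comp[OF j[of jpt]] by simp
    have e: "act (adj M) (f y) = refl_H3 y" if "y \<in> H3" for y
      using a that M(1) by simp
    show False using jac_pos_cong[OF jpt_H3 e c] not_jac_pos_refl by blast
  qed
  then have "\<forall>x\<in>H3. f x = act M x" using M by blast
  then have "f = mob M" using isom_H3_simps(4)[OF f] by (auto simp: extensional_def restrict_def)
  then show ?thesis using that M by blast
qed

lemma mob_mult: "dt M \<noteq> 0 \<Longrightarrow> dt N \<noteq> 0 \<Longrightarrow> mob M \<otimes>\<^bsub>isom_plus_H3\<^esub> mob N = mob (M * N)"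
  using isom_H3_simps(5)[OF mob_isom mob_isom, of M N]
  by (auto simp: isom_plus_H3_def compose_def act_mult restrict_def)

lemma mob_scale: "c \<noteq> 0 \<Longrightarrow> dt M \<noteq> 0 \<Longrightarrow> mob (sc c M) = mob M"
  by (auto simp: restrict_def act_scale)

lemma mob_one: "\<one>\<^bsub>isom_plus_H3\<^esub> = mob 1"
  using isom_H3_simps(6) by (auto simp: isom_plus_H3_def)

lemma group_isom_plus: "group isom_plus_H3"
proof (rule groupI)
  fix x assume "x \<in> carrier isom_plus_H3"
  then obtain M where M: "dt M \<noteq> 0" "x = mob M" by (rule isom_plus_mob)
  show "\<one>\<^bsub>isom_plus_H3\<^esub> \<otimes>\<^bsub>isom_plus_H3\<^esub> x = x" using M by (simp add: mob_one mob_mult)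
  have "mob (adj M) \<otimes>\<^bsub>isom_plus_H3\<^esub> x = mob (cm (dt M))" using M by (simp add: mob_mult)
  also have "\<dots> = \<one>\<^bsub>isom_plus_H3\<^esub>" using M mob_scale[of "dt M" 1] by (simp add: mob_one)
  finally show "\<exists>y\<in>carrier isom_plus_H3. y \<otimes>\<^bsub>isom_plus_H3\<^esub> x = \<one>\<^bsub>isom_plus_H3\<^esub>"
    using mob_isom_plus[of "adj M"] M by auto
  fix y assume "y \<in> carrier isom_plus_H3"
  then obtain N where N: "dt N \<noteq> 0" "y = mob N" by (rule isom_plus_mob)
  show "x \<otimes>\<^bsub>isom_plus_H3\<^esub> y \<in> carrier isom_plus_H3"
    using mob_isom_plus[of "M * N"] M N by (simp add: mob_mult)
  fix z assume "z \<in> carrier isom_plus_H3"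
  then obtain L where "dt L \<noteq> 0" "z = mob L" by (rule isom_plus_mob)
  then show "x \<otimes>\<^bsub>isom_plus_H3\<^esub> y \<otimes>\<^bsub>isom_plus_H3\<^esub> z = x \<otimes>\<^bsub>isom_plus_H3\<^esub> (y \<otimes>\<^bsub>isom_plus_H3\<^esub> z)"
    using M N by (simp add: mob_mult mult.assoc)
qed (use mob_isom_plus[of 1] in \<open>simp add: mob_one\<close>)

text \<open>Fixing \<open>jpt\<close> makes \<open>M\<close> a multiple of a unitary matrix, so
  fixing \<open>x\<close> means commuting with \<open>herm x\<close>. The point \<open>vp 2\<close>
  forces \<open>M\<close> to be diagonal, and a point off the axis makes its two entries
  equal.\<close>

lemma mob_id_scalar:
  assumes "dt M \<noteq> 0" "\<And>x. x \<in> H3 \<Longrightarrow> act M x = x"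
  obtains c where "M = cm c"
proof -
  define r where "r = complex_of_real (1 / cmod (dt M))"
  have r0: "r \<noteq> 0" using assms(1) by (simp add: r_def)
  have e: "herm x = sc r (M * herm x * star M)" if "x \<in> H3" for x
    using herm_act(2)[OF assms(1) that] assms(2)[OF that] by (simp add: r_def)
  have one: "sc r (M * star M) = 1" using e[of jpt] by simp
  have comm: "herm x * M = M * herm x" if "x \<in> H3" for x
  proof -
    have "star M * M = sc (1 / r) 1"
    proof -
      have "M * (star M * M) = M * sc (1 / r) 1"
        using arg_cong[OF one, of "\<lambda>Z. sc (1 / r) (Z * M)"] r0 by (simp add: mult.assoc)
      then show ?thesis using assms(1) mult_left_cancel_m2 by blast
    qed
    then show ?thesis using arg_cong[OF e[OF that], of "\<lambda>Z. Z * M"] r0 by (simp add: mult.assoc)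
  qed
  have "herm (vp 2) * M = M * herm (vp 2)" by (rule comm) simp
  then have 0: "e12 M = 0" "e21 M = 0" by (auto simp: herm_vp m2_eq_iff)
  define p where "p = (vector [1, 0, 1] :: real^3)"
  have p: "p \<in> H3" "cz p = 1" "p $ 3 = 1" by (simp_all add: p_def H3_def cz_def complex_eq_iff)
  have "e12 (herm p * M) = e12 (M * herm p)" by (simp only: comm[OF p(1)])
  then have "e11 M = e22 M" using 0 by (simp add: herm_def p)
  then show ?thesis using that[of "e11 M"] 0 by (simp add: m2_eq_iff)
qed

section \<open>Evaluation of words on tuples of matrices\<close>

primrec ev :: "('a \<Rightarrow> m2) \<Rightarrow> 'a word \<Rightarrow> m2" where
  "ev T [] = 1"
| "ev T (p # w) = (if snd p then adj (T (fst p)) else T (fst p)) * ev T w"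

lemma ev_append [simp]: "ev T (u @ v) = ev T u * ev T v"
  by (induction u) (auto simp: mult.assoc)

definition valid :: "nat \<Rightarrow> (surface_gen \<Rightarrow> m2) \<Rightarrow> bool" where
  "valid g T \<longleftrightarrow> (\<forall>x\<in>surface_gens g. dt (T x) \<noteq> 0) \<and> (\<exists>c. ev T (surface_relator g) = cm c)"

lemma dt_ev: "\<forall>x\<in>X. dt (T x) \<noteq> 0 \<Longrightarrow> w \<in> words_over X \<Longrightarrow> dt (ev T w) \<noteq> 0"
  by (induction w) auto

abbreviation cls :: "nat \<Rightarrow> surface_gen word \<Rightarrow> surface_elt" where
  "cls g w \<equiv> word_rel (surface_gens g) {surface_relator g} `` {w}"

text \<open>Adjugates stand for inverses, so equal words have proportional rather than equal values:
  a cancelling pair contributes a determinant and a relator its scalar.\<close>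

lemma word_eq_ev:
  assumes "word_eq X R u v" "\<forall>x\<in>X. dt (T x) \<noteq> 0" "\<forall>r\<in>R. \<exists>c. ev T r = cm c"
  shows "\<exists>c. c \<noteq> 0 \<and> ev T u = sc c (ev T v)"
  using assms
proof (induction rule: word_eq.induct)
  case (word_refl u)
  then show ?case by (intro exI[of _ 1]) simp
next
  case (word_sym u v)
  then obtain c where "c \<noteq> 0" "ev T u = sc c (ev T v)" by blast
  then show ?case by (intro exI[of _ "1 / c"]) simp
next
  case (word_trans u v w)
  then obtain c d where "c \<noteq> 0" "ev T u = sc c (ev T v)" "d \<noteq> 0" "ev T v = sc d (ev T w)" by blast
  then show ?case by (intro exI[of _ "c * d"]) simp
next
  case (word_cancel u v x b)
  then show ?case by (intro exI[of _ "dt (T x)"]) (auto simp: mult.assoc)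
next
  case (word_relator u v r)
  then obtain c where c: "ev T r = cm c" by blast
  have "dt (ev T r) \<noteq> 0" using word_relator by (intro dt_ev) auto
  then have "c \<noteq> 0" by (simp add: c)
  then show ?case using c by (intro exI[of _ c]) simp
qed

text \<open>The word representing the class is arbitrary; by \<open>word_eq_ev\<close> the Moebius
  map of its value does not depend on the choice.\<close>

definition rep :: "nat \<Rightarrow> (surface_gen \<Rightarrow> m2) \<Rightarrow> representation" where
  "rep g T = (\<lambda>\<gamma>\<in>carrier (surface_group g). mob (ev T (SOME w. w \<in> \<gamma>)))"

lemma surface_carrier: "carrier (surface_group g) = cls g ` words_over (surface_gens g)"
  by (auto simp: surface_group_def presented_group_def quotient_def)

lemma surface_mult: "u \<in> words_over (surface_gens g) \<Longrightarrow> v \<in> words_over (surface_gens g) \<Longrightarrow>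
  cls g u \<otimes>\<^bsub>surface_group g\<^esub> cls g v = cls g (u @ v)"
  by (simp add: surface_group_def mult_presented_class)

lemma surface_one: "\<one>\<^bsub>surface_group g\<^esub> = cls g []"
  by (simp add: surface_group_def presented_group_def)

lemma group_surface: "group (surface_group g)"
  by (simp add: surface_group_def group_presented_group)

lemma surface_relator_words: "surface_relator g \<in> words_over (surface_gens g)"
  by (auto simp: surface_relator_def words_over_def surface_gens_def)

lemma rep_cls:
  assumes "valid g T" "w \<in> words_over (surface_gens g)"
  shows "rep g T (cls g w) = mob (ev T w)"
proof -
  let ?X = "surface_gens g"
  have "w \<in> cls g w" using assms(2) by (auto simp: word_rel_def intro: word_eq.word_refl)
  then have "(SOME u. u \<in> cls g w) \<in> cls g w" by (rule someI)
  then have "word_eq ?X {surface_relator g} w (SOME u. u \<in> cls g w)" by (simp add: word_rel_def)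
  then obtain c where c: "c \<noteq> 0" "ev T w = sc c (ev T (SOME u. u \<in> cls g w))"
    using word_eq_ev[of ?X "{surface_relator g}"] assms(1) unfolding valid_def by blast
  have "(SOME u. u \<in> cls g w) \<in> words_over ?X"
    using word_eq_in_words[OF \<open>word_eq _ _ w _\<close>] by blast
  then have "dt (ev T (SOME u. u \<in> cls g w)) \<noteq> 0" using assms(1) dt_ev by (auto simp: valid_def)
  then show ?thesis using c assms(2) mob_scale by (simp add: rep_def surface_carrier)
qed

lemma rep_in_rep_space:
  assumes "valid g T"
  shows "rep g T \<in> rep_space g"
proof -
  have d: "dt (ev T w) \<noteq> 0" if "w \<in> words_over (surface_gens g)" for w
    using that assms dt_ev by (auto simp: valid_def)
  have "rep g T \<in> hom (surface_group g) isom_plus_H3"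
  proof (rule homI)
    fix \<gamma> assume "\<gamma> \<in> carrier (surface_group g)"
    then obtain u where u: "u \<in> words_over (surface_gens g)" "\<gamma> = cls g u" by (auto simp: surface_carrier)
    then show "rep g T \<gamma> \<in> carrier isom_plus_H3" using assms mob_isom_plus d by (simp add: rep_cls)
    fix \<eta> assume "\<eta> \<in> carrier (surface_group g)"
    then obtain v where v: "v \<in> words_over (surface_gens g)" "\<eta> = cls g v" by (auto simp: surface_carrier)
    show "rep g T (\<gamma> \<otimes>\<^bsub>surface_group g\<^esub> \<eta>) = rep g T \<gamma> \<otimes>\<^bsub>isom_plus_H3\<^esub> rep g T \<eta>"
      using u v assms d by (simp add: surface_mult rep_cls mob_mult)
  qed
  then show ?thesis by (simp add: rep_space_def rep_def)
qed

text \<open>Matrices are chosen for the generators only. The relator acts as the identity, and a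
  matrix acting as the identity is scalar, so the chosen tuple is \<open>valid\<close>.\<close>

lemma rep_space_rep:
  assumes "\<rho> \<in> rep_space g"
  obtains T where "valid g T" "\<rho> = rep g T"
proof -
  let ?X = "surface_gens g"
  have hom: "\<rho> \<in> hom (surface_group g) isom_plus_H3" and ext: "\<rho> \<in> extensional (carrier (surface_group g))"
    using assms by (auto simp: rep_space_def)
  interpret group_hom "surface_group g" isom_plus_H3 \<rho>
    using hom by (simp add: group_hom_def group_hom_axioms_def group_surface group_isom_plus)
  have cl: "cls g w \<in> carrier (surface_group g)" if "w \<in> words_over ?X" for w
    using that by (auto simp: surface_carrier)
  have "\<forall>x\<in>?X. \<exists>M. dt M \<noteq> 0 \<and> \<rho> (cls g [(x, False)]) = mob M"
    using hom_closed[OF cl] isom_plus_mob by (metis words_over_simps(1,3))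
  then obtain T where T: "\<And>x. x \<in> ?X \<Longrightarrow> dt (T x) \<noteq> 0" "\<And>x. x \<in> ?X \<Longrightarrow> \<rho> (cls g [(x, False)]) = mob (T x)"
    by metis
  have one: "\<rho> (cls g []) = mob 1" using hom_one by (simp add: surface_one mob_one)
  have inv: "\<rho> (cls g [(x, True)]) = mob (adj (T x))" if x: "x \<in> ?X" for x
  proof -
    obtain M where M: "dt M \<noteq> 0" "\<rho> (cls g [(x, True)]) = mob M"
      using hom_closed[OF cl, of "[(x, True)]"] x isom_plus_mob by (metis words_over_simps(1,3))
    have "word_eq ?X {surface_relator g} ([] @ [(x, True), (x, \<not> True)] @ []) ([] @ [])"
      using x by (intro word_eq.word_cancel) auto
    then have "cls g [(x, True), (x, False)] = cls g []"
      by (intro equiv_class_eq[OF equiv_word_rel]) (simp add: word_rel_def)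
    then have "cls g [(x, True)] \<otimes>\<^bsub>surface_group g\<^esub> cls g [(x, False)] = cls g []"
      using x by (simp add: surface_mult)
    then have "mob (M * T x) = mob 1"
      using hom_mult[OF cl cl, of "[(x, True)]" "[(x, False)]"] x one M T by (simp add: mob_mult)
    then have id: "act M (act (T x) y) = y" if "y \<in> H3" for y
      using that act_mult[OF M(1) T(1)[OF x] that] by (metis act_1 restrict_apply')
    have "act M y = act (adj (T x)) y" if "y \<in> H3" for y
      using id[of "act (adj (T x)) y"] that T(1)[OF x] by simp
    then show ?thesis using M by (auto simp: restrict_def)
  qed
  have w: "w \<in> words_over ?X \<Longrightarrow> \<rho> (cls g w) = mob (ev T w) \<and> dt (ev T w) \<noteq> 0" for w
  proof (induction w)
    case Nil
    then show ?case using one by simp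
  next
    case (Cons p w)
    obtain x b where p: "p = (x, b)" by force
    have x: "x \<in> ?X" "w \<in> words_over ?X" using Cons.prems p by auto
    have "cls g (p # w) = cls g [p] \<otimes>\<^bsub>surface_group g\<^esub> cls g w"
      using x p by (simp add: surface_mult)
    then have "\<rho> (cls g (p # w)) = \<rho> (cls g [p]) \<otimes>\<^bsub>isom_plus_H3\<^esub> \<rho> (cls g w)"
      using hom_mult[OF cl cl, of "[p]" w] x p by simp
    moreover have "\<rho> (cls g w) = mob (ev T w)" "dt (ev T w) \<noteq> 0" using Cons.IH x by auto
    moreover define P where "P = (if b then adj (T x) else T x)"
    then have "\<rho> (cls g [p]) = mob P" "dt P \<noteq> 0" using inv T x p by (cases b; simp)+
    ultimately have "\<rho> (cls g (p # w)) = mob (P * ev T w)" "dt (P * ev T w) \<noteq> 0"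
      using mob_mult[of P "ev T w"] by simp_all
    moreover have "ev T (p # w) = P * ev T w" by (simp add: P_def p)
    ultimately show ?case by simp
  qed
  have "word_eq ?X {surface_relator g} ([] @ surface_relator g @ []) ([] @ [])"
    using surface_relator_words by (intro word_eq.word_relator) auto
  then have "cls g (surface_relator g) = cls g []"
    by (intro equiv_class_eq[OF equiv_word_rel]) (simp add: word_rel_def)
  then have m: "mob (ev T (surface_relator g)) = mob 1" using w[OF surface_relator_words] one by simp
  have "act (ev T (surface_relator g)) x = x" if "x \<in> H3" for x
    using fun_cong[OF m, of x] that by simp
  then obtain c where "ev T (surface_relator g) = cm c"
    using mob_id_scalar w[OF surface_relator_words] by metis
  then have v: "valid g T" using T by (auto simp: valid_def)
  have "\<rho> = rep g T"
  proof
    fix \<gamma> show "\<rho> \<gamma> = rep g T \<gamma>"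
    proof (cases "\<gamma> \<in> carrier (surface_group g)")
      case True
      then obtain u where "u \<in> words_over ?X" "\<gamma> = cls g u" by (auto simp: surface_carrier)
      then show ?thesis using w v by (simp add: rep_cls)
    next
      case False
      then show ?thesis using ext by (simp add: rep_def extensional_def)
    qed
  qed
  then show ?thesis using that v by blast
qed

section \<open>Points at infinity\<close>

text \<open>For invertible \<open>N\<close>: the first column of \<open>N\<close> spans a line
  invariant under \<open>M\<close>, that is, \<open>M\<close> fixes the endpoint at infinity of the
  vertical ray moved by \<open>N\<close>.\<close>

definition tri :: "m2 \<Rightarrow> m2 \<Rightarrow> bool" where "tri N M \<longleftrightarrow> e21 (adj N * M * N) = 0"

definition irr :: "nat \<Rightarrow> (surface_gen \<Rightarrow> m2) \<Rightarrow> bool" where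
  "irr g T \<longleftrightarrow> \<not> (\<exists>N. dt N \<noteq> 0 \<and> (\<forall>x\<in>surface_gens g. tri N (T x)))"

text \<open>Both columns of \<open>G\<close> are common eigenvectors, which amounts to two distinct
  fixed points at infinity.\<close>

definition diagable :: "nat \<Rightarrow> (surface_gen \<Rightarrow> m2) \<Rightarrow> bool" where
  "diagable g T \<longleftrightarrow> (\<exists>G. dt G \<noteq> 0 \<and> (\<forall>x\<in>surface_gens g. e21 (adj G * T x * G) = 0 \<and> e12 (adj G * T x * G) = 0))"

definition good :: "nat \<Rightarrow> (surface_gen \<Rightarrow> m2) \<Rightarrow> bool" where
  "good g T \<longleftrightarrow> irr g T \<or> diagable g T"

lemma tri_iff: "tri N M \<longleftrightarrow> (e11 M * e11 N + e12 M * e21 N) * e21 N = (e21 M * e11 N + e22 M * e21 N) * e11 N"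
  by (auto simp: tri_def algebra_simps)

lemma tri_mult:
  assumes "dt N \<noteq> 0" "tri N A" "tri N B" shows "tri N (A * B)"
proof -
  have *: "sc (dt N) (adj N * (A * B) * N) = (adj N * A * N) * (adj N * B * N)"
    by (simp add: mult.assoc del: m2_sel)
  have m: "e21 (X * Y) = e21 X * e11 Y + e22 X * e21 Y" for X Y by simp
  from * have "dt N * e21 (adj N * (A * B) * N) = e21 ((adj N * A * N) * (adj N * B * N))"
    by (metis sc_sel(3))
  also have "\<dots> = 0"
    using assms unfolding tri_def m by simp
  finally show ?thesis using assms(1) unfolding tri_def by simp
qed

lemma tri_adj: "tri N A \<Longrightarrow> tri N (adj A)"
proof -
  have "e21 (adj N * adj A * N) = - e21 (adj N * A * N)" by (simp add: algebra_simps)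
  then show "tri N A \<Longrightarrow> tri N (adj A)" by (simp only: tri_def) simp
qed

lemma tri_ev:
  assumes "dt N \<noteq> 0" "\<forall>x\<in>X. tri N (T x)" "w \<in> words_over X"
  shows "tri N (ev T w)"
  using assms(3)
proof (induction w)
  case Nil
  show ?case by (simp add: tri_iff algebra_simps)
next
  case (Cons p w)
  then show ?case using assms tri_mult tri_adj by (cases p) auto
qed

section \<open>Geodesic rays and their endpoints\<close>

definition ray :: "m2 \<Rightarrow> real \<Rightarrow> real^3" where
  "ray M = (\<lambda>t\<in>{0..}. act M (vp (exp t)))"

lemma ray_geodesic: "dt M \<noteq> 0 \<Longrightarrow> ray M \<in> geodesic_rays H3 hdist"
  by (auto simp: ray_def geodesic_rays_def hdist_vp)

text \<open>Two points of the ray are placed on the vertical axis by \<open>two_point\<close>, and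
  the distances to them determine every other point by \<open>height_from_dist\<close>.\<close>

lemma geodesic_ray:
  assumes "r \<in> geodesic_rays H3 hdist"
  obtains M where "dt M \<noteq> 0" "r = ray M"
proof -
  have r: "r t \<in> H3" if "0 \<le> t" for t using assms that by (auto simp: geodesic_rays_def)
  have d: "hdist (r t) (r u) = \<bar>t - u\<bar>" if "0 \<le> t" "0 \<le> u" for t u
    using assms that by (auto simp: geodesic_rays_def)
  obtain M where M: "dt M \<noteq> 0" "act M jpt = r 0" "act M (vp (exp 1)) = r 1"
    using two_point[of "r 0" "r 1"] r d[of 0 1] by auto
  have "r t = act M (vp (exp t))" if t: "0 \<le> t" for t
  proof -
    define y where "y = act (adj M) (r t)"
    have y: "y \<in> H3" "act M y = r t" using M r t by (simp_all add: y_def)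
    have "hdist jpt y = hdist (act M jpt) (act M y)" using hdist_act[OF M(1) jpt_H3 y(1)] by (simp only:)
    then have 1: "hdist jpt y = hdist jpt (vp (exp t))" using M y d t by (simp add: jpt_eq hdist_vp)
    have "hdist (vp (exp 1)) y = hdist (act M (vp (exp 1))) (act M y)"
      using hdist_act[OF M(1) _ y(1), of "vp (exp 1)"] by simp
    then have 2: "hdist (vp (exp 1)) y = hdist (vp (exp 1)) (vp (exp t))" using M y d t by (simp add: hdist_vp)
    have "y = vp (exp t)"
      using height_from_dist[of y "vp (exp t)" "exp 1"] y 1 2 by (simp add: cz_eq)
    then show ?thesis using y by simp
  qed
  then have "r = ray M" using assms by (auto simp: ray_def geodesic_rays_def PiE_def extensional_def)
  then show ?thesis using that M by blast
qed

lemma ray_dist: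
  assumes "dt M \<noteq> 0" "dt N \<noteq> 0" "0 \<le> t" and L: "L = adj M * N"
  shows "2 * cosh (hdist (ray M t) (ray N t)) = ((cmod (e11 L))\<^sup>2 + (cmod (e12 L))\<^sup>2 / (exp t)\<^sup>2
    + (cmod (e21 L))\<^sup>2 * (exp t)\<^sup>2 + (cmod (e22 L))\<^sup>2) / cmod (dt L)"
proof -
  \<comment> \<open>The dilation carrying \<open>jpt\<close> to height \<open>exp t\<close>, so that
    \<open>hdist_disp\<close> applies to \<open>L\<close> at that point.\<close>
  let ?G = "M2 (of_real (exp t)) 0 0 1"
  have dG: "dt ?G = of_real (exp t)" by (simp add: dt_def)
  have G: "dt ?G \<noteq> 0" "act ?G jpt = vp (exp t)"
    unfolding dG using act_affine[of "of_real (exp t)" jpt 0] by (simp_all add: cz_eq jpt_eq)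
  have "hdist (ray M t) (ray N t) = hdist (act (adj M) (act M (vp (exp t)))) (act (adj M) (act N (vp (exp t))))"
    using assms by (simp add: ray_def del: act_adj)
  also have "\<dots> = hdist (act ?G jpt) (act L (act ?G jpt))"
    using assms G by (simp add: L act_mult)
  finally have "2 * cosh (hdist (ray M t) (ray N t)) = nrm2 (adj ?G * L * ?G) / (cmod (dt L) * (exp t)\<^sup>2)"
    using hdist_disp[of L ?G] assms G(1) dG by (simp add: L)
  also have "nrm2 (adj ?G * L * ?G) = (exp t)\<^sup>2 * ((cmod (e11 L))\<^sup>2 + (cmod (e12 L))\<^sup>2 / (exp t)\<^sup>2
    + (cmod (e21 L))\<^sup>2 * (exp t)\<^sup>2 + (cmod (e22 L))\<^sup>2)"
    by (simp add: nrm2_def norm_mult power_mult_distrib distrib_left power2_eq_square)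
  finally show ?thesis by simp
qed

lemma le_2cosh: "x \<le> 2 * cosh (x :: real)"
proof -
  have "x \<le> exp x + exp (- x)"
    using exp_ge_add_one_self[of x] exp_gt_zero[of "- x"] by linarith
  then show ?thesis by (simp add: cosh_field_def)
qed

text \<open>Of the four terms in \<open>ray_dist\<close> only that of \<open>e21\<close> can grow
  with \<open>t\<close>. Its vanishing says that the first columns of \<open>M\<close> and
  \<open>N\<close> are proportional, so that both send infinity to the same point.\<close>

lemma asymptotic_iff:
  assumes "dt M \<noteq> 0" "dt N \<noteq> 0"
  shows "(ray M, ray N) \<in> asymptotic \<longleftrightarrow> e21 (adj M * N) = 0"
proof -
  define L where "L = adj M * N"
  have dL: "0 < cmod (dt L)" using assms by (simp add: L_def)
  have dist: "2 * cosh (hdist (ray M t) (ray N t)) = ((cmod (e11 L))\<^sup>2 + (cmod (e12 L))\<^sup>2 / (exp t)\<^sup>2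
    + (cmod (e21 L))\<^sup>2 * (exp t)\<^sup>2 + (cmod (e22 L))\<^sup>2) / cmod (dt L)" if "0 \<le> t" for t
    using ray_dist[OF assms that L_def] .
  have "e21 L = 0" if C: "\<forall>t\<ge>0. hdist (ray M t) (ray N t) \<le> C" for C
  proof (rule ccontr)
    assume c: "e21 L \<noteq> 0"
    define K where "K = 2 * cosh C * cmod (dt L)"
    have "(cmod (e21 L))\<^sup>2 * t \<le> K" if "0 \<le> t" for t
    proof -
      have "cosh (hdist (ray M t) (ray N t)) \<le> cosh C"
        using C that cosh_real_nonneg_le_iff[of "hdist (ray M t) (ray N t)" C] by (metis hdist_nonneg order_trans)
      then have "((cmod (e11 L))\<^sup>2 + (cmod (e12 L))\<^sup>2 / (exp t)\<^sup>2
    + (cmod (e21 L))\<^sup>2 * (exp t)\<^sup>2 + (cmod (e22 L))\<^sup>2) / cmod (dt L) \<le> 2 * cosh C"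
        using dist[OF that] by linarith
      then have "(cmod (e11 L))\<^sup>2 + (cmod (e12 L))\<^sup>2 / (exp t)\<^sup>2
    + (cmod (e21 L))\<^sup>2 * (exp t)\<^sup>2 + (cmod (e22 L))\<^sup>2 \<le> K"
        using dL unfolding K_def by (simp only: pos_divide_le_eq)
      moreover have "0 \<le> (cmod (e11 L))\<^sup>2" "0 \<le> (cmod (e12 L))\<^sup>2 / (exp t)\<^sup>2" "0 \<le> (cmod (e22 L))\<^sup>2" by simp_all
      ultimately have "(cmod (e21 L))\<^sup>2 * (exp t)\<^sup>2 \<le> K" by linarith
      moreover have "t \<le> (exp t)\<^sup>2"
      proof -
        have "(exp t)\<^sup>2 = exp (2 * t)" by (simp add: exp_double)
        then show ?thesis using exp_ge_add_one_self[of "2 * t"] that by linarith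
      qed
      then have "(cmod (e21 L))\<^sup>2 * t \<le> (cmod (e21 L))\<^sup>2 * (exp t)\<^sup>2" by (intro mult_left_mono) auto
      ultimately show ?thesis by linarith
    qed
    from this[of "\<bar>K\<bar> / (cmod (e21 L))\<^sup>2 + 1"] c show False by (simp add: distrib_left) (smt (verit) zero_less_power zero_less_norm_iff)
  qed
  moreover have "\<exists>C. \<forall>t\<ge>0. hdist (ray M t) (ray N t) \<le> C" if c: "e21 L = 0"
  proof (intro exI allI impI)
    fix t :: real assume t: "0 \<le> t"
    have "hdist (ray M t) (ray N t) \<le> 2 * cosh (hdist (ray M t) (ray N t))"
      by (rule le_2cosh)
    also have "\<dots> \<le> ((cmod (e11 L))\<^sup>2 + (cmod (e12 L))\<^sup>2 + (cmod (e22 L))\<^sup>2) / cmod (dt L)"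
    proof -
      have "(cmod (e12 L))\<^sup>2 / (exp t)\<^sup>2 \<le> (cmod (e12 L))\<^sup>2"
        using t one_le_power[of "exp t" 2] divide_left_mono[of 1 "(exp t)\<^sup>2" "(cmod (e12 L))\<^sup>2"] by simp
      then show ?thesis unfolding dist[OF t] c by (intro divide_right_mono) simp_all
    qed
    finally show "hdist (ray M t) (ray N t) \<le> \<dots>" .
  qed
  ultimately show ?thesis
    using ray_geodesic[OF assms(1)] ray_geodesic[OF assms(2)] unfolding asymptotic_def L_def by blast
qed

lemma equiv_asymptotic: "equiv (geodesic_rays H3 hdist) asymptotic"
proof (rule equivI)
  have H: "r t \<in> H3" if "r \<in> geodesic_rays H3 hdist" "0 \<le> t" for r t
    using that by (auto simp: geodesic_rays_def)
  show "asymptotic \<subseteq> geodesic_rays H3 hdist \<times> geodesic_rays H3 hdist" by (auto simp: asymptotic_def)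
  show "refl_on (geodesic_rays H3 hdist) asymptotic"
    using H by (auto simp: refl_on_def asymptotic_def intro!: exI[of _ 0])
  show "sym asymptotic"
    by (auto simp: sym_def asymptotic_def hdist_sym)
  show "trans asymptotic"
  proof (rule transI)
    fix r s q assume "(r, s) \<in> asymptotic" "(s, q) \<in> asymptotic"
    then obtain C D where R: "r \<in> geodesic_rays H3 hdist" "s \<in> geodesic_rays H3 hdist" "q \<in> geodesic_rays H3 hdist"
      and "\<forall>t\<ge>0. hdist (r t) (s t) \<le> C" "\<forall>t\<ge>0. hdist (s t) (q t) \<le> D"
      by (auto simp: asymptotic_def)
    then have "\<forall>t\<ge>0. hdist (r t) (q t) \<le> C + D"
      using hdist_triangle H by (meson add_mono order_trans)
    then show "(r, q) \<in> asymptotic" using R by (auto simp: asymptotic_def)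
  qed
qed

lemma compose_ray:
  assumes "dt P \<noteq> 0" "dt N \<noteq> 0"
  shows "compose {0..} (mob P) (ray N) = ray (P * N)"
  using assms by (auto simp: compose_def ray_def act_mult restrict_def)

lemma fixed_point_tri:
  assumes "valid g T" "\<xi> \<in> fixed_points_at_infinity g (rep g T)"
  obtains N where "dt N \<noteq> 0" "\<xi> = asymptotic `` {ray N}" "\<forall>x\<in>surface_gens g. tri N (T x)"
proof -
  have b: "\<xi> \<in> boundary_H3" and f: "fixes_ray_class g (rep g T) \<xi>"
    using assms(2) by (auto simp: fixed_points_at_infinity_def)
  obtain r where "r \<in> geodesic_rays H3 hdist" "\<xi> = asymptotic `` {r}"
    using b by (auto simp: boundary_H3_def elim: quotientE)
  then obtain N where N: "dt N \<noteq> 0" "\<xi> = asymptotic `` {ray N}" by (metis geodesic_ray)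
  have in_\<xi>: "ray N \<in> \<xi>" using N equiv_class_self[OF equiv_asymptotic ray_geodesic] by simp
  have "tri N (T x)" if x: "x \<in> surface_gens g" for x
  proof -
    have w: "[(x, False)] \<in> words_over (surface_gens g)" using x by simp
    have d: "dt (T x) \<noteq> 0" using assms(1) x by (simp add: valid_def)
    have "(\<lambda>r. compose {0..} (rep g T (cls g [(x, False)])) r) ` \<xi> = \<xi>"
      using f w by (auto simp: fixes_ray_class_def surface_carrier)
    moreover have "rep g T (cls g [(x, False)]) = mob (T x)"
      using rep_cls[OF assms(1) w] by simp
    ultimately have "compose {0..} (mob (T x)) ` \<xi> = \<xi>" by simp
    then have "compose {0..} (mob (T x)) (ray N) \<in> \<xi>"
      using in_\<xi> by blast
    then have "(ray N, ray (T x * N)) \<in> asymptotic" using N d by (simp add: compose_ray)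
    then show ?thesis using asymptotic_iff[of N "T x * N"] N d by (simp add: tri_def mult.assoc del: m2_sel)
  qed
  then show ?thesis using that N by blast
qed

lemma tri_fixed_point:
  assumes "valid g T" "dt N \<noteq> 0" "\<forall>x\<in>surface_gens g. tri N (T x)"
  shows "asymptotic `` {ray N} \<in> fixed_points_at_infinity g (rep g T)"
proof -
  let ?\<xi> = "asymptotic `` {ray N}"
  have trans: "trans asymptotic" using equiv_asymptotic by (auto elim: equivE)
  have step: "ray (P * R) \<in> ?\<xi>" if "dt P \<noteq> 0" "tri N P" "dt R \<noteq> 0" "ray R \<in> ?\<xi>" for P R
  proof -
    have "(ray N, ray (P * N)) \<in> asymptotic"
      using asymptotic_iff[of N "P * N"] that assms(2) by (simp add: tri_def mult.assoc del: m2_sel)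
    moreover have "e21 (adj N * R) = 0" using asymptotic_iff[of N R] that assms(2) by (simp del: m2_sel)
    then have "e21 (adj (P * N) * (P * R)) = 0"
      by (simp add: mult.assoc del: m2_sel)
    then have "(ray (P * N), ray (P * R)) \<in> asymptotic"
      using asymptotic_iff[of "P * N" "P * R"] that assms(2) by (simp del: m2_sel)
    ultimately show ?thesis using trans by (auto dest: transD)
  qed
  \<comment> \<open>\<open>fixes_ray_class\<close> asks for equality of sets; the reverse inclusion
    holds because \<open>adj P\<close> fixes the same endpoint.\<close>
  have sub: "compose {0..} (mob P) ` ?\<xi> = ?\<xi>" if P: "dt P \<noteq> 0" "tri N P" for P
  proof
    show "compose {0..} (mob P) ` ?\<xi> \<subseteq> ?\<xi>"
    proof
      fix s assume "s \<in> compose {0..} (mob P) ` ?\<xi>"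
      then obtain r where r: "(ray N, r) \<in> asymptotic" "s = compose {0..} (mob P) r" by auto
      then have "r \<in> geodesic_rays H3 hdist" by (auto simp: asymptotic_def)
      then obtain R where R: "dt R \<noteq> 0" "r = ray R" by (rule geodesic_ray)
      then show "s \<in> ?\<xi>" using step[OF P, of R] r P by (simp add: compose_ray)
    qed
    show "?\<xi> \<subseteq> compose {0..} (mob P) ` ?\<xi>"
    proof
      fix r assume r: "r \<in> ?\<xi>"
      then have "r \<in> geodesic_rays H3 hdist" by (auto simp: asymptotic_def)
      then obtain R where R: "dt R \<noteq> 0" "r = ray R" by (rule geodesic_ray)
      have "ray (adj P * R) \<in> ?\<xi>" using step[of "adj P" R] P R r tri_adj by simp
      moreover have "compose {0..} (mob P) (ray (adj P * R)) = ray (sc (dt P) R)"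
        using P R by (simp add: compose_ray)
      moreover have "ray (sc (dt P) R) = ray R" using P R by (auto simp: ray_def act_scale)
      ultimately show "r \<in> compose {0..} (mob P) ` ?\<xi>" using R by (metis image_eqI)
    qed
  qed
  have "?\<xi> \<in> boundary_H3" using ray_geodesic[OF assms(2)] by (auto simp: boundary_H3_def intro: quotientI)
  moreover have "fixes_ray_class g (rep g T) ?\<xi>"
    unfolding fixes_ray_class_def surface_carrier
  proof clarify
    fix w assume w: "w \<in> words_over (surface_gens g)"
    have "dt (ev T w) \<noteq> 0" using assms(1) w dt_ev by (auto simp: valid_def)
    then show "(\<lambda>r. compose {0..} (rep g T (cls g w)) r) ` ?\<xi> = ?\<xi>"
      using sub[of "ev T w"] tri_ev[OF assms(2,3) w] by (simp add: rep_cls[OF assms(1) w])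
  qed
  ultimately show ?thesis by (simp add: fixed_points_at_infinity_def)
qed

lemma good_iff_fixed_points:
  assumes "valid g T"
  shows "good g T \<longleftrightarrow> fixed_points_at_infinity g (rep g T) = {} \<or>
      (\<exists>\<xi>\<in>fixed_points_at_infinity g (rep g T). \<exists>\<eta>\<in>fixed_points_at_infinity g (rep g T). \<xi> \<noteq> \<eta>)"
proof -
  let ?F = "fixed_points_at_infinity g (rep g T)"
  have "irr g T \<longleftrightarrow> ?F = {}"
    unfolding irr_def using fixed_point_tri[OF assms] tri_fixed_point[OF assms] by blast
  moreover have "diagable g T" if \<xi>: "\<xi> \<in> ?F" "\<eta> \<in> ?F" "\<xi> \<noteq> \<eta>" for \<xi> \<eta>
  proof -
    obtain N where N: "dt N \<noteq> 0" "\<xi> = asymptotic `` {ray N}" "\<forall>x\<in>surface_gens g. tri N (T x)"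
      using fixed_point_tri[OF assms \<xi>(1)] .
    obtain L where L: "dt L \<noteq> 0" "\<eta> = asymptotic `` {ray L}" "\<forall>x\<in>surface_gens g. tri L (T x)"
      using fixed_point_tri[OF assms \<xi>(2)] .
    \<comment> \<open>The first columns of \<open>N\<close> and \<open>L\<close>; the determinant is
      \<open>e21 (adj N * L)\<close>, nonzero because the endpoints differ.\<close>
    let ?G = "M2 (e11 N) (e11 L) (e21 N) (e21 L)"
    have "(ray N, ray L) \<notin> asymptotic" using \<xi>(3) N L equiv_class_eq[OF equiv_asymptotic] by blast
    then have "e21 (adj N * L) \<noteq> 0" using asymptotic_iff N(1) L(1) by blast
    then have "dt ?G \<noteq> 0" by (simp add: dt_def algebra_simps)
    moreover have "e21 (adj ?G * T x * ?G) = 0 \<and> e12 (adj ?G * T x * ?G) = 0" if "x \<in> surface_gens g" for x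
      using N(3) L(3) that unfolding tri_iff by (auto simp: algebra_simps)
    ultimately show ?thesis unfolding diagable_def by blast
  qed
  moreover have "\<exists>\<xi>\<in>?F. \<exists>\<eta>\<in>?F. \<xi> \<noteq> \<eta>" if D: "diagable g T"
  proof -
    obtain G where G: "dt G \<noteq> 0" "\<forall>x\<in>surface_gens g. e21 (adj G * T x * G) = 0 \<and> e12 (adj G * T x * G) = 0"
      using D unfolding diagable_def by blast
    \<comment> \<open>The columns of \<open>G\<close> in the opposite order, so that
      \<open>tri L\<close> tests the second column of \<open>G\<close>.\<close>
    define L where "L = M2 (e12 G) (e11 G) (e22 G) (e21 G)"
    have L: "dt L \<noteq> 0" using G(1) by (auto simp: dt_def L_def algebra_simps)
    have tG: "\<forall>x\<in>surface_gens g. tri G (T x)" using G(2) unfolding tri_def by blast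
    have tL: "\<forall>x\<in>surface_gens g. tri L (T x)"
    proof
      fix x assume "x \<in> surface_gens g"
      then have "e12 (adj G * T x * G) = 0" using G by blast
      then show "tri L (T x)" by (simp add: tri_iff L_def algebra_simps)
    qed
    have "e21 (adj G * L) = dt G" by (simp add: L_def dt_def)
    then have "(ray G, ray L) \<notin> asymptotic" using asymptotic_iff[OF G(1) L] G(1) by simp
    then have "asymptotic `` {ray G} \<noteq> asymptotic `` {ray L}"
      using eq_equiv_class[OF _ equiv_asymptotic ray_geodesic[OF L]] by blast
    then show ?thesis using tri_fixed_point[OF assms G(1) tG] tri_fixed_point[OF assms L tL] by metis
  qed
  ultimately show ?thesis unfolding good_def by metis
qed

section \<open>Hyperbolic points of the compactification\<close>

lemma equivariantly_isometric_sym: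
  assumes "equivariantly_isometric g (X, d, \<rho>) (X', d', \<rho>')"
    and "\<And>\<gamma> x. \<gamma> \<in> carrier (surface_group g) \<Longrightarrow> x \<in> X \<Longrightarrow> \<rho> \<gamma> x \<in> X"
  shows "equivariantly_isometric g (X', d', \<rho>') (X, d, \<rho>)"
proof -
  obtain f where f: "bij_betw f X X'" "\<And>x y. x \<in> X \<Longrightarrow> y \<in> X \<Longrightarrow> d' (f x) (f y) = d x y"
    "\<And>\<gamma> x. \<gamma> \<in> carrier (surface_group g) \<Longrightarrow> x \<in> X \<Longrightarrow> f (\<rho> \<gamma> x) = \<rho>' \<gamma> (f x)"
    using assms(1) by (auto simp: equivariantly_isometric_def)
  let ?h = "inv_into X f"
  have h: "?h y \<in> X" "f (?h y) = y" if "y \<in> X'" for y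
    using that f(1) bij_betw_inv_into_right bij_betw_apply[OF bij_betw_inv_into] by metis+
  have "?h (\<rho>' \<gamma> y) = \<rho> \<gamma> (?h y)" if "\<gamma> \<in> carrier (surface_group g)" "y \<in> X'" for \<gamma> y
    using f(3)[OF that(1) h(1)[OF that(2)]] h(2)[OF that(2)] assms(2)[OF that(1) h(1)[OF that(2)]]
      bij_betw_inv_into_left[OF f(1)] by metis
  moreover have "d (?h x) (?h y) = d' x y" if "x \<in> X'" "y \<in> X'" for x y
    using f(2)[OF h(1)[OF that(1)] h(1)[OF that(2)]] h(2) that by simp
  ultimately show ?thesis
    using bij_betw_inv_into[OF f(1)] by (auto simp: equivariantly_isometric_def)
qed

lemma equivariantly_isometric_trans:
  assumes "equivariantly_isometric g (X, d, \<rho>) (X', d', \<rho>')" "equivariantly_isometric g (X', d', \<rho>') (X'', d'', \<rho>'')"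
  shows "equivariantly_isometric g (X, d, \<rho>) (X'', d'', \<rho>'')"
proof -
  obtain f where f: "bij_betw f X X'" "\<And>x y. x \<in> X \<Longrightarrow> y \<in> X \<Longrightarrow> d' (f x) (f y) = d x y"
    "\<And>\<gamma> x. \<gamma> \<in> carrier (surface_group g) \<Longrightarrow> x \<in> X \<Longrightarrow> f (\<rho> \<gamma> x) = \<rho>' \<gamma> (f x)"
    using assms(1) by (auto simp: equivariantly_isometric_def)
  obtain h where h: "bij_betw h X' X''" "\<And>x y. x \<in> X' \<Longrightarrow> y \<in> X' \<Longrightarrow> d'' (h x) (h y) = d' x y"
    "\<And>\<gamma> x. \<gamma> \<in> carrier (surface_group g) \<Longrightarrow> x \<in> X' \<Longrightarrow> h (\<rho>' \<gamma> x) = \<rho>'' \<gamma> (h x)"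
    using assms(2) by (auto simp: equivariantly_isometric_def)
  have fX: "f x \<in> X'" if "x \<in> X" for x using that f(1) bij_betw_apply by metis
  show ?thesis unfolding equivariantly_isometric_def prod.case
    using bij_betw_trans[OF f(1) h(1)] f h fX by (intro exI[of _ "h \<circ> f"]) simp
qed

lemma isometry_class_eq:
  assumes "equivariantly_isometric g (X, d, \<rho>) (X', d', \<rho>')"
    and "\<And>\<gamma> x. \<gamma> \<in> carrier (surface_group g) \<Longrightarrow> x \<in> X \<Longrightarrow> \<rho> \<gamma> x \<in> X"
  shows "isometry_class g (X, d, \<rho>) = isometry_class g (X', d', \<rho>')"
  unfolding isometry_class_def
  using equivariantly_isometric_trans[OF assms(1)]
    equivariantly_isometric_trans[OF equivariantly_isometric_sym[OF assms]] by auto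

lemma generating_set_carrier: "s \<in> generating_set g \<Longrightarrow> s \<in> carrier (surface_group g)"
  by (auto simp: generating_set_def surface_carrier)

text \<open>Stated for all isometries, so that it passes at once to conjugates by
  orientation-reversing ones.\<close>

definition acts :: "nat \<Rightarrow> representation \<Rightarrow> bool" where
  "acts g \<rho> \<longleftrightarrow> (\<forall>\<gamma>\<in>carrier (surface_group g). \<rho> \<gamma> \<in> carrier isom_H3)"

lemma conjugate_apply:
  assumes "acts g \<rho>" "h \<in> carrier isom_H3" "\<gamma> \<in> carrier (surface_group g)" "x \<in> H3"
  shows "conjugate g h \<rho> \<gamma> (h x) = h (\<rho> \<gamma> x)" "conjugate g h \<rho> \<gamma> \<in> carrier isom_H3"
proof -
  interpret group isom_H3 by (rule group_isom_H3)
  have r: "\<rho> \<gamma> \<in> carrier isom_H3" using assms by (simp add: acts_def)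
  have hr: "h \<otimes>\<^bsub>isom_H3\<^esub> \<rho> \<gamma> \<in> carrier isom_H3" using assms r by simp
  show "conjugate g h \<rho> \<gamma> \<in> carrier isom_H3" using assms r by (simp add: conjugate_def)
  have "(inv\<^bsub>isom_H3\<^esub> h \<otimes>\<^bsub>isom_H3\<^esub> h) x = x"
    unfolding l_inv[OF assms(2)] isom_H3_simps(6) using assms(4) by simp
  then have i: "(inv\<^bsub>isom_H3\<^esub> h) (h x) = x"
    using isom_H3_simps(5)[OF inv_closed[OF assms(2)] assms(2)] assms(4) by (simp add: compose_def)
  have "conjugate g h \<rho> \<gamma> (h x) = (h \<otimes>\<^bsub>isom_H3\<^esub> \<rho> \<gamma>) ((inv\<^bsub>isom_H3\<^esub> h) (h x))"
    using isom_H3_simps(5)[OF hr inv_closed[OF assms(2)]] isom_H3_simps(1)[OF assms(2,4)] assms(3)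
    by (simp add: conjugate_def compose_def)
  also have "\<dots> = h (\<rho> \<gamma> x)"
    unfolding i using isom_H3_simps(5)[OF assms(2) r] assms(4) by (simp add: compose_def)
  finally show "conjugate g h \<rho> \<gamma> (h x) = h (\<rho> \<gamma> x)" .
qed

lemma min_displacement_conjugate:
  assumes "acts g \<rho>" "h \<in> carrier isom_H3"
  shows "min_displacement g (conjugate g h \<rho>) = min_displacement g \<rho>"
proof -
  have m: "max_displacement g (H3, hdist, conjugate g h \<rho>) (h x) = max_displacement g (H3, hdist, \<rho>) x"
    if "x \<in> H3" for x
  proof -
    have "hdist (h x) (conjugate g h \<rho> s (h x)) = hdist x (\<rho> s x)" if s: "s \<in> generating_set g" for s
      using conjugate_apply(1)[OF assms generating_set_carrier[OF s] \<open>x \<in> H3\<close>]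
        isom_H3_simps(2)[OF assms(2) \<open>x \<in> H3\<close>] isom_H3_simps(1)[of "\<rho> s" x] assms(1)
        generating_set_carrier[OF s] \<open>x \<in> H3\<close> by (simp add: acts_def)
    then show ?thesis by (simp add: max_displacement_def cong: image_cong)
  qed
  have "h ` H3 = H3" using isom_H3_simps(3)[OF assms(2)] by (simp add: bij_betw_def)
  then have "(\<lambda>x. max_displacement g (H3, hdist, conjugate g h \<rho>) x) ` H3
    = (\<lambda>x. max_displacement g (H3, hdist, conjugate g h \<rho>) (h x)) ` H3"
    by (metis image_image)
  also have "\<dots> = (\<lambda>x. max_displacement g (H3, hdist, \<rho>) x) ` H3"
    using m by (simp cong: image_cong)
  finally show ?thesis by (simp add: min_displacement_def)
qed

lemma isometry_class_conjugate:
  assumes "acts g \<rho>" "h \<in> carrier isom_H3"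
  shows "isometry_class g (rescaled_H3 g (conjugate g h \<rho>)) = isometry_class g (rescaled_H3 g \<rho>)"
proof -
  have "equivariantly_isometric g (rescaled_H3 g \<rho>) (rescaled_H3 g (conjugate g h \<rho>))"
    unfolding rescaled_H3_def equivariantly_isometric_def prod.case min_displacement_conjugate[OF assms]
    using isom_H3_simps(2,3)[OF assms(2)] conjugate_apply(1)[OF assms] by (intro exI[of _ h]) simp
  then show ?thesis
    unfolding rescaled_H3_def using assms(1) isom_H3_simps(1)
    by (intro isometry_class_eq[symmetric]) (auto simp: acts_def)
qed

lemma rep_space_acts: "\<rho> \<in> rep_space g \<Longrightarrow> acts g \<rho>"
  by (auto simp: rep_space_def acts_def hom_def isom_plus_H3_def)

definition pt :: "nat \<Rightarrow> (surface_gen \<Rightarrow> m2) \<Rightarrow> (real^3) gamma_space set" where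
  "pt g T = isometry_class g (rescaled_H3 g (rep g T))"

text \<open>A conjugating isometry is itself an equivariant isometry between the rescaled spaces, so
  the union over the whole orbit is a single class.\<close>

lemma hyperbolic_point_orbit:
  assumes "\<rho> \<in> rep_space g"
  shows "hyperbolic_point g ((\<lambda>h. conjugate g h ` conjugacy_class g \<rho>) ` carrier isom_H3)
    = isometry_class g (rescaled_H3 g \<rho>)"
proof -
  let ?S = "\<Union> ((\<lambda>h. conjugate g h ` conjugacy_class g \<rho>) ` carrier isom_H3)"
  note a = rep_space_acts[OF assms]
  have "isometry_class g (rescaled_H3 g \<rho>') = isometry_class g (rescaled_H3 g \<rho>)" if \<rho>': "\<rho>' \<in> ?S" for \<rho>'
  proof -
    obtain h k where hk: "h \<in> carrier isom_H3" "k \<in> carrier isom_plus_H3" "\<rho>' = conjugate g h (conjugate g k \<rho>)"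
      using \<rho>' by (auto simp: conjugacy_class_def)
    have k: "k \<in> carrier isom_H3" using hk by (simp add: isom_plus_H3_def)
    have "acts g (conjugate g k \<rho>)" using conjugate_apply(2)[OF a k _ jpt_H3] by (simp add: acts_def)
    then show ?thesis using isometry_class_conjugate[OF a k] isometry_class_conjugate hk by simp
  qed
  moreover have "?S \<noteq> {}"
    using mob_isom[of 1] mob_isom_plus[of 1] by (auto simp: conjugacy_class_def)
  ultimately show ?thesis unfolding hyperbolic_point_def by (auto simp: SUP_eq_const)
qed

text \<open>From here on conjugacy classes give way to tuples of matrices, on which families can be
  written down explicitly.\<close>

lemma hyperbolic_points_eq: "hyperbolic_points g = pt g ` {T. valid g T \<and> good g T}"
proof -
  define Q where "Q \<rho> \<longleftrightarrow> fixed_points_at_infinity g \<rho> = {} \<or>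
      (\<exists>\<xi>\<in>fixed_points_at_infinity g \<rho>. \<exists>\<eta>\<in>fixed_points_at_infinity g \<rho>. \<xi> \<noteq> \<eta>)" for \<rho>
  define F where "F C = (\<lambda>h. conjugate g h ` C) ` carrier isom_H3" for C
  have "hyperbolic_points g = hyperbolic_point g ` {F C | C. C \<in> {conjugacy_class g \<rho> | \<rho>. \<rho> \<in> rep_space g \<and> Q \<rho>}}"
    unfolding hyperbolic_points_def m_u_def m_o_def F_def Q_def ..
  also have "\<dots> = (\<lambda>\<rho>. hyperbolic_point g (F (conjugacy_class g \<rho>))) ` {\<rho> \<in> rep_space g. Q \<rho>}"
    by blast
  also have "\<dots> = (\<lambda>\<rho>. isometry_class g (rescaled_H3 g \<rho>)) ` {\<rho> \<in> rep_space g. Q \<rho>}"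
    unfolding F_def using hyperbolic_point_orbit by (intro image_cong refl) blast
  also have "{\<rho> \<in> rep_space g. Q \<rho>} = rep g ` {T. valid g T \<and> good g T}"
  proof (intro equalityI subsetI)
    fix \<rho> assume \<rho>: "\<rho> \<in> {\<rho> \<in> rep_space g. Q \<rho>}"
    then have "\<rho> \<in> rep_space g" by blast
    then obtain T where T: "valid g T" "\<rho> = rep g T" by (rule rep_space_rep)
    have "good g T" using good_iff_fixed_points[OF T(1)] \<rho> T(2) by (simp add: Q_def)
    then show "\<rho> \<in> rep g ` {T. valid g T \<and> good g T}" using T by blast
  next
    fix \<rho> assume "\<rho> \<in> rep g ` {T. valid g T \<and> good g T}"
    then obtain T where T: "valid g T" "good g T" "\<rho> = rep g T" by blast
    then show "\<rho> \<in> {\<rho> \<in> rep_space g. Q \<rho>}"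
      using rep_in_rep_space[OF T(1)] good_iff_fixed_points[OF T(1)] by (simp add: Q_def)
  qed
  finally show ?thesis by (simp add: image_image pt_def)
qed

lemma rep_apply:
  assumes "valid g T" "w \<in> words_over (surface_gens g)" "x \<in> H3"
  shows "rep g T (cls g w) x = act (ev T w) x"
  using assms by (simp add: rep_cls)

lemma surface_gens_finite: "finite (surface_gens g)"
  by (simp add: surface_gens_def)

lemma generating_set_finite: "finite (generating_set g)"
proof -
  have "generating_set g = (\<lambda>(x, b). cls g [(x, b)]) ` (surface_gens g \<times> UNIV)"
    by (auto simp: generating_set_def)
  then show ?thesis using surface_gens_finite by simp
qed

lemma GenA_1_in: "1 \<le> g \<Longrightarrow> GenA 1 \<in> surface_gens g"
  by (auto simp: surface_gens_def)

section \<open>Displacement of the generators\<close>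

abbreviation disp :: "nat \<Rightarrow> (surface_gen \<Rightarrow> m2) \<Rightarrow> real^3 \<Rightarrow> real" where
  "disp g T \<equiv> max_displacement g (H3, hdist, rep g T)"

text \<open>A generator and its inverse displace a point equally, so the symmetric generating set
  reduces to the generators themselves.\<close>

lemma max_displacement_le:
  assumes "valid g T" "x \<in> H3" "1 \<le> g"
  shows "disp g T x \<le> K \<longleftrightarrow> (\<forall>y\<in>surface_gens g. hdist x (act (T y) x) \<le> K)"
proof -
  have ne: "generating_set g \<noteq> {}"
    using GenA_1_in[OF assms(3)] by (auto simp: generating_set_def)
  have d: "hdist x (rep g T (cls g [(y, b)]) x) = hdist x (act (T y) x)" if y: "y \<in> surface_gens g" for y b
  proof (cases b)
    case False
    then show ?thesis using rep_apply[OF assms(1) _ assms(2), of "[(y, b)]"] y by simp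
  next
    case True
    have dy: "dt (T y) \<noteq> 0" using assms(1) y by (simp add: valid_def)
    have "hdist x (rep g T (cls g [(y, b)]) x) = hdist x (act (adj (T y)) x)"
      using rep_apply[OF assms(1) _ assms(2), of "[(y, b)]"] y True by simp
    also have "\<dots> = hdist (act (T y) x) (act (T y) (act (adj (T y)) x))"
      using dy assms(2) by (simp del: act_adj)
    finally show ?thesis using dy assms(2) by (simp add: hdist_sym)
  qed
  have "disp g T x \<le> K \<longleftrightarrow> (\<forall>s\<in>generating_set g. hdist x (rep g T s x) \<le> K)"
    using ne generating_set_finite by (simp add: max_displacement_def)
  also have "\<dots> \<longleftrightarrow> (\<forall>y\<in>surface_gens g. hdist x (act (T y) x) \<le> K)"
    using d by (auto simp: generating_set_def) metis+
  finally show ?thesis .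
qed

lemma max_displacement_nonneg:
  assumes "valid g T" "x \<in> H3" "1 \<le> g"
  shows "0 \<le> disp g T x"
proof -
  have "hdist x (act (T (GenA 1)) x) \<le> disp g T x"
    using max_displacement_le[OF assms] GenA_1_in[OF assms(3)] by blast
  then show ?thesis using hdist_nonneg order_trans by blast
qed

lemma min_displacement_less_iff:
  assumes "valid g T" "1 \<le> g"
  shows "min_displacement g (rep g T) < K \<longleftrightarrow> (\<exists>x\<in>H3. disp g T x < K)"
  unfolding min_displacement_def
  by (rule cINF_less_iff, use jpt_H3 in blast)
    (rule bdd_belowI2[of _ 0], rule max_displacement_nonneg[OF assms(1) _ assms(2)])

lemma min_displacement_le:
  assumes "valid g T" "1 \<le> g" "x \<in> H3"
  shows "min_displacement g (rep g T) \<le> disp g T x"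
  unfolding min_displacement_def
  by (rule cINF_lower[OF _ assms(3)])
    (rule bdd_belowI2[of _ 0], rule max_displacement_nonneg[OF assms(1) _ assms(2)])

section \<open>Hyperbolicity constants\<close>

lemma geodesic_segment_scaled:
  assumes "0 < l" "geodesic_segment X d x y s"
  shows "geodesic_segment X (\<lambda>x y. d x y / l) x y s"
proof -
  obtain c where c: "c \<in> {0..d x y} \<rightarrow> X" "c 0 = x" "c (d x y) = y"
    "\<And>t u. t \<in> {0..d x y} \<Longrightarrow> u \<in> {0..d x y} \<Longrightarrow> d (c t) (c u) = \<bar>t - u\<bar>" "s = c ` {0..d x y}"
    using assms(2) by (auto simp: geodesic_segment_def)
  have m: "l * t \<in> {0..d x y} \<longleftrightarrow> t \<in> {0..d x y / l}" for t
    using assms(1) by (auto simp: field_simps zero_le_mult_iff)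
  have im: "(\<lambda>t. l * t) ` {0..d x y / l} = {0..d x y}"
    using assms(1) by (simp add: image_mult_atLeastAtMost)
  show ?thesis unfolding geodesic_segment_def
  proof (intro exI[of _ "\<lambda>t. c (l * t)"] conjI ballI)
    show "(\<lambda>t. c (l * t)) \<in> {0..d x y / l} \<rightarrow> X" using c(1) m by (auto simp: Pi_iff simp del: atLeastAtMost_iff)
    show "s = (\<lambda>t. c (l * t)) ` {0..d x y / l}"
      unfolding c(5) im[symmetric] image_image ..
    fix t u assume tu: "t \<in> {0..d x y / l}" "u \<in> {0..d x y / l}"
    have "d (c (l * t)) (c (l * u)) = \<bar>l * t - l * u\<bar>" using c(4) m tu by blast
    also have "\<dots> = l * \<bar>t - u\<bar>" using assms(1) by (simp add: abs_mult flip: right_diff_distrib)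
    finally show "d (c (l * t)) (c (l * u)) / l = \<bar>t - u\<bar>" using assms(1) by simp
  qed (use c assms(1) in auto)
qed

lemma geodesic_segment_scale:
  assumes "0 < l"
  shows "geodesic_segment X (\<lambda>x y. d x y / l) x y s \<longleftrightarrow> geodesic_segment X d x y s"
  using geodesic_segment_scaled[OF assms, of X d x y s]
    geodesic_segment_scaled[of "1 / l" X "\<lambda>x y. d x y / l" x y s] assms by auto

lemma thin_triangles_scale:
  assumes "0 < l"
  shows "thin_triangles X (\<lambda>x y. d x y / l) \<delta> \<longleftrightarrow> thin_triangles X d (l * \<delta>)"
  using assms unfolding thin_triangles_def geodesic_segment_scale[OF assms] in_neighbourhood_def
  by (simp add: pos_divide_le_eq mult.commute)

text \<open>Multiplication by \<open>l\<close> matches the two sets of admissible constants; the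
  given \<open>\<delta>\<close> ensures that the infima are taken over nonempty sets.\<close>

lemma hyp_const_scale:
  assumes "0 < l" "0 \<le> \<delta>" "thin_triangles X d \<delta>"
  shows "hyp_const X (\<lambda>x y. d x y / l) = hyp_const X d / l"
proof -
  let ?A = "{\<delta>. 0 \<le> \<delta> \<and> thin_triangles X d \<delta>}" and ?B = "{\<delta>. 0 \<le> \<delta> \<and> thin_triangles X d (l * \<delta>)}"
  have A: "?A \<noteq> {}" "bdd_below ?A" using assms by (auto intro: bdd_belowI[of _ 0])
  have "\<delta> / l \<in> ?B" using assms by auto
  then have B: "?B \<noteq> {}" "bdd_below ?B" using assms by (blast, auto intro: bdd_belowI[of _ 0])
  have "Inf ?A \<le> l * Inf ?B"
  proof -
    have "Inf ?A / l \<le> Inf ?B"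
    proof (rule cInf_greatest[OF B(1)])
      fix x assume "x \<in> ?B"
      then have "l * x \<in> ?A" using assms by auto
      then have "Inf ?A \<le> l * x" by (intro cInf_lower A)
      then show "Inf ?A / l \<le> x" using assms by (simp add: pos_divide_le_eq mult.commute)
    qed
    then show ?thesis using assms by (simp add: pos_divide_le_eq mult.commute)
  qed
  moreover have "l * Inf ?B \<le> Inf ?A"
  proof (rule cInf_greatest[OF A(1)])
    fix x assume "x \<in> ?A"
    then have "x / l \<in> ?B" using assms by auto
    then have "Inf ?B \<le> x / l" by (intro cInf_lower B)
    then show "l * Inf ?B \<le> x" using assms by (simp add: pos_le_divide_eq mult.commute)
  qed
  ultimately have "l * Inf ?B = Inf ?A" by simp
  then show ?thesis using assms unfolding hyp_const_def thin_triangles_scale[OF assms(1)]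
    by (simp add: field_simps)
qed

text \<open>Stewart's theorem in hyperbolic geometry. Along the vertical axis, in logarithmic height
  \<open>u\<close>, \<open>cosh\<close> of the distance to \<open>w'\<close> is a combination of
  \<open>exp u\<close> and \<open>exp (- u)\<close>, and all such functions satisfy this three-term
  relation.\<close>

lemma geodesic_point_dist:
  assumes xy: "x \<in> H3" "y \<in> H3" "x \<noteq> y" and p: "p \<in> H3" "w \<in> H3"
    and d: "hdist x p = a" "hdist p y = hdist x y - a"
  shows "sinh (hdist x y) * cosh (hdist p w) =
    sinh (hdist x y - a) * cosh (hdist x w) + sinh a * cosh (hdist y w)"
proof -
  define b where "b = hdist x y"
  have b: "b \<noteq> 0" using xy hdist_0 by (simp add: b_def)
  obtain M where M: "dt M \<noteq> 0" "act M jpt = x" "act M (vp (exp b)) = y"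
    using two_point[OF xy(1,2)] unfolding b_def by blast
  define p' w' where pw: "p' = act (adj M) p" "w' = act (adj M) w"
  have pw': "p' \<in> H3" "w' \<in> H3" "act M p' = p" "act M w' = w" using M(1) p by (simp_all add: pw)
  have tr: "hdist (act M u) (act M v) = hdist u v" if "u \<in> H3" "v \<in> H3" for u v
    using M(1) that by simp
  have a: "0 \<le> a" "a \<le> b" using d hdist_nonneg[of x p] hdist_nonneg[of p y] by (auto simp: b_def)
  have "hdist jpt p' = a" using tr[of jpt p'] pw' M d by simp
  then have 1: "hdist jpt p' = hdist jpt (vp (exp a))" using a by (simp add: jpt_eq hdist_vp)
  have "hdist (vp (exp b)) p' = b - a" using tr[of "vp (exp b)" p'] pw' M d by (simp add: hdist_sym b_def)
  then have 2: "hdist (vp (exp b)) p' = hdist (vp (exp b)) (vp (exp a))" using a by (simp add: hdist_vp)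
  have "p' = vp (exp a)"
    using height_from_dist[of p' "vp (exp a)" "exp b"] pw' b 1 2 by (simp add: cz_eq)
  then have "hdist p w = hdist (vp (exp a)) w'" "hdist x w = hdist (vp 1) w'" "hdist y w = hdist (vp (exp b)) w'"
    using tr[of p' w'] tr[of jpt w'] tr[of "vp (exp b)" w'] pw' M by (simp_all add: jpt_eq)
  note D = this
  define R t where "R = (cmod (cz w'))\<^sup>2 + (w' $ 3)\<^sup>2" and "t = w' $ 3"
  have t: "0 < t" using pw' by (simp add: H3_def t_def)
  have C: "cosh (hdist (vp (exp u)) w') = (R * exp (- u) + exp u) / (2 * t)" for u
  proof -
    have "2 * cosh (hdist (vp (exp u)) w') = (R + (exp u)\<^sup>2) / (exp u * t)"
      using pw' by (simp add: cosh_hdist R_def t_def add_ac)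
    also have "\<dots> = (R * exp (- u) + exp u) / t"
      by (simp add: exp_minus divide_simps power2_eq_square) 
    finally show ?thesis using t by (simp add: field_simps)
  qed
  have C1: "cosh (hdist (vp 1) w') = (R + 1) / (2 * t)" using C[of 0] by simp
  have s: "sinh b * (R * exp (- a) + exp a) = sinh (b - a) * (R + 1) + sinh a * (R * exp (- b) + exp b)"
    unfolding sinh_field_def by (simp add: exp_diff exp_minus field_simps)
  show ?thesis unfolding b_def[symmetric] D C C1
    using s t by (simp add: field_simps)
qed

lemma sinh_bounds: "sinh x \<le> exp x / 2" "1 \<le> x \<Longrightarrow> exp x / 4 \<le> sinh x" "0 \<le> x \<Longrightarrow> cosh x \<le> exp x" for x :: real
proof -
  show "sinh x \<le> exp x / 2" by (simp add: sinh_field_def)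
  show "cosh x \<le> exp x" if "0 \<le> x" using that by (simp add: cosh_field_def)
  assume x: "1 \<le> x"
  have "2 \<le> exp (2 * x)" using exp_ge_add_one_self[of "2 * x"] x by linarith
  then have "2 * exp (- x) \<le> exp (2 * x) * exp (- x)" by (intro mult_right_mono) auto
  also have "\<dots> = exp x" by (simp flip: exp_add)
  finally show "exp x / 4 \<le> sinh x" by (simp add: sinh_field_def)
qed

text \<open>The bound on \<open>a\<close> says that \<open>p\<close> and \<open>q\<close> lie within
  the Gromov product of \<open>y\<close> and \<open>z\<close> at \<open>x\<close>. Stewart's
  theorem, used twice, expresses \<open>cosh (hdist p q)\<close> through the side lengths, and
  exponentials then bound every term.\<close>

lemma fellow_travel:
  assumes H: "x \<in> H3" "y \<in> H3" "z \<in> H3" "p \<in> H3" "q \<in> H3"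
    and p: "hdist x p = a" "hdist p y = hdist x y - a" and q: "hdist x q = a" "hdist q z = hdist x z - a"
    and a: "2 * a \<le> hdist x y + hdist x z - hdist y z"
  shows "hdist p q \<le> 24"
proof -
  define b c e where bce: "b = hdist x y" "c = hdist x z" "e = hdist y z"
  have a0: "0 \<le> a" "a \<le> b" "a \<le> c" "0 \<le> e"
    using p q hdist_nonneg[of x p] hdist_nonneg[of p y] hdist_nonneg[of q z] by (auto simp: bce)
  show ?thesis
  proof (cases "1 \<le> b \<and> 1 \<le> c")
    \<comment> \<open>If a side is shorter than 1, so is \<open>a\<close>, and the way through
      \<open>x\<close> is short. The lower bound for \<open>sinh\<close> in the other case needs
      sides of length at least 1.\<close>
    case False
    then have "a \<le> 1" using a0 by linarith
    moreover have "hdist p q \<le> hdist p x + hdist x q" using H by (intro hdist_triangle)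
    ultimately show ?thesis using p q by (simp add: hdist_sym)
  next
    case True
    then have bc: "1 \<le> b" "1 \<le> c" by auto
    then have ne: "x \<noteq> y" "x \<noteq> z" using H by (auto simp: bce)
    have 1: "sinh c * cosh (hdist p q) = sinh (c - a) * cosh a + sinh a * cosh (hdist p z)"
      using geodesic_point_dist[OF H(1,3) ne(2) H(5,4) q] p by (simp add: bce hdist_sym)
    have 2: "sinh b * cosh (hdist p z) = sinh (b - a) * cosh c + sinh a * cosh e"
      using geodesic_point_dist[OF H(1,2) ne(1) H(4,3) p] by (simp add: bce)
    have s0: "0 \<le> sinh b" "0 \<le> sinh c" "0 \<le> sinh a" "0 \<le> sinh (b - a)" "0 \<le> sinh (c - a)"
      using a0 bc by auto
    have "(sinh b * sinh c) * cosh (hdist p q) = sinh b * sinh (c - a) * cosh a + sinh a * (sinh b * cosh (hdist p z))"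
      using 1 by (simp add: algebra_simps)
    also have "\<dots> = sinh b * sinh (c - a) * cosh a + sinh a * sinh (b - a) * cosh c + sinh a * sinh a * cosh e"
      unfolding 2 by (simp add: algebra_simps)
    also have "\<dots> \<le> (exp b / 2) * (exp (c - a) / 2) * exp a + (exp a / 2) * (exp (b - a) / 2) * exp c
      + (exp a / 2) * (exp a / 2) * exp e"
      using s0 a0 bc sinh_bounds by (intro add_mono mult_mono) auto
    also have "\<dots> = (exp (b + c) + exp (b + c) + exp (2 * a + e)) / 4"
      by (simp add: exp_add exp_diff exp_double power2_eq_square)
    also have "\<dots> \<le> 3 * exp (b + c) / 4"
      using a by (simp add: bce)
    finally have u: "(sinh b * sinh c) * cosh (hdist p q) \<le> 3 * exp (b + c) / 4" .
    have "(exp b / 4) * (exp c / 4) * cosh (hdist p q) \<le> (sinh b * sinh c) * cosh (hdist p q)"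
      using s0 bc sinh_bounds(2) by (intro mult_right_mono mult_mono) auto
    then have "(exp b / 4) * (exp c / 4) * cosh (hdist p q) \<le> 3 * exp (b + c) / 4"
      using u by (rule order_trans)
    then have "exp (b + c) * cosh (hdist p q) \<le> exp (b + c) * 12"
      by (simp add: exp_add field_simps)
    \<comment> \<open>The 12 is \<open>16 * 3 / 4\<close>: 16 from the two \<open>sinh\<close>
      bounds and \<open>3 / 4\<close> from the three exponentials. The bound
      \<open>x \<le> 2 * cosh x\<close> doubles it to 24.\<close>
    then have "cosh (hdist p q) \<le> 12" by (simp only: mult_le_cancel_left_pos[OF exp_gt_zero])
    then show ?thesis using le_2cosh[of "hdist p q"] by linarith
  qed
qed

lemma geodesic_segment_rev:
  assumes "geodesic_segment X d x y s" "d y x = d x y"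
  shows "geodesic_segment X d y x s"
proof -
  obtain c where c: "c \<in> {0..d x y} \<rightarrow> X" "c 0 = x" "c (d x y) = y"
    "\<And>t u. t \<in> {0..d x y} \<Longrightarrow> u \<in> {0..d x y} \<Longrightarrow> d (c t) (c u) = \<bar>t - u\<bar>" "s = c ` {0..d x y}"
    using assms(1) by (auto simp: geodesic_segment_def)
  have "s = (\<lambda>t. c (d x y - t)) ` {0..d x y}"
    unfolding c(5) by (auto intro!: image_eqI[where x = "d x y - _"])
  then show ?thesis unfolding geodesic_segment_def assms(2)
    using c(1-4) by (intro exI[of _ "\<lambda>t. c (d x y - t)"]) (auto simp: Pi_iff)
qed

lemma geodesic_segmentE:
  assumes "geodesic_segment X d x y s" "p \<in> s"
  obtains a where "0 \<le> a" "a \<le> d x y" "d x p = a" "d p y = d x y - a" "p \<in> X"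
proof -
  obtain c where c: "c \<in> {0..d x y} \<rightarrow> X" "c 0 = x" "c (d x y) = y"
    "\<And>t u. t \<in> {0..d x y} \<Longrightarrow> u \<in> {0..d x y} \<Longrightarrow> d (c t) (c u) = \<bar>t - u\<bar>" "s = c ` {0..d x y}"
    using assms(1) by (auto simp: geodesic_segment_def)
  obtain a where a: "0 \<le> a" "a \<le> d x y" "p = c a" using assms(2) c(5) by auto
  then have "p \<in> X" using funcset_mem[OF c(1), of a] by simp
  moreover have "d x p = a" "d p y = d x y - a" using a c(4)[of 0 a] c(4)[of a "d x y"] c(2,3) by auto
  ultimately show ?thesis using that a by blast
qed

lemma geodesic_segment_point:
  assumes "geodesic_segment X d x y s" "0 \<le> a" "a \<le> d x y"
  obtains p where "p \<in> s" "d x p = a" "d p y = d x y - a" "p \<in> X"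
proof -
  obtain c where c: "c \<in> {0..d x y} \<rightarrow> X" "c 0 = x" "c (d x y) = y"
    "\<And>t u. t \<in> {0..d x y} \<Longrightarrow> u \<in> {0..d x y} \<Longrightarrow> d (c t) (c u) = \<bar>t - u\<bar>" "s = c ` {0..d x y}"
    using assms(1) by (auto simp: geodesic_segment_def)
  show ?thesis using that[of "c a"] funcset_mem[OF c(1), of a] c(4)[of 0 a] c(4)[of a "d x y"] c(2,3,5) assms(2,3) by auto
qed

text \<open>Every point of the side from \<open>x\<close> to \<open>y\<close> lies within the Gromov
  product of one of its two ends, and so it fellow travels with the other side issuing from that
  end.\<close>

lemma H3_side_near:
  assumes H: "x \<in> H3" "y \<in> H3" "z \<in> H3"
    and s: "geodesic_segment H3 hdist x y s" "geodesic_segment H3 hdist x z s'" "geodesic_segment H3 hdist y z s''"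
  shows "in_neighbourhood hdist 24 s (s' \<union> s'')"
  unfolding in_neighbourhood_def
proof
  fix p assume "p \<in> s"
  then obtain a where a: "0 \<le> a" "a \<le> hdist x y" "hdist x p = a" "hdist p y = hdist x y - a" "p \<in> H3"
    using geodesic_segmentE[OF s(1)] by metis
  show "\<exists>q\<in>s' \<union> s''. hdist p q \<le> 24"
  proof (cases "2 * a \<le> hdist x y + hdist x z - hdist y z")
    case True
    have "a \<le> hdist x z" using True hdist_triangle[OF H(1,3,2)] by (simp add: hdist_sym)
    then obtain q where q: "q \<in> s'" "hdist x q = a" "hdist q z = hdist x z - a" "q \<in> H3"
      using geodesic_segment_point[OF s(2) a(1)] by metis
    show ?thesis using fellow_travel[OF H a(5) q(4) a(3,4) q(2,3) True] q(1) by blast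
  next
    case False
    let ?a = "hdist x y - a"
    have c: "2 * ?a \<le> hdist y x + hdist y z - hdist x z" using False by (simp add: hdist_sym)
    then have "?a \<le> hdist y z" using hdist_triangle[OF H(2,3,1)] by (simp add: hdist_sym)
    then obtain q where q: "q \<in> s''" "hdist y q = ?a" "hdist q z = hdist y z - ?a" "q \<in> H3"
      using geodesic_segment_point[OF s(3)] a by (metis diff_ge_0_iff_ge)
    have "hdist y p = ?a" "hdist p x = hdist y x - ?a" using a by (simp_all add: hdist_sym)
    then show ?thesis using fellow_travel[OF H(2,1,3) a(5) q(4) _ _ q(2,3) c] q(1) by blast
  qed
qed

text \<open>What counts is that some finite constant exists: rescaling the metric divides the best
  constant by the scale, so it tends to 0 along a degenerating family.\<close>

lemma H3_thin: "thin_triangles H3 hdist 24"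
  unfolding thin_triangles_def
proof (intro ballI allI impI, elim conjE, intro conjI)
  fix x y z s1 s2 s3 assume H: "x \<in> H3" "y \<in> H3" "z \<in> H3"
    and s: "geodesic_segment H3 hdist x y s1" "geodesic_segment H3 hdist y z s2" "geodesic_segment H3 hdist z x s3"
  note r = s[THEN geodesic_segment_rev, OF hdist_sym]
  show "in_neighbourhood hdist 24 s1 (s2 \<union> s3)"
    using H3_side_near[OF H s(1) r(3) s(2)] by (simp add: Un_commute)
  show "in_neighbourhood hdist 24 s2 (s3 \<union> s1)"
    using H3_side_near[OF H(2,3,1) s(2) r(1) s(3)] by (simp add: Un_commute)
  show "in_neighbourhood hdist 24 s3 (s1 \<union> s2)"
    using H3_side_near[OF H(3,1,2) s(3) r(2) s(1)] by (simp add: Un_commute)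
qed

lemma hyp_const_H3_scale: "0 < l \<Longrightarrow> hyp_const H3 (\<lambda>x y. hdist x y / l) = hyp_const H3 hdist / l"
  using hyp_const_scale[OF _ _ H3_thin] by simp

section \<open>Lines\<close>

lemma line_segment:
  assumes f: "bij_betw f (UNIV :: real set) X" "\<And>s t. d (f s) (f t) = \<bar>s - t\<bar>"
  shows "geodesic_segment X d (f s) (f t) S \<longleftrightarrow> S = f ` {min s t..max s t}"
proof
  have fX: "f u \<in> X" for u using f(1) bij_betw_apply by fastforce
  have one: "f ` {min s t..max s t} = (\<lambda>u. f (s + sgn (t - s) * u)) ` {0..\<bar>s - t\<bar>}"
  proof -
    have "{min s t..max s t} = (\<lambda>u. s + sgn (t - s) * u) ` {0..\<bar>s - t\<bar>}"
    proof (intro equalityI subsetI)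
      fix v assume "v \<in> {min s t..max s t}"
      then show "v \<in> (\<lambda>u. s + sgn (t - s) * u) ` {0..\<bar>s - t\<bar>}"
        by (intro image_eqI[of _ _ "\<bar>v - s\<bar>"]) (auto simp: sgn_if split: if_splits)
    qed (auto simp: sgn_if split: if_splits)
    then show ?thesis by (simp add: image_image)
  qed
  have "geodesic_segment X d (f s) (f t) (f ` {min s t..max s t})"
    unfolding one geodesic_segment_def f(2)
    by (intro exI[of _ "\<lambda>u. f (s + sgn (t - s) * u)"]) (auto simp: f(2) fX sgn_if)
  then show "geodesic_segment X d (f s) (f t) S" if "S = f ` {min s t..max s t}" using that by simp
  assume S: "geodesic_segment X d (f s) (f t) S"
  show "S = f ` {min s t..max s t}"
  proof (intro equalityI subsetI)
    fix p assume "p \<in> S"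
    then obtain a where a: "0 \<le> a" "a \<le> \<bar>s - t\<bar>" "d (f s) p = a" "d p (f t) = \<bar>s - t\<bar> - a" "p \<in> X"
      using geodesic_segmentE[OF S] unfolding f(2) by metis
    obtain v where v: "p = f v" using a(5) f(1) by (auto simp: bij_betw_def)
    have "v \<in> {min s t..max s t}" using a unfolding v f(2) by auto
    then show "p \<in> f ` {min s t..max s t}" using v by blast
  next
    fix p assume "p \<in> f ` {min s t..max s t}"
    then obtain v where v: "p = f v" "min s t \<le> v" "v \<le> max s t" by auto
    then have le: "\<bar>s - v\<bar> \<le> \<bar>s - t\<bar>" by (auto simp: min_def max_def split: if_splits)
    obtain q where q: "q \<in> S" "d (f s) q = \<bar>s - v\<bar>" "d q (f t) = \<bar>s - t\<bar> - \<bar>s - v\<bar>" "q \<in> X"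
      using geodesic_segment_point[OF S, of "\<bar>s - v\<bar>", unfolded f(2), OF abs_ge_zero le] by blast
    obtain w where w: "q = f w" using q(4) f(1) by (auto simp: bij_betw_def)
    have "w = v" using q(2,3) v(2,3) unfolding w f(2) by (auto simp: min_def max_def abs_if split: if_splits)
    then show "p \<in> S" using q(1) w v by simp
  qed
qed

text \<open>On a line each side of a triangle is contained in the union of the two others.\<close>

lemma line_hyp_const:
  assumes f: "bij_betw f (UNIV :: real set) X" "\<And>s t. d (f s) (f t) = \<bar>s - t\<bar>"
  shows "hyp_const X d = 0"
proof -
  have "thin_triangles X d 0"
    unfolding thin_triangles_def
  proof (intro ballI allI impI)
    fix x y z s1 s2 s3 assume H: "x \<in> X" "y \<in> X" "z \<in> X"
      and s: "geodesic_segment X d x y s1 \<and> geodesic_segment X d y z s2 \<and> geodesic_segment X d z x s3"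
    obtain a b c where abc: "x = f a" "y = f b" "z = f c" using H f(1) by (auto simp: bij_betw_def)
    have seg: "s1 = f ` {min a b..max a b}" "s2 = f ` {min b c..max b c}" "s3 = f ` {min c a..max c a}"
      using s unfolding abc line_segment[OF f] by auto
    have n: "in_neighbourhood d 0 A B" if AB: "A \<subseteq> B" "A \<subseteq> range f" for A B
      unfolding in_neighbourhood_def
    proof
      fix p assume "p \<in> A"
      then obtain u where "p = f u" "p \<in> B" using AB by blast
      then show "\<exists>q\<in>B. d p q \<le> 0" using f(2)[of u u] by (intro bexI[of _ p]) simp_all
    qed
    show "in_neighbourhood d 0 s1 (s2 \<union> s3) \<and> in_neighbourhood d 0 s2 (s3 \<union> s1) \<and> in_neighbourhood d 0 s3 (s1 \<union> s2)"
      unfolding seg image_Un[symmetric] by (intro conjI n image_mono) auto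
  qed
  then have "0 \<in> {\<delta>. 0 \<le> \<delta> \<and> thin_triangles X d \<delta>}" by simp
  then show ?thesis unfolding hyp_const_def by (intro cInf_eq_minimum) auto
qed

text \<open>In the coordinate \<open>h\<close> an injective path is an injective continuous real
  function: it is monotone, hence stays between its end values, and by connectedness it attains
  everything between them.\<close>

lemma line_real_tree:
  assumes f: "bij_betw f (UNIV :: real set) X" "\<And>s t. d (f s) (f t) = \<bar>s - t\<bar>" and m: "Metric_space X d"
  shows "real_tree X d"
proof -
  interpret Metric_space X d by (rule m)
  have fX: "f u \<in> X" for u using f(1) bij_betw_apply by fastforce
  define h where "h = inv_into UNIV f"
  have h: "h (f u) = u" for u using f(1) by (simp add: h_def bij_betw_def)
  have fh: "f (h x) = x" if "x \<in> X" for x using that f(1) h by (auto simp: bij_betw_def)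
  have dh: "d x y = \<bar>h x - h y\<bar>" if "x \<in> X" "y \<in> X" for x y using that f(2) fh by metis
  have ch: "continuous_map mtopology euclideanreal h"
    unfolding continuous_map_def
  proof (intro conjI allI impI)
    fix U :: "real set" assume U: "openin euclideanreal U"
    show "openin mtopology {x \<in> topspace mtopology. h x \<in> U}"
      unfolding openin_mtopology topspace_mtopology
    proof (intro conjI allI impI)
      fix x assume x: "x \<in> {x \<in> X. h x \<in> U}"
      then obtain r where r: "r > 0" "ball (h x) r \<subseteq> U" using U by (auto simp: open_contains_ball)
      then have "mball x r \<subseteq> {x \<in> X. h x \<in> U}"
        using dh by (auto simp: in_mball subset_iff dist_real_def)
      then show "\<exists>r>0. mball x r \<subseteq> {x \<in> X. h x \<in> U}" using r by blast
    qed auto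
  qed auto
  show ?thesis unfolding real_tree_def
  proof (intro conjI ballI)
    fix x y assume xy: "x \<in> X" "y \<in> X"
    define s t where "s = h x" and "t = h y"
    have st: "x = f s" "y = f t" using xy fh by (simp_all add: s_def t_def)
    have "p ` {0..1} = f ` {min s t..max s t}"
      if p: "pathin mtopology p" "inj_on p {0..1}" "p 0 = x" "p 1 = y" for p
    proof -
      have pX: "p u \<in> X" if "u \<in> {0..1}" for u
        using p(1) that continuous_map_image_subset_topspace unfolding pathin_def by fastforce
      have c: "continuous_on {0..1} (h \<circ> p)"
        using continuous_map_compose[OF p(1)[unfolded pathin_def] ch] by simp
      have i: "inj_on (h \<circ> p) {0..1}"
        using p(2) pX fh unfolding inj_on_def comp_def by metis
      have e: "(h \<circ> p) 0 = s" "(h \<circ> p) 1 = t" using p by (simp_all add: s_def t_def)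
      have "(h \<circ> p) u \<in> {min s t..max s t}" if "u \<in> {0..1}" for u
      proof (cases "u = 0 \<or> u = 1")
        case True
        then show ?thesis using e by auto
      next
        case False
        then show ?thesis using continuous_inj_imp_mono[OF _ _ c i, of u] that e by auto
      qed
      then have "(h \<circ> p) ` {0..1} \<subseteq> {min s t..max s t}" by blast
      moreover have "is_interval ((h \<circ> p) ` {0..1})"
        using connected_continuous_image[OF c] by (simp add: is_interval_connected_1)
      then have "{min s t..max s t} \<subseteq> (h \<circ> p) ` {0..1}"
      proof -
        have "s \<in> (h \<circ> p) ` {0..1}" "t \<in> (h \<circ> p) ` {0..1}"
          using e by (metis atLeastAtMost_iff image_eqI order_refl zero_le_one)+
        then have "min s t \<in> (h \<circ> p) ` {0..1}" "max s t \<in> (h \<circ> p) ` {0..1}"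
          by (auto simp: min_def max_def)
        then show ?thesis using \<open>is_interval _\<close> unfolding is_interval_1 by (meson atLeastAtMost_iff subsetI)
      qed
      ultimately have "(h \<circ> p) ` {0..1} = {min s t..max s t}" by blast
      then have "f ` {min s t..max s t} = f ` ((h \<circ> p) ` {0..1})" by simp
      also have "\<dots> = (\<lambda>u. f (h (p u))) ` {0..1}" unfolding image_image comp_def ..
      also have "\<dots> = p ` {0..1}" using fh pX by (intro image_cong) auto
      finally show ?thesis ..
    qed
    then show "\<exists>s. geodesic_segment X d x y s \<and>
      (\<forall>p. pathin mtopology p \<and> inj_on p {0..1} \<and> p 0 = x \<and> p 1 = y \<longrightarrow> p ` {0..1} = s)"
      unfolding st using line_segment[OF f, of s t] by (intro exI[of _ "f ` {min s t..max s t}"]) simp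
  next
    show "Metric_space X d" by (rule m)
    show "X \<noteq> {}" using fX by blast
  qed
qed

section \<open>Continuity of the minimal displacement\<close>

definition mlim :: "'a filter \<Rightarrow> ('a \<Rightarrow> m2) \<Rightarrow> m2 \<Rightarrow> bool" where
  "mlim F f L \<longleftrightarrow> ((\<lambda>s. e11 (f s)) \<longlongrightarrow> e11 L) F \<and> ((\<lambda>s. e12 (f s)) \<longlongrightarrow> e12 L) F \<and>
    ((\<lambda>s. e21 (f s)) \<longlongrightarrow> e21 L) F \<and> ((\<lambda>s. e22 (f s)) \<longlongrightarrow> e22 L) F"

lemma mlim_const [simp]: "mlim F (\<lambda>s. c) c"
  by (simp add: mlim_def)

lemma mlim_mult: "mlim F f A \<Longrightarrow> mlim F h B \<Longrightarrow> mlim F (\<lambda>s. f s * h s) (A * B)"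
  by (auto simp: mlim_def intro!: tendsto_intros)

lemma mlim_adj: "mlim F f A \<Longrightarrow> mlim F (\<lambda>s. adj (f s)) (adj A)"
  by (auto simp: mlim_def intro!: tendsto_intros)

lemma mlim_star: "mlim F f A \<Longrightarrow> mlim F (\<lambda>s. star (f s)) (star A)"
  by (auto simp: mlim_def intro!: tendsto_intros)

lemma mlim_dt: "mlim F f A \<Longrightarrow> ((\<lambda>s. dt (f s)) \<longlongrightarrow> dt A) F"
  by (auto simp: mlim_def dt_def intro!: tendsto_intros)

lemma mlim_tr: "mlim F f A \<Longrightarrow> ((\<lambda>s. tr (f s)) \<longlongrightarrow> tr A) F"
  by (auto simp: mlim_def tr_def intro!: tendsto_intros)

lemma mlim_nrm2: "mlim F f A \<Longrightarrow> ((\<lambda>s. nrm2 (f s)) \<longlongrightarrow> nrm2 A) F"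
  by (auto simp: mlim_def nrm2_def intro!: tendsto_intros)

lemma mlim_ev:
  "(\<And>x. x \<in> X \<Longrightarrow> mlim F (\<lambda>s. T s x) (L x)) \<Longrightarrow> w \<in> words_over X \<Longrightarrow> mlim F (\<lambda>s. ev (T s) w) (ev L w)"
proof (induction w)
  case (Cons p w)
  then show ?case by (cases p) (auto intro!: mlim_mult mlim_adj)
qed simp

lemma cosh_hdist_act:
  assumes "dt M \<noteq> 0" "dt N \<noteq> 0" "u \<in> H3" "v \<in> H3"
  shows "cosh (hdist (act M u) (act N v)) =
    Re (tr (M * herm u * star M * adj (N * herm v * star N))) / (2 * cmod (dt M) * cmod (dt N))"
proof -
  have re: "Re (complex_of_real r * z) = r * Re z" for r z by simp
  have "of_real (2 * cosh (hdist (act M u) (act N v))) = tr (herm (act M u) * adj (herm (act N v)))"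
    using assms by (simp only: cosh_hdist_tr act_in not_False_eq_True)
  also have "\<dots> = of_real (1 / cmod (dt M) * (1 / cmod (dt N))) * tr (M * herm u * star M * adj (N * herm v * star N))"
    unfolding herm_act(2)[OF assms(1,3)] herm_act(2)[OF assms(2,4)] sc_simps(13) sc_simps(3,4,5,12) by simp
  finally have "Re (of_real (2 * cosh (hdist (act M u) (act N v)))) =
    Re (of_real (1 / cmod (dt M) * (1 / cmod (dt N))) * tr (M * herm u * star M * adj (N * herm v * star N)))"
    by (rule arg_cong)
  then have "2 * cosh (hdist (act M u) (act N v)) =
    1 / cmod (dt M) * (1 / cmod (dt N)) * Re (tr (M * herm u * star M * adj (N * herm v * star N)))"
    unfolding Re_complex_of_real re .
  then show ?thesis by (simp add: field_simps)
qed

lemma tendsto_hdist_act: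
  assumes M: "mlim F f M" "dt M \<noteq> 0" "\<forall>\<^sub>F s in F. dt (f s) \<noteq> 0"
    and N: "mlim F h N" "dt N \<noteq> 0" "\<forall>\<^sub>F s in F. dt (h s) \<noteq> 0" and uv: "u \<in> H3" "v \<in> H3"
  shows "((\<lambda>s. hdist (act (f s) u) (act (h s) v)) \<longlongrightarrow> hdist (act M u) (act N v)) F"
proof -
  let ?c = "\<lambda>M N. Re (tr (M * herm u * star M * adj (N * herm v * star N))) / (2 * cmod (dt M) * cmod (dt N))"
  have "((\<lambda>s. ?c (f s) (h s)) \<longlongrightarrow> ?c M N) F"
    using M(2) N(2)
    by (intro tendsto_divide tendsto_Re tendsto_mult tendsto_const tendsto_norm mlim_dt mlim_tr mlim_mult mlim_star mlim_adj M(1) N(1) mlim_const) auto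
  moreover have "\<forall>\<^sub>F s in F. ?c (f s) (h s) = cosh (hdist (act (f s) u) (act (h s) v))"
    using M(3) N(3) by eventually_elim (simp only: cosh_hdist_act uv not_False_eq_True)
  ultimately have "((\<lambda>s. cosh (hdist (act (f s) u) (act (h s) v))) \<longlongrightarrow> cosh (hdist (act M u) (act N v))) F"
    unfolding cosh_hdist_act[OF M(2) N(2) uv] by (rule Lim_transform_eventually)
  then have "((\<lambda>s. arcosh (cosh (hdist (act (f s) u) (act (h s) v)))) \<longlongrightarrow> arcosh (cosh (hdist (act M u) (act N v)))) F"
    by (rule tendsto_arcosh_strong) (auto simp: cosh_real_ge_1)
  then show ?thesis by (simp add: arcosh_cosh_real)
qed

text \<open>The right-hand side remains meaningful for singular \<open>h\<close>, which is needed
  when normalized conjugators may degenerate in the limit.\<close>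

lemma hdist_le_iff_nrm2:
  assumes "dt M \<noteq> 0" "dt h \<noteq> 0" "0 \<le> K"
  shows "hdist (act h jpt) (act M (act h jpt)) \<le> K \<longleftrightarrow>
    nrm2 (adj h * M * h) \<le> 2 * cosh K * (cmod (dt M) * (cmod (dt h))\<^sup>2)"
proof -
  have p: "0 < cmod (dt M) * (cmod (dt h))\<^sup>2" using assms by simp
  have "hdist (act h jpt) (act M (act h jpt)) \<le> K \<longleftrightarrow> 2 * cosh (hdist (act h jpt) (act M (act h jpt))) \<le> 2 * cosh K"
    using assms(3) cosh_real_nonneg_le_iff hdist_nonneg by simp
  also have "\<dots> \<longleftrightarrow> nrm2 (adj h * M * h) / (cmod (dt M) * (cmod (dt h))\<^sup>2) \<le> 2 * cosh K"
    by (simp only: hdist_disp[OF assms(1,2)])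
  also have "\<dots> \<longleftrightarrow> nrm2 (adj h * M * h) \<le> 2 * cosh K * (cmod (dt M) * (cmod (dt h))\<^sup>2)"
    using p by (rule pos_divide_le_eq)
  finally show ?thesis .
qed

text \<open>This is \<open>|\<lambda>|\<^sup>2 + |\<mu>|\<^sup>2\<close> for the eigenvalues \<open>\<lambda>, \<mu>\<close> of \<open>M\<close>, in a form whose continuity is evident.\<close>

definition eigval_bound :: "m2 \<Rightarrow> real" where
  "eigval_bound M = ((cmod (tr M))\<^sup>2 + cmod ((tr M)\<^sup>2 - 4 * dt M)) / 2"

lemma cmod_sum_diff: "(cmod (a + b))\<^sup>2 + (cmod (a - b))\<^sup>2 = 2 * (cmod a)\<^sup>2 + 2 * (cmod b)\<^sup>2"
  unfolding cmod_power2 by (simp add: power2_eq_square algebra_simps)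

lemma disc_eq: "(tr M)\<^sup>2 - 4 * dt M = (e11 M - e22 M)\<^sup>2 + 4 * (e12 M * e21 M)"
  by (simp add: tr_def dt_def power2_eq_square algebra_simps)

text \<open>Schur's inequality: the squared moduli of the eigenvalues add up to at most the squared
  Hilbert-Schmidt norm. Diagonal matrices give equality.\<close>

lemma eigval_bound_le: "eigval_bound M \<le> nrm2 M"
proof -
  have "cmod ((tr M)\<^sup>2 - 4 * dt M) \<le> (cmod (e11 M - e22 M))\<^sup>2 + 4 * (cmod (e12 M) * cmod (e21 M))"
    unfolding disc_eq using norm_triangle_ineq[of "(e11 M - e22 M)\<^sup>2" "4 * (e12 M * e21 M)"]
    by (simp add: norm_mult norm_power)
  moreover have "2 * (cmod (e12 M) * cmod (e21 M)) \<le> (cmod (e12 M))\<^sup>2 + (cmod (e21 M))\<^sup>2"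
    using sum_squares_bound[of "cmod (e12 M)" "cmod (e21 M)"] by simp
  moreover have "(cmod (tr M))\<^sup>2 + (cmod (e11 M - e22 M))\<^sup>2 = 2 * (cmod (e11 M))\<^sup>2 + 2 * (cmod (e22 M))\<^sup>2"
    using cmod_sum_diff[of "e11 M" "e22 M"] by (simp add: tr_def)
  moreover have "D \<le> m + 4 * p \<Longrightarrow> 2 * p \<le> q + r \<Longrightarrow> s + m = 2 * a + 2 * d \<Longrightarrow> (s + D) / 2 \<le> a + q + r + d"
    for D m p q r s a d :: real unfolding pos_divide_le_eq[OF zero_less_numeral] by (simp add: algebra_simps)
  ultimately show ?thesis unfolding eigval_bound_def nrm2_def by blast
qed

lemma eigval_bound_diag: "e12 M = 0 \<Longrightarrow> e21 M = 0 \<Longrightarrow> eigval_bound M = nrm2 M"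
  using cmod_sum_diff[of "e11 M" "e22 M"]
  unfolding eigval_bound_def nrm2_def disc_eq by (simp add: tr_def norm_power)

text \<open>\<open>adj h * M * h\<close> is \<open>dt h\<close> times a conjugate of
  \<open>M\<close>, so the eigenvalues are multiplied by \<open>dt h\<close>.\<close>

lemma eigval_bound_conj: "eigval_bound (adj h * M * h) = (cmod (dt h))\<^sup>2 * eigval_bound M"
proof -
  have t: "tr (adj h * M * h) = dt h * tr M"
    unfolding tr_comm[of "adj h * M"] by (simp add: mult.assoc[symmetric])
  have "(dt h * tr M)\<^sup>2 - 4 * dt (adj h * M * h) = (dt h)\<^sup>2 * ((tr M)\<^sup>2 - 4 * dt M)"
    by (simp add: power2_eq_square algebra_simps)
  then show ?thesis unfolding eigval_bound_def t
    by (simp only: norm_mult norm_power power_mult_distrib) (simp add: algebra_simps)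
qed

lemma convergent_normalized:
  assumes "\<And>n. nrm2 (h n) = 1"
  obtains r G where "strict_mono (r :: nat \<Rightarrow> nat)" "mlim sequentially (\<lambda>n. h (r n)) G" "nrm2 G = 1"
proof -
  define s where "s n = (e11 (h n), e12 (h n), e21 (h n), e22 (h n))" for n
  have b: "cmod (e11 (h n)) \<le> 1" "cmod (e12 (h n)) \<le> 1" "cmod (e21 (h n)) \<le> 1" "cmod (e22 (h n)) \<le> 1" for n
  proof -
    have "(cmod (e11 (h n)))\<^sup>2 \<le> 1\<^sup>2" "(cmod (e12 (h n)))\<^sup>2 \<le> 1\<^sup>2" "(cmod (e21 (h n)))\<^sup>2 \<le> 1\<^sup>2" "(cmod (e22 (h n)))\<^sup>2 \<le> 1\<^sup>2"
      using assms[of n] unfolding nrm2_def by (simp_all add: algebra_simps) (smt (verit) zero_le_power2)+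
    then show "cmod (e11 (h n)) \<le> 1" "cmod (e12 (h n)) \<le> 1" "cmod (e21 (h n)) \<le> 1" "cmod (e22 (h n)) \<le> 1"
      by (auto intro: power2_le_imp_le)
  qed
  have "norm (s n) \<le> 4" for n
  proof -
    have "norm (s n) \<le> cmod (e11 (h n)) + (cmod (e12 (h n)) + (cmod (e21 (h n)) + cmod (e22 (h n))))"
      unfolding s_def by (intro order_trans[OF norm_Pair_le] add_left_mono order_refl)
    then show ?thesis using b[of n] by linarith
  qed
  then have "bounded (range s)" by (auto simp: bounded_iff)
  then obtain l r where r: "strict_mono (r :: nat \<Rightarrow> nat)" "(s \<circ> r) \<longlonglongrightarrow> l"
    using bounded_imp_convergent_subsequence by blast
  obtain a b c d where l: "l = (a, b, c, d)" by (cases l)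
  have "(\<lambda>n. fst (s (r n))) \<longlonglongrightarrow> fst l" "(\<lambda>n. fst (snd (s (r n)))) \<longlonglongrightarrow> fst (snd l)"
    "(\<lambda>n. fst (snd (snd (s (r n))))) \<longlonglongrightarrow> fst (snd (snd l))" "(\<lambda>n. snd (snd (snd (s (r n))))) \<longlonglongrightarrow> snd (snd (snd l))"
    using r(2) unfolding comp_def by (intro tendsto_intros; assumption)+
  then have m: "mlim sequentially (\<lambda>n. h (r n)) (M2 a b c d)"
    by (simp add: mlim_def s_def l)
  have "nrm2 (M2 a b c d) = 1"
    using mlim_nrm2[OF m] unfolding assms by (simp add: LIMSEQ_const_iff)
  then show ?thesis using that r(1) m by blast
qed

text \<open>The points that satisfy the bound for \<open>Tn n\<close> may escape to infinity. If the
  limit is diagonalizable, a point on the common axis can be taken instead, where every generator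
  attains its least displacement. If it is irreducible, escaping points would produce a common fixed
  point at infinity.\<close>

lemma displacement_limit:
  assumes g: "1 \<le> g" and T: "valid g T" "good g T" and Tn: "\<And>n. valid g (Tn n)"
    and lim: "\<And>x. x \<in> surface_gens g \<Longrightarrow> mlim sequentially (\<lambda>n. Tn n x) (T x)"
    and K: "\<And>n. \<exists>p\<in>H3. disp g (Tn n) p \<le> K"
  shows "\<exists>p\<in>H3. disp g T p \<le> K"
proof -
  have dT: "dt (T x) \<noteq> 0" "dt (Tn n x) \<noteq> 0" if "x \<in> surface_gens g" for x n
    using T(1) Tn that by (auto simp: valid_def)
  have K0: "0 \<le> K" using K[of 0] max_displacement_nonneg[OF Tn _ g] order_trans by blast
  have "\<exists>h. dt h \<noteq> 0 \<and> nrm2 h = 1 \<and> (\<forall>x\<in>surface_gens g. hdist (act h jpt) (act (Tn n x) (act h jpt)) \<le> K)" for n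
  proof -
    obtain p where p: "p \<in> H3" "disp g (Tn n) p \<le> K" using K by blast
    obtain h where h: "dt h \<noteq> 0" "p = act h jpt" using act_trans[OF p(1)] .
    have "h \<noteq> 0" using h(1) by auto
    then have n0: "nrm2 h > 0" by (auto simp: nrm2_def m2_eq_iff add_pos_nonneg add_nonneg_pos)
    define c where "c = complex_of_real (1 / sqrt (nrm2 h))"
    have c: "c \<noteq> 0" "(cmod c)\<^sup>2 * nrm2 h = 1" using n0 by (simp_all add: c_def norm_divide power_divide)
    have "p = act (sc c h) jpt" using act_scale[OF c(1) h(1) jpt_H3] h(2) by simp
    then show ?thesis using c h max_displacement_le[OF Tn p(1) g] p
      by (intro exI[of _ "sc c h"]) simp
  qed
  then obtain h where h: "\<And>n. dt (h n) \<noteq> 0" "\<And>n. nrm2 (h n) = 1"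
    "\<And>n x. x \<in> surface_gens g \<Longrightarrow> hdist (act (h n) jpt) (act (Tn n x) (act (h n) jpt)) \<le> K"
    by metis
  have N: "nrm2 (adj (h n) * Tn n x * h n) \<le> 2 * cosh K * (cmod (dt (Tn n x)) * (cmod (dt (h n)))\<^sup>2)"
    if "x \<in> surface_gens g" for x n
    using h(3)[OF that] hdist_le_iff_nrm2[OF dT(2)[OF that] h(1) K0] by blast
  have fin: "\<exists>p\<in>H3. disp g T p \<le> K"
    if "dt G \<noteq> 0" "\<forall>x\<in>surface_gens g. nrm2 (adj G * T x * G) \<le> 2 * cosh K * (cmod (dt (T x)) * (cmod (dt G))\<^sup>2)" for G
    using that hdist_le_iff_nrm2[OF dT(1) that(1) K0] max_displacement_le[OF T(1) act_in[OF that(1) jpt_H3] g]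
      act_in[OF that(1) jpt_H3] by blast
  show ?thesis
  proof (cases "irr g T")
    case False
    then obtain G where G: "dt G \<noteq> 0" "\<forall>x\<in>surface_gens g. e21 (adj G * T x * G) = 0 \<and> e12 (adj G * T x * G) = 0"
      using T(2) unfolding good_def diagable_def by blast
    have "nrm2 (adj G * T x * G) \<le> 2 * cosh K * (cmod (dt (T x)) * (cmod (dt G))\<^sup>2)" if x: "x \<in> surface_gens g" for x
    proof -
      \<comment> \<open>Eigenvalues are invariant under conjugation, so this bound does not depend
        on where the points have gone, and it passes to the limit.\<close>
      have le: "eigval_bound (Tn n x) \<le> 2 * cosh K * cmod (dt (Tn n x))" for n
      proof -
        have "(cmod (dt (h n)))\<^sup>2 * eigval_bound (Tn n x) \<le> 2 * cosh K * (cmod (dt (Tn n x)) * (cmod (dt (h n)))\<^sup>2)"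
          unfolding eigval_bound_conj[symmetric] using eigval_bound_le N[OF x] order_trans by blast
        then have "(cmod (dt (h n)))\<^sup>2 * eigval_bound (Tn n x) \<le> (cmod (dt (h n)))\<^sup>2 * (2 * cosh K * cmod (dt (Tn n x)))"
          by (simp add: mult_ac)
        then show ?thesis using h(1)[of n] by (simp add: mult_le_cancel_left)
      qed
      have "(\<lambda>n. eigval_bound (Tn n x)) \<longlonglongrightarrow> eigval_bound (T x)"
        unfolding eigval_bound_def by (intro tendsto_intros mlim_tr mlim_dt lim[OF x]) auto
      moreover have "(\<lambda>n. 2 * cosh K * cmod (dt (Tn n x))) \<longlonglongrightarrow> 2 * cosh K * cmod (dt (T x))"
        by (intro tendsto_intros mlim_dt lim[OF x])
      ultimately have "eigval_bound (T x) \<le> 2 * cosh K * cmod (dt (T x))"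
        by (rule LIMSEQ_le) (use le in blast)
      then have "(cmod (dt G))\<^sup>2 * eigval_bound (T x) \<le> (cmod (dt G))\<^sup>2 * (2 * cosh K * cmod (dt (T x)))"
        by (intro mult_left_mono) auto
      then show ?thesis
        using eigval_bound_diag[of "adj G * T x * G"] G(2) x unfolding eigval_bound_conj by (simp add: mult_ac del: m2_sel)
    qed
    then show ?thesis using fin[OF G(1)] by blast
  next
    case True
    obtain r G where r: "strict_mono (r :: nat \<Rightarrow> nat)" "mlim sequentially (\<lambda>n. h (r n)) G" "nrm2 G = 1"
      using convergent_normalized[of h] h(2) by blast
    have rl: "mlim sequentially (\<lambda>n. Tn (r n) x) (T x)" if "x \<in> surface_gens g" for x
      using lim[OF that] LIMSEQ_subseq_LIMSEQ[OF _ r(1)] unfolding mlim_def comp_def by blast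
    have le: "nrm2 (adj G * T x * G) \<le> 2 * cosh K * (cmod (dt (T x)) * (cmod (dt G))\<^sup>2)" if x: "x \<in> surface_gens g" for x
    proof (rule LIMSEQ_le)
      show "(\<lambda>n. nrm2 (adj (h (r n)) * Tn (r n) x * h (r n))) \<longlonglongrightarrow> nrm2 (adj G * T x * G)"
        by (intro mlim_nrm2 mlim_mult mlim_adj rl x r(2))
      show "(\<lambda>n. 2 * cosh K * (cmod (dt (Tn (r n) x)) * (cmod (dt (h (r n))))\<^sup>2)) \<longlonglongrightarrow> 2 * cosh K * (cmod (dt (T x)) * (cmod (dt G))\<^sup>2)"
        by (intro tendsto_intros mlim_dt rl x r(2))
      show "\<exists>m. \<forall>n\<ge>m. nrm2 (adj (h (r n)) * Tn (r n) x * h (r n)) \<le> 2 * cosh K * (cmod (dt (Tn (r n) x)) * (cmod (dt (h (r n))))\<^sup>2)"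
        using N[OF x] by blast
    qed
    \<comment> \<open>For singular \<open>G\<close> the limit inequality would give
      \<open>adj G * T x * G = 0\<close>, so every \<open>T x\<close> would preserve the line
      spanned by a nonzero column of \<open>G\<close>.\<close>
    have "dt G \<noteq> 0"
    proof
      assume d: "dt G = 0"
      have z: "adj G * T x * G = 0" if x: "x \<in> surface_gens g" for x
      proof -
        have "nrm2 (adj G * T x * G) \<le> 0" using le[OF x] d by simp
        moreover define Z where "Z = adj G * T x * G"
        ultimately have "nrm2 Z \<le> 0" by simp
        then have "(cmod (e11 Z))\<^sup>2 = 0" "(cmod (e12 Z))\<^sup>2 = 0" "(cmod (e21 Z))\<^sup>2 = 0" "(cmod (e22 Z))\<^sup>2 = 0"
          unfolding nrm2_def using zero_le_power2 by (smt (verit))+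
        then show ?thesis unfolding Z_def[symmetric] by (simp add: m2_eq_iff)
      qed
      have key: False if uv: "u \<noteq> 0 \<or> v \<noteq> 0"
        "\<And>x. x \<in> surface_gens g \<Longrightarrow> (e11 (T x) * u + e12 (T x) * v) * v = (e21 (T x) * u + e22 (T x) * v) * u" for u v
      proof -
        \<comment> \<open>The vector with entries \<open>u\<close>, \<open>v\<close>, completed by
          an orthogonal one to an invertible matrix.\<close>
        let ?N = "M2 u (- cnj v) v (cnj u)"
        have "dt ?N = of_real ((cmod u)\<^sup>2 + (cmod v)\<^sup>2)" unfolding of_real_add complex_norm_square by (simp add: dt_def)
        moreover have "(cmod u)\<^sup>2 + (cmod v)\<^sup>2 \<noteq> 0" using uv(1) by (simp add: sum_power2_eq_zero_iff)
        ultimately have "dt ?N \<noteq> 0" by (simp only: of_real_eq_0_iff not_False_eq_True)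
        moreover have "\<forall>x\<in>surface_gens g. tri ?N (T x)" using uv(2) by (simp add: tri_iff)
        ultimately show False using True unfolding irr_def by blast
      qed
      show False
      proof (cases "e11 G \<noteq> 0 \<or> e21 G \<noteq> 0")
        case True
        have "(e11 (T x) * e11 G + e12 (T x) * e21 G) * e21 G = (e21 (T x) * e11 G + e22 (T x) * e21 G) * e11 G"
          if x: "x \<in> surface_gens g" for x
          using z[OF x] tri_iff[of G "T x"] unfolding tri_def by simp
        then show False using key True by blast
      next
        case False
        then have "e12 G \<noteq> 0 \<or> e22 G \<noteq> 0" using r(3) by (auto simp: nrm2_def)
        moreover have "(e11 (T x) * e12 G + e12 (T x) * e22 G) * e22 G = (e21 (T x) * e12 G + e22 (T x) * e22 G) * e12 G"
          if x: "x \<in> surface_gens g" for x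
        proof -
          have "e12 (adj G * T x * G) = 0" using z[OF x] by (simp only: m2_sel)
          then show ?thesis by (simp add: algebra_simps)
        qed
        ultimately show False using key by blast
      qed
    qed
    then show ?thesis using fin le by blast
  qed
qed

text \<open>Upper semicontinuity: a nearly optimal point stays nearly optimal for nearby parameters.
  Lower semicontinuity is \<open>displacement_limit\<close>, and this is where \<open>good\<close>
  enters.\<close>

lemma continuous_min_displacement:
  fixes U :: "'a :: metric_space set"
  assumes g: "1 \<le> g" and T: "\<And>s. s \<in> U \<Longrightarrow> valid g (T s)" "\<And>s. s \<in> U \<Longrightarrow> good g (T s)"
    and lim: "\<And>s x. s \<in> U \<Longrightarrow> x \<in> surface_gens g \<Longrightarrow> mlim (at s within U) (\<lambda>s. T s x) (T s x)"
  shows "continuous_on U (\<lambda>s. min_displacement g (rep g (T s)))"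
  unfolding continuous_on_sequentially
proof (intro allI ballI impI, elim conjE)
  fix S a assume a: "a \<in> U" and S: "\<forall>n. S n \<in> U" "S \<longlonglongrightarrow> a"
  let ?m = "\<lambda>s. min_displacement g (rep g (T s))"
  have l: "mlim sequentially (\<lambda>n. T (S n) x) (T a x)" if x: "x \<in> surface_gens g" for x
  proof -
    have *: "(\<lambda>n. f (S n)) \<longlonglongrightarrow> f a" if "(f \<longlongrightarrow> f a) (at a within U)" for f :: "'a \<Rightarrow> complex"
      using that S a by (auto simp: continuous_within[symmetric] continuous_within_sequentially comp_def)
    show ?thesis using lim[OF a x] unfolding mlim_def by (auto intro: *)
  qed
  have dT: "dt (T s x) \<noteq> 0" if "s \<in> U" "x \<in> surface_gens g" for s x using T(1) that by (auto simp: valid_def)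
  show "(?m \<circ> S) \<longlonglongrightarrow> ?m a"
  proof (rule order_tendstoI)
    fix b assume "?m a < b"
    then obtain p where p: "p \<in> H3" "disp g (T a) p < b"
      using min_displacement_less_iff[OF T(1)[OF a] g] by blast
    then obtain c where c: "disp g (T a) p < c" "c < b" using dense by blast
    obtain c' where c': "disp g (T a) p < c'" "c' < c" using c dense by blast
    have "\<forall>x\<in>surface_gens g. \<forall>\<^sub>F n in sequentially. hdist p (act (T (S n) x) p) < c"
    proof
      fix x assume x: "x \<in> surface_gens g"
      have "(\<lambda>n. hdist (act 1 p) (act (T (S n) x) p)) \<longlonglongrightarrow> hdist (act 1 p) (act (T a x) p)"
        using dT[OF a x] dT[OF _ x] S by (intro tendsto_hdist_act l x mlim_const p) auto
      moreover have "hdist p (act (T a x) p) < c"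
        using max_displacement_le[OF T(1)[OF a] p(1) g, of c'] c' x by force
      ultimately show "\<forall>\<^sub>F n in sequentially. hdist p (act (T (S n) x) p) < c"
        using p by (auto dest: order_tendstoD(2))
    qed
    then have "\<forall>\<^sub>F n in sequentially. \<forall>x\<in>surface_gens g. hdist p (act (T (S n) x) p) < c"
      by (rule eventually_ball_finite[OF surface_gens_finite])
    then show "\<forall>\<^sub>F n in sequentially. (?m \<circ> S) n < b"
    proof eventually_elim
      case (elim n)
      then have "disp g (T (S n)) p \<le> c"
        using max_displacement_le[OF T(1) p(1) g] S by (simp add: less_imp_le)
      then show ?case using min_displacement_le[OF T(1) g p(1), of "S n"] S c(2) by simp
    qed
  next
    fix b assume b: "b < ?m a"
    show "\<forall>\<^sub>F n in sequentially. b < (?m \<circ> S) n"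
    proof (rule ccontr)
      assume "\<not> (\<forall>\<^sub>F n in sequentially. b < (?m \<circ> S) n)"
      then have "\<exists>\<^sub>F n in sequentially. ?m (S n) \<le> b" by (simp add: not_eventually not_less)
      then have "infinite {n. ?m (S n) \<le> b}" by (simp add: frequently_cofinite flip: cofinite_eq_sequentially)
      then obtain r where r: "strict_mono (r :: nat \<Rightarrow> nat)" "\<And>n. r n \<in> {n. ?m (S n) \<le> b}"
        using infinite_enumerate by blast
      obtain c where c: "b < c" "c < ?m a" using b dense by blast
      have "\<exists>p\<in>H3. max_displacement g (H3, hdist, rep g (T (S (r n)))) p \<le> c" for n
        using min_displacement_less_iff[OF T(1) g, of "S (r n)" c] S r(2)[of n] c(1) by (auto intro: less_imp_le)
      moreover have "mlim sequentially (\<lambda>n. T (S (r n)) x) (T a x)" if "x \<in> surface_gens g" for x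
        using l[OF that] LIMSEQ_subseq_LIMSEQ[OF _ r(1)] unfolding mlim_def comp_def by blast
      ultimately obtain p where "p \<in> H3" "disp g (T a) p \<le> c"
        using displacement_limit[OF g T(1)[OF a] T(2)[OF a], of "\<lambda>n. T (S (r n))" c] T(1) S by blast
      then show False using min_displacement_le[OF T(1)[OF a] g] c(2) by force
    qed
  qed
qed

section \<open>Continuous families of representations\<close>

lemma thin_triangles_isometry:
  assumes f: "bij_betw f X X'" "\<And>x y. x \<in> X \<Longrightarrow> y \<in> X \<Longrightarrow> d' (f x) (f y) = d x y" and thin: "thin_triangles X d \<delta>"
  shows "thin_triangles X' d' \<delta>"
proof -
  define h where "h = inv_into X f"
  have h: "h y \<in> X" "f (h y) = y" if "y \<in> X'" for y
    using that f(1) bij_betw_inv_into_right bij_betw_apply[OF bij_betw_inv_into] unfolding h_def by metis+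
  have dh: "d (h x) (h y) = d' x y" if "x \<in> X'" "y \<in> X'" for x y
    using f(2)[OF h(1)[OF that(1)] h(1)[OF that(2)]] h(2) that by simp
  have sub: "s \<subseteq> X'" if "geodesic_segment X' d' x y s" for x y s
    using that unfolding geodesic_segment_def by blast
  have seg: "geodesic_segment X d (h x) (h y) (h ` s)" if xy: "x \<in> X'" "y \<in> X'" and s: "geodesic_segment X' d' x y s" for x y s
  proof -
    obtain c where c: "c \<in> {0..d' x y} \<rightarrow> X'" "c 0 = x" "c (d' x y) = y"
      "\<And>t u. t \<in> {0..d' x y} \<Longrightarrow> u \<in> {0..d' x y} \<Longrightarrow> d' (c t) (c u) = \<bar>t - u\<bar>" "s = c ` {0..d' x y}"
      using s by (auto simp: geodesic_segment_def)
    have "d (h (c t)) (h (c u)) = \<bar>t - u\<bar>" if "t \<in> {0..d' x y}" "u \<in> {0..d' x y}" for t u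
      using dh[OF funcset_mem[OF c(1) that(1)] funcset_mem[OF c(1) that(2)]] c(4)[OF that] by simp
    moreover have "h ` s = (\<lambda>t. h (c t)) ` {0..d' x y}" by (simp add: c(5) image_image)
    ultimately show ?thesis
      unfolding geodesic_segment_def dh[OF xy] using h(1) funcset_mem[OF c(1)] c(2,3)
      by (intro exI[of _ "\<lambda>t. h (c t)"]) auto
  qed
  have nbh: "in_neighbourhood d' \<delta> s A" if nb: "in_neighbourhood d \<delta> (h ` s) (h ` A)" "s \<subseteq> X'" "A \<subseteq> X'" for s A
    unfolding in_neighbourhood_def
  proof
    fix p assume p: "p \<in> s"
    then obtain q where "q \<in> A" "d (h p) (h q) \<le> \<delta>" using nb(1) unfolding in_neighbourhood_def by blast
    then show "\<exists>q\<in>A. d' p q \<le> \<delta>" using dh p nb(2,3) by (metis subsetD)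
  qed
  show ?thesis unfolding thin_triangles_def
  proof (intro ballI allI impI)
    fix x y z s1 s2 s3 assume H: "x \<in> X'" "y \<in> X'" "z \<in> X'"
      and s: "geodesic_segment X' d' x y s1 \<and> geodesic_segment X' d' y z s2 \<and> geodesic_segment X' d' z x s3"
    have sX: "s1 \<subseteq> X'" "s2 \<subseteq> X'" "s3 \<subseteq> X'" using s sub by blast+
    have "in_neighbourhood d \<delta> (h ` s1) (h ` s2 \<union> h ` s3) \<and> in_neighbourhood d \<delta> (h ` s2) (h ` s3 \<union> h ` s1) \<and>
      in_neighbourhood d \<delta> (h ` s3) (h ` s1 \<union> h ` s2)"
      using thin[unfolded thin_triangles_def, rule_format, of "h x" "h y" "h z" "h ` s1" "h ` s2" "h ` s3"] h(1) H s seg by blast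
    then show "in_neighbourhood d' \<delta> s1 (s2 \<union> s3) \<and> in_neighbourhood d' \<delta> s2 (s3 \<union> s1) \<and> in_neighbourhood d' \<delta> s3 (s1 \<union> s2)"
      unfolding image_Un[symmetric] using nbh sX by blast
  qed
qed

lemma hyp_const_isometry:
  assumes f: "bij_betw f X X'" "\<And>x y. x \<in> X \<Longrightarrow> y \<in> X \<Longrightarrow> d' (f x) (f y) = d x y"
  shows "hyp_const X' d' = hyp_const X d"
proof -
  have "d (inv_into X f x) (inv_into X f y) = d' x y" if "x \<in> X'" "y \<in> X'" for x y
    using f(2)[OF bij_betw_apply[OF bij_betw_inv_into[OF f(1)] that(1)] bij_betw_apply[OF bij_betw_inv_into[OF f(1)] that(2)]]
      bij_betw_inv_into_right[OF f(1)] that by simp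
  then have "thin_triangles X' d' \<delta> \<Longrightarrow> thin_triangles X d \<delta>" for \<delta>
    by (rule thin_triangles_isometry[OF bij_betw_inv_into[OF f(1)]])
  moreover have "thin_triangles X d \<delta> \<Longrightarrow> thin_triangles X' d' \<delta>" for \<delta>
    using f by (rule thin_triangles_isometry)
  ultimately have "thin_triangles X' d' \<delta> \<longleftrightarrow> thin_triangles X d \<delta>" for \<delta> by blast
  then show ?thesis by (simp add: hyp_const_def)
qed

lemma approximates_isometry:
  assumes iso: "equivariantly_isometric g (X, d, \<rho>) (X', d', \<rho>')"
    and act: "\<And>\<gamma> x. \<gamma> \<in> carrier (surface_group g) \<Longrightarrow> x \<in> X \<Longrightarrow> \<rho> \<gamma> x \<in> X"
    and P: "P \<subseteq> carrier (surface_group g)" and a: "approximates K \<epsilon> P Y (X', d', \<rho>')"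
  shows "approximates K \<epsilon> P Y (X, d, \<rho>)"
proof -
  obtain Z e \<sigma> where Y: "Y = (Z, e, \<sigma>)" by (cases Y)
  obtain f where f: "bij_betw f X X'" "\<And>x y. x \<in> X \<Longrightarrow> y \<in> X \<Longrightarrow> d' (f x) (f y) = d x y"
    "\<And>\<gamma> x. \<gamma> \<in> carrier (surface_group g) \<Longrightarrow> x \<in> X \<Longrightarrow> f (\<rho> \<gamma> x) = \<rho>' \<gamma> (f x)"
    using iso by (auto simp: equivariantly_isometric_def)
  obtain k where k: "k \<in> K \<rightarrow> X'" "\<And>\<gamma> \<eta> x y. \<gamma> \<in> P \<Longrightarrow> \<eta> \<in> P \<Longrightarrow> x \<in> K \<Longrightarrow> y \<in> K \<Longrightarrow>
      \<bar>e (\<sigma> \<gamma> x) (\<sigma> \<eta> y) - d' (\<rho>' \<gamma> (k x)) (\<rho>' \<eta> (k y))\<bar> < \<epsilon>" "\<bar>hyp_const Z e - hyp_const X' d'\<bar> < \<epsilon>"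
    using a unfolding Y approximates_def by auto
  define h where "h = inv_into X f"
  have h: "h y \<in> X" "f (h y) = y" if "y \<in> X'" for y
    using that f(1) bij_betw_inv_into_right bij_betw_apply[OF bij_betw_inv_into] unfolding h_def by metis+
  have "d (\<rho> \<gamma> (h (k x))) (\<rho> \<eta> (h (k y))) = d' (\<rho>' \<gamma> (k x)) (\<rho>' \<eta> (k y))"
    if "\<gamma> \<in> P" "\<eta> \<in> P" "x \<in> K" "y \<in> K" for \<gamma> \<eta> x y
  proof -
    have kX: "k x \<in> X'" "k y \<in> X'" using k(1) that by auto
    have c: "\<gamma> \<in> carrier (surface_group g)" "\<eta> \<in> carrier (surface_group g)" using P that by auto
    have "d (\<rho> \<gamma> (h (k x))) (\<rho> \<eta> (h (k y))) = d' (f (\<rho> \<gamma> (h (k x)))) (f (\<rho> \<eta> (h (k y))))"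
      using f(2) act c h(1) kX by simp
    then show ?thesis using f(3)[OF c(1) h(1)[OF kX(1)]] f(3)[OF c(2) h(1)[OF kX(2)]] h(2) kX by simp
  qed
  then show ?thesis unfolding Y approximates_def prod.case
    using k(2,3) h(1) funcset_mem[OF k(1)] hyp_const_isometry[of f X X' d' d, OF f(1,2)]
    by (intro conjI bexI[of _ "h \<circ> k"]) auto
qed

lemma isometric_action_in:
  assumes "isometric_action g (X, d, \<rho>)" "\<gamma> \<in> carrier (surface_group g)" "x \<in> X"
  shows "\<rho> \<gamma> x \<in> X"
proof -
  interpret group_action "surface_group g" X \<rho> using assms(1) by (simp add: isometric_action_def)
  show ?thesis using element_image assms(2,3) by blast
qed

lemma equivariantly_isometric_refl: "equivariantly_isometric g Y Y"
  unfolding equivariantly_isometric_def by (cases Y) (auto intro!: exI[of _ id])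

lemma isometry_class_self: "isometric_action g Y \<Longrightarrow> Y \<in> isometry_class g Y"
  by (simp add: isometry_class_def equivariantly_isometric_refl)

text \<open>An equivariant isometry carries approximating points along, so membership may be tested
  on any representative of the class.\<close>

lemma basic_nbhd_iff:
  assumes Z: "isometric_action g Z" "isometry_class g Z \<in> points g" and P: "P \<subseteq> carrier (surface_group g)"
  shows "isometry_class g Z \<in> basic_nbhd g K \<epsilon> P Y \<longleftrightarrow> approximates K \<epsilon> P Y Z"
proof
  show "approximates K \<epsilon> P Y Z \<Longrightarrow> isometry_class g Z \<in> basic_nbhd g K \<epsilon> P Y"
    using isometry_class_self[OF Z(1)] Z(2) by (auto simp: basic_nbhd_def)
  assume "isometry_class g Z \<in> basic_nbhd g K \<epsilon> P Y"
  then obtain Z' where Z': "equivariantly_isometric g Z Z'" "approximates K \<epsilon> P Y Z'"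
    by (auto simp: basic_nbhd_def isometry_class_def)
  obtain X d \<rho> X' d' \<rho>' where e: "Z = (X, d, \<rho>)" "Z' = (X', d', \<rho>')" by (cases Z; cases Z')
  show "approximates K \<epsilon> P Y Z"
    using approximates_isometry Z' Z(1) P isometric_action_in unfolding e by metis
qed

lemma points_in_nbhds: "p \<in> points g \<Longrightarrow> p \<in> \<Union> (basic_nbhds g)"
proof -
  assume p: "p \<in> points g"
  have "isometric_action g Y" if "admissible_tree_action g Y" for Y :: "(real^3) gamma_space"
    using that by (cases Y) (auto simp: admissible_tree_action_def)
  then have "\<exists>Z. p = isometry_class g Z \<and> isometric_action g Z"
    using p isometric_action_rescaled_H3[OF rep_in_rep_space]
    unfolding points_def hyperbolic_points_eq pt_def tree_points_def by blast
  then obtain Z where Z: "p = isometry_class g Z" "isometric_action g Z" by blast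
  then have Zp: "Z \<in> p" using isometry_class_self by blast
  have "approximates {} 1 {} Z Z" by (cases Z) (simp add: approximates_def)
  then have "p \<in> basic_nbhd g {} 1 {} Z" using p Zp by (auto simp: basic_nbhd_def)
  moreover have "basic_nbhd g {} 1 {} Z \<in> basic_nbhds g"
    unfolding basic_nbhds_def using UnionI[OF p Zp]
    by (intro CollectI exI[of _ "{}"] exI[of _ "1 :: real"] exI[of _ Z]) simp
  ultimately show ?thesis by blast
qed

lemma pt_in_points: "valid g T \<Longrightarrow> good g T \<Longrightarrow> pt g T \<in> points g"
  by (auto simp: points_def hyperbolic_points_eq)

lemma pt_nbhd_iff:
  assumes "valid g T" "good g T" "P \<subseteq> carrier (surface_group g)"
  shows "pt g T \<in> basic_nbhd g K \<epsilon> P Y \<longleftrightarrow> approximates K \<epsilon> P Y (rescaled_H3 g (rep g T))"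
  using basic_nbhd_iff[OF isometric_action_rescaled_H3[OF rep_in_rep_space[OF assms(1)]]] pt_in_points[OF assms(1,2)] assms(3)
  by (simp add: pt_def)

text \<open>The approximating points \<open>k x\<close> stay fixed in \<open>H3\<close> while the
  parameter moves. The finitely many distances between their images and the scale \<open>l\<close>
  vary continuously, so the strict inequalities persist.\<close>

lemma continuous_pt:
  fixes U :: "'a :: metric_space set"
  assumes g: "1 \<le> g" and T: "\<And>s. s \<in> U \<Longrightarrow> valid g (T s)" "\<And>s. s \<in> U \<Longrightarrow> good g (T s)"
    and lim: "\<And>s x. s \<in> U \<Longrightarrow> x \<in> surface_gens g \<Longrightarrow> mlim (at s within U) (\<lambda>s. T s x) (T s x)"
  shows "continuous_map (top_of_set U) (points_topology g) (\<lambda>s. pt g (T s))"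
  unfolding points_topology_def continuous_on_generated_topo_iff
proof (intro conjI allI impI)
  show "(\<lambda>s. pt g (T s)) ` topspace (top_of_set U) \<subseteq> \<Union> (basic_nbhds g)"
    using pt_in_points T points_in_nbhds by auto
next
  fix V assume "V \<in> basic_nbhds g"
  then obtain K \<epsilon> P Y where V: "V = basic_nbhd g K \<epsilon> P Y" "0 < \<epsilon>" "finite K" "finite P" "P \<subseteq> carrier (surface_group g)"
    by (auto simp: basic_nbhds_def)
  obtain Z e \<sigma> where Y: "Y = (Z, e, \<sigma>)" by (cases Y)
  define l where "l s = max 1 (min_displacement g (rep g (T s)))" for s
  have l0: "0 < l s" for s by (simp add: l_def)
  have cl: "continuous_on U l"
    unfolding l_def using continuous_min_displacement[OF g T lim] by (intro continuous_intros)
  have "\<forall>\<^sub>F s in at a within U. pt g (T s) \<in> V" if a: "a \<in> U" "pt g (T a) \<in> V" for a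
  proof -
    have tl: "(l \<longlongrightarrow> l a) (at a within U)" using cl a by (simp add: continuous_on_def)
    have U: "\<forall>\<^sub>F s in at a within U. s \<in> U" by (simp add: eventually_at_filter)
    have "approximates K \<epsilon> P Y (rescaled_H3 g (rep g (T a)))"
      using pt_nbhd_iff[OF T[OF a(1)] V(5)] a(2) by (simp add: V(1))
    then obtain k where k: "k \<in> K \<rightarrow> H3"
      "\<And>\<gamma> \<eta> x y. \<gamma> \<in> P \<Longrightarrow> \<eta> \<in> P \<Longrightarrow> x \<in> K \<Longrightarrow> y \<in> K \<Longrightarrow>
        \<bar>e (\<sigma> \<gamma> x) (\<sigma> \<eta> y) - hdist (rep g (T a) \<gamma> (k x)) (rep g (T a) \<eta> (k y)) / l a\<bar> < \<epsilon>"
      "\<bar>hyp_const Z e - hyp_const H3 hdist / l a\<bar> < \<epsilon>"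
      unfolding Y approximates_def rescaled_H3_def l_def[symmetric] prod.case hyp_const_H3_scale[OF l0] by blast
    have 1: "\<forall>\<^sub>F s in at a within U. \<bar>e (\<sigma> \<gamma> x) (\<sigma> \<eta> y) - hdist (rep g (T s) \<gamma> (k x)) (rep g (T s) \<eta> (k y)) / l s\<bar> < \<epsilon>"
      if H: "\<gamma> \<in> P" "\<eta> \<in> P" "x \<in> K" "y \<in> K" for \<gamma> \<eta> x y
    proof -
      obtain u v where uv: "u \<in> words_over (surface_gens g)" "v \<in> words_over (surface_gens g)" "\<gamma> = cls g u" "\<eta> = cls g v"
        using V(5) H(1,2) unfolding surface_carrier by blast
      have kx: "k x \<in> H3" "k y \<in> H3" using k(1) H by auto
      have d: "dt (ev (T s) w) \<noteq> 0" if "s \<in> U" "w \<in> words_over (surface_gens g)" for s w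
        using T(1)[OF that(1)] that(2) dt_ev by (auto simp: valid_def)
      have "((\<lambda>s. hdist (act (ev (T s) u) (k x)) (act (ev (T s) v) (k y))) \<longlongrightarrow>
        hdist (act (ev (T a) u) (k x)) (act (ev (T a) v) (k y))) (at a within U)"
        using U by (intro tendsto_hdist_act mlim_ev[OF lim[OF a(1)]] uv d a kx) (auto elim!: eventually_mono simp: d uv(1,2))
      then have "((\<lambda>s. \<bar>e (\<sigma> \<gamma> x) (\<sigma> \<eta> y) - hdist (act (ev (T s) u) (k x)) (act (ev (T s) v) (k y)) / l s\<bar>) \<longlongrightarrow>
        \<bar>e (\<sigma> \<gamma> x) (\<sigma> \<eta> y) - hdist (act (ev (T a) u) (k x)) (act (ev (T a) v) (k y)) / l a\<bar>) (at a within U)"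
        using l0[of a] by (intro tendsto_intros tl) auto
      moreover have "\<bar>e (\<sigma> \<gamma> x) (\<sigma> \<eta> y) - hdist (act (ev (T a) u) (k x)) (act (ev (T a) v) (k y)) / l a\<bar> < \<epsilon>"
        using k(2)[OF H] by (simp only: uv(3,4) rep_apply[OF T(1)[OF a(1)] uv(1) kx(1)] rep_apply[OF T(1)[OF a(1)] uv(2) kx(2)])
      ultimately have "\<forall>\<^sub>F s in at a within U. \<bar>e (\<sigma> \<gamma> x) (\<sigma> \<eta> y) - hdist (act (ev (T s) u) (k x)) (act (ev (T s) v) (k y)) / l s\<bar> < \<epsilon>"
        by (rule order_tendstoD(2))
      then show ?thesis using U
      proof eventually_elim
        case (elim s)
        then show ?case
          by (simp only: uv(3,4) rep_apply[OF T(1)[OF elim(2)] uv(1) kx(1)] rep_apply[OF T(1)[OF elim(2)] uv(2) kx(2)])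
      qed
    qed
    have "\<forall>\<^sub>F s in at a within U. \<forall>\<gamma>\<in>P. \<forall>\<eta>\<in>P. \<forall>x\<in>K. \<forall>y\<in>K.
      \<bar>e (\<sigma> \<gamma> x) (\<sigma> \<eta> y) - hdist (rep g (T s) \<gamma> (k x)) (rep g (T s) \<eta> (k y)) / l s\<bar> < \<epsilon>"
      using V(3,4) 1 by (intro eventually_ball_finite ballI) auto
    moreover have "((\<lambda>s. \<bar>hyp_const Z e - hyp_const H3 hdist / l s\<bar>) \<longlongrightarrow> \<bar>hyp_const Z e - hyp_const H3 hdist / l a\<bar>) (at a within U)"
      using l0[of a] by (intro tendsto_intros tl) auto
    then have "\<forall>\<^sub>F s in at a within U. \<bar>hyp_const Z e - hyp_const H3 hdist / l s\<bar> < \<epsilon>"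
      using k(3) by (rule order_tendstoD(2))
    ultimately show ?thesis using U
    proof eventually_elim
      case (elim s)
      then have "approximates K \<epsilon> P Y (rescaled_H3 g (rep g (T s)))"
        unfolding Y approximates_def rescaled_H3_def l_def[symmetric] prod.case hyp_const_H3_scale[OF l0] using k(1) by blast
      then show ?case using pt_nbhd_iff[OF T[OF elim(3)] V(5)] by (simp add: V(1))
    qed
  qed
  then show "openin (top_of_set U) ((\<lambda>s. pt g (T s)) -` V \<inter> topspace (top_of_set U))"
    unfolding openin_contains_ball
  proof (intro conjI ballI)
    fix a assume "a \<in> (\<lambda>s. pt g (T s)) -` V \<inter> topspace (top_of_set U)"
    then have a: "a \<in> U" "pt g (T a) \<in> V" by auto
    then have "\<forall>\<^sub>F s in at a within U. pt g (T s) \<in> V"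
      using \<open>\<And>a. a \<in> U \<Longrightarrow> pt g (T a) \<in> V \<Longrightarrow> \<forall>\<^sub>F s in at a within U. pt g (T s) \<in> V\<close> by blast
    then obtain r where "r > 0" "\<forall>s\<in>U. s \<noteq> a \<and> dist s a < r \<longrightarrow> pt g (T s) \<in> V"
      unfolding eventually_at by blast
    then show "\<exists>r>0. ball a r \<inter> U \<subseteq> (\<lambda>s. pt g (T s)) -` V \<inter> topspace (top_of_set U)"
      using a by (intro exI[of _ r]) (auto simp: dist_commute)
  qed auto
qed

lemma connected_pt:
  fixes U :: "'a :: metric_space set"
  assumes "connected U" "1 \<le> g" "\<And>s. s \<in> U \<Longrightarrow> valid g (T s)" "\<And>s. s \<in> U \<Longrightarrow> good g (T s)"
    and "\<And>s x. s \<in> U \<Longrightarrow> x \<in> surface_gens g \<Longrightarrow> mlim (at s within U) (\<lambda>s. T s x) (T s x)"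
  shows "connectedin (points_topology g) ((\<lambda>s. pt g (T s)) ` U)"
  using connectedin_continuous_map_image[OF continuous_pt[of g U T, OF assms(2-5)], of U] assms(1)
  by (simp add: connectedin_subtopology)

section \<open>Connecting hyperbolic points by families\<close>

definition linked :: "nat \<Rightarrow> (real^3) gamma_space set \<Rightarrow> (real^3) gamma_space set \<Rightarrow> bool" where
  "linked g p q \<longleftrightarrow> (\<exists>C. connectedin (points_topology g) C \<and> C \<subseteq> hyperbolic_points g \<and> p \<in> C \<and> q \<in> C)"

lemma linked_sym: "linked g p q \<Longrightarrow> linked g q p"
  by (auto simp: linked_def)

lemma linked_trans: "linked g p q \<Longrightarrow> linked g q r \<Longrightarrow> linked g p r"
proof -
  assume "linked g p q" "linked g q r"
  then obtain C D where C: "connectedin (points_topology g) C" "C \<subseteq> hyperbolic_points g" "p \<in> C" "q \<in> C"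
    and D: "connectedin (points_topology g) D" "D \<subseteq> hyperbolic_points g" "q \<in> D" "r \<in> D"
    unfolding linked_def by blast
  have "connectedin (points_topology g) (C \<union> D)" using C D by (intro connectedin_Un) auto
  then show ?thesis using C D unfolding linked_def by blast
qed

lemma linked_family:
  fixes U :: "'a :: metric_space set"
  assumes "connected U" "1 \<le> g" "\<And>s. s \<in> U \<Longrightarrow> valid g (T s)" "\<And>s. s \<in> U \<Longrightarrow> good g (T s)"
    and "\<And>s x. s \<in> U \<Longrightarrow> x \<in> surface_gens g \<Longrightarrow> mlim (at s within U) (\<lambda>s. T s x) (T s x)"
    and "a \<in> U" "b \<in> U"
  shows "linked g (pt g (T a)) (pt g (T b))"
  unfolding linked_def using connected_pt[of U g T, OF assms(1-5)] assms(3,4,6,7)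
  by (intro exI[of _ "(\<lambda>s. pt g (T s)) ` U"]) (auto simp: hyperbolic_points_eq)

section \<open>Polynomial families of representations\<close>

definition polyf :: "(complex \<Rightarrow> complex) \<Rightarrow> bool" where "polyf f \<longleftrightarrow> (\<exists>p. \<forall>s. f s = poly p s)"

lemma polyf_intros [intro]:
  "polyf (\<lambda>s. c)" "polyf (\<lambda>s. s)" "polyf f \<Longrightarrow> polyf h \<Longrightarrow> polyf (\<lambda>s. f s + h s)"
  "polyf f \<Longrightarrow> polyf h \<Longrightarrow> polyf (\<lambda>s. f s - h s)" "polyf f \<Longrightarrow> polyf h \<Longrightarrow> polyf (\<lambda>s. f s * h s)"
  "polyf f \<Longrightarrow> polyf (\<lambda>s. - f s)"
proof -
  show "polyf (\<lambda>s. c)" unfolding polyf_def by (intro exI[of _ "[:c:]"]) simp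
  show "polyf (\<lambda>s. s)" unfolding polyf_def by (intro exI[of _ "[:0, 1:]"]) simp
  assume f: "polyf f"
  then show "polyf (\<lambda>s. - f s)" unfolding polyf_def by (metis poly_minus)
  assume h: "polyf h"
  show "polyf (\<lambda>s. f s + h s)" "polyf (\<lambda>s. f s - h s)" "polyf (\<lambda>s. f s * h s)"
    using f h unfolding polyf_def by (metis poly_add, metis poly_diff, metis poly_mult)
qed

lemma polyf_finite_zeros:
  assumes "polyf f" "f a \<noteq> 0"
  shows "finite {s. f s = 0}"
proof -
  obtain p where p: "\<forall>s. f s = poly p s" using assms(1) by (auto simp: polyf_def)
  then have "p \<noteq> 0" using assms(2) by auto
  then show ?thesis using poly_roots_finite p by simp
qed

lemma polyf_tendsto: "polyf f \<Longrightarrow> (f \<longlongrightarrow> f a) (at a within U)"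
proof -
  assume "polyf f"
  then obtain p where "f = poly p" by (auto simp: polyf_def)
  then show ?thesis using isCont_def poly_isCont tendsto_within_subset by blast
qed

definition polym :: "(complex \<Rightarrow> m2) \<Rightarrow> bool" where
  "polym F \<longleftrightarrow> polyf (\<lambda>s. e11 (F s)) \<and> polyf (\<lambda>s. e12 (F s)) \<and> polyf (\<lambda>s. e21 (F s)) \<and> polyf (\<lambda>s. e22 (F s))"

lemma polym_intros [intro]:
  "polym (\<lambda>s. C)" "polym F \<Longrightarrow> polym G \<Longrightarrow> polym (\<lambda>s. F s + G s)" "polym F \<Longrightarrow> polym G \<Longrightarrow> polym (\<lambda>s. F s - G s)"
  "polym F \<Longrightarrow> polym G \<Longrightarrow> polym (\<lambda>s. F s * G s)" "polym F \<Longrightarrow> polym (\<lambda>s. adj (F s))"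
  "polyf f \<Longrightarrow> polym (\<lambda>s. cm (f s))" "polyf f \<Longrightarrow> polym F \<Longrightarrow> polym (\<lambda>s. sc (f s) (F s))"
  by (auto simp: polym_def)

lemma polyf_dt [intro]: "polym F \<Longrightarrow> polyf (\<lambda>s. dt (F s))"
  by (auto simp: polym_def dt_def)

lemma polyf_tr [intro]: "polym F \<Longrightarrow> polyf (\<lambda>s. tr (F s))"
  by (auto simp: polym_def tr_def)

lemma polym_mlim: "polym F \<Longrightarrow> mlim (at a within U) F (F a)"
  unfolding polym_def mlim_def by (auto intro: polyf_tendsto)

lemma polym_prod_list: "(\<And>k. k \<in> set xs \<Longrightarrow> polym (\<lambda>s. F s k)) \<Longrightarrow> polym (\<lambda>s. prod_list (map (F s) xs))"
  by (induction xs) auto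

lemma polyf_prod_list: "(\<And>k. k \<in> set xs \<Longrightarrow> polyf (\<lambda>s. f s k)) \<Longrightarrow> polyf (\<lambda>s. prod_list (map (f s) xs))"
  by (induction xs) auto

lemma linked_curve:
  assumes g: "1 \<le> g" and F: "\<And>x. x \<in> surface_gens g \<Longrightarrow> polym (\<lambda>s. F s x)" and fin: "finite B"
    and ok: "\<And>s. s \<notin> B \<Longrightarrow> valid g (F s)" "\<And>s. s \<notin> B \<Longrightarrow> good g (F s)" and ab: "a \<notin> B" "b \<notin> B"
  shows "linked g (pt g (F a)) (pt g (F b))"
proof (rule linked_family[where U = "UNIV - B"])
  show "connected (UNIV - B)" using fin by (intro connected_open_delete_finite) auto
  show "mlim (at s within UNIV - B) (\<lambda>s. F s x) (F s x)" if "x \<in> surface_gens g" for s x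
    by (rule polym_mlim[OF F[OF that]])
qed (use assms in auto)

text \<open>With a common invariant line both matrices are triangular in one basis and their
  commutator is singular. The criterion is polynomial, so on a polynomial curve it holds for all but
  finitely many parameters as soon as it holds for one.\<close>

lemma irr_witness:
  assumes "x \<in> surface_gens g" "y \<in> surface_gens g" "dt (T x * T y - T y * T x) \<noteq> 0"
  shows "irr g T"
  unfolding irr_def
proof clarify
  fix N assume N: "dt N \<noteq> 0" "\<forall>x\<in>surface_gens g. tri N (T x)"
  define X Y where "X = adj N * T x * N" and "Y = adj N * T y * N"
  have z: "e21 X = 0" "e21 Y = 0" using N(2) assms(1,2) by (auto simp only: X_def Y_def tri_def)
  have XY: "X * Y = sc (dt N) (adj N * (T x * T y) * N)" "Y * X = sc (dt N) (adj N * (T y * T x) * N)"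
    by (simp_all add: X_def Y_def mult.assoc del: m2_sel)
  have "X * Y - Y * X = sc (dt N) (adj N * (T x * T y - T y * T x) * N)"
    unfolding XY by (simp add: sc_distrib right_diff_distrib left_diff_distrib del: m2_sel)
  then have "dt (X * Y - Y * X) = (dt N)\<^sup>2 * (dt N * dt (T x * T y - T y * T x) * dt N)"
    by simp
  moreover have "dt (X * Y - Y * X) = 0" using z by (simp add: dt_def algebra_simps)
  ultimately show False using N(1) assms(3) by simp
qed

text \<open>The curves constructed below reach their end points only up to a scalar for each
  generator, which \<open>mob\<close> forgets.\<close>

lemma rescale:
  assumes T: "valid g T" and c: "\<And>x. x \<in> surface_gens g \<Longrightarrow> c x \<noteq> 0 \<and> T' x = sc (c x) (T x)"
  shows "valid g T'" "pt g T' = pt g T" "good g T' \<longleftrightarrow> good g T"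
proof -
  have e: "w \<in> words_over (surface_gens g) \<Longrightarrow> \<exists>k. k \<noteq> 0 \<and> ev T' w = sc k (ev T w)" for w
  proof (induction w)
    case Nil
    then show ?case by (intro exI[of _ 1]) simp
  next
    case (Cons p w)
    obtain x b where p: "p = (x, b)" by force
    then obtain k where k: "k \<noteq> 0" "ev T' w = sc k (ev T w)" using Cons by auto
    have "c x \<noteq> 0" "T' x = sc (c x) (T x)" using c Cons.prems p by auto
    then show ?case using k p by (intro exI[of _ "c x * k"]) (auto simp: mult.commute)
  qed
  have d: "dt (ev T w) \<noteq> 0" if "w \<in> words_over (surface_gens g)" for w
    using T that dt_ev by (auto simp: valid_def)
  obtain r where "ev T (surface_relator g) = cm r" using T by (auto simp: valid_def)
  then have "\<exists>r. ev T' (surface_relator g) = cm r" using e[OF surface_relator_words] by auto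
  then show v: "valid g T'" using T c by (auto simp: valid_def)
  have "rep g T' = rep g T"
  proof
    fix \<gamma> show "rep g T' \<gamma> = rep g T \<gamma>"
    proof (cases "\<gamma> \<in> carrier (surface_group g)")
      case True
      then obtain u where u: "u \<in> words_over (surface_gens g)" "\<gamma> = cls g u" by (auto simp: surface_carrier)
      then obtain k where "k \<noteq> 0" "ev T' u = sc k (ev T u)" using e by blast
      then show ?thesis using u rep_cls[OF T] rep_cls[OF v] mob_scale d by simp
    qed (simp add: rep_def)
  qed
  then show "pt g T' = pt g T" by (simp add: pt_def)
  have t: "tri N (T' x) \<longleftrightarrow> tri N (T x)" if "x \<in> surface_gens g" for x N
    using c[OF that] by (simp add: tri_def del: m2_sel)
  have "e21 (adj G * T' x * G) = c x * e21 (adj G * T x * G)" "e12 (adj G * T' x * G) = c x * e12 (adj G * T x * G)"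
    if "x \<in> surface_gens g" for x G
    using c[OF that] by (simp_all del: m2_sel)
  then show "good g T' \<longleftrightarrow> good g T"
    using t c unfolding good_def irr_def diagable_def by simp
qed

section \<open>The surface relation handle by handle\<close>

definition hand :: "(surface_gen \<Rightarrow> m2) \<Rightarrow> nat \<Rightarrow> m2" where
  "hand T i = T (GenA i) * T (GenB i) * adj (T (GenA i)) * adj (T (GenB i))"

text \<open>With adjugates for inverses, \<open>hand\<close> is the commutator multiplied by this
  product of determinants.\<close>

definition delta :: "(surface_gen \<Rightarrow> m2) \<Rightarrow> nat \<Rightarrow> complex" where
  "delta T i = dt (T (GenA i)) * dt (T (GenB i))"

text \<open>The sign \<open>e\<close> is the second Stiefel-Whitney class: the product of the commutators of
  lifts to \<open>SL\<^sub>2\<close> of the images of the generators is \<open>e\<close>.\<close>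

definition relc :: "nat \<Rightarrow> complex \<Rightarrow> (surface_gen \<Rightarrow> m2) \<Rightarrow> bool" where
  "relc g e T \<longleftrightarrow> (\<forall>x\<in>surface_gens g. dt (T x) \<noteq> 0) \<and>
    prod_list (map (hand T) [1..<Suc g]) = cm (e * prod_list (map (delta T) [1..<Suc g]))"

lemma ev_relator: "ev T (surface_relator g) = prod_list (map (hand T) [1..<Suc g])"
proof -
  have "ev T (concat (map (\<lambda>i. [(GenA i, False), (GenB i, False), (GenA i, True), (GenB i, True)]) xs))
    = prod_list (map (hand T) xs)" for xs
    by (induction xs) (auto simp: hand_def mult.assoc)
  then show ?thesis by (simp only: surface_relator_def)
qed

lemma relc_valid: "relc g e T \<Longrightarrow> valid g T"
  by (auto simp: relc_def valid_def ev_relator)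

lemma dt_hand: "dt (hand T i) = (delta T i)\<^sup>2"
  by (simp add: hand_def delta_def power2_eq_square)

lemma dt_prod_hand: "dt (prod_list (map (hand T) xs)) = (prod_list (map (delta T) xs))\<^sup>2"
  by (induction xs) (simp_all add: dt_hand power_mult_distrib)

text \<open>The square of the scalar value of the relator is its determinant, and so is the square
  of the product of all \<open>delta\<close>; hence the two differ by a sign.\<close>

lemma valid_relc:
  assumes "valid g T"
  obtains e where "e = 1 \<or> e = - 1" "relc g e T"
proof -
  let ?D = "prod_list (map (delta T) [1..<Suc g])"
  obtain c where c: "prod_list (map (hand T) [1..<Suc g]) = cm c" using assms by (auto simp: valid_def ev_relator)
  have "c\<^sup>2 = ?D\<^sup>2" using dt_prod_hand[of T "[1..<Suc g]"] unfolding c by simp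
  then have "c = ?D \<or> c = - ?D" by (simp add: power2_eq_iff)
  then have "relc g 1 T \<or> relc g (- 1) T" using assms c by (auto simp: relc_def valid_def)
  then show ?thesis using that by blast
qed

definition before :: "(surface_gen \<Rightarrow> m2) \<Rightarrow> nat \<Rightarrow> m2" where
  "before T i = prod_list (map (hand T) [1..<i])"
definition after :: "nat \<Rightarrow> (surface_gen \<Rightarrow> m2) \<Rightarrow> nat \<Rightarrow> m2" where
  "after g T i = prod_list (map (hand T) [Suc i..<Suc g])"
definition delta_rest :: "nat \<Rightarrow> (surface_gen \<Rightarrow> m2) \<Rightarrow> nat \<Rightarrow> complex" where
  "delta_rest g T i = prod_list (map (delta T) ([1..<i] @ [Suc i..<Suc g]))"

lemma split_at:
  assumes "i \<in> {1..g}"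
  shows "prod_list (map (hand T) [1..<Suc g]) = before T i * hand T i * after g T i"
    "prod_list (map (delta T) [1..<Suc g]) = delta_rest g T i * delta T i"
proof -
  have "[1..<Suc g] = [1..<i] @ i # [Suc i..<Suc g]"
    using assms upt_add_eq_append[of 1 i "Suc g - i"] upt_conv_Cons[of i "Suc g"] by simp
  then show "prod_list (map (hand T) [1..<Suc g]) = before T i * hand T i * after g T i"
    "prod_list (map (delta T) [1..<Suc g]) = delta_rest g T i * delta T i"
    by (simp_all add: before_def after_def delta_rest_def mult.assoc mult_ac del: upt_Suc)
qed

lemma rest_cong:
  assumes "\<And>x. x \<noteq> GenA i \<Longrightarrow> x \<noteq> GenB i \<Longrightarrow> x \<in> surface_gens g \<Longrightarrow> T x = T' x" "i \<in> {1..g}"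
  shows "before T i = before T' i" "after g T i = after g T' i" "delta_rest g T i = delta_rest g T' i"
proof -
  have hd: "hand T k = hand T' k" "delta T k = delta T' k" if "k \<in> {1..g} - {i}" for k
    using assms that by (auto simp: hand_def delta_def surface_gens_def)
  have "map (hand T) xs = map (hand T') xs" "map (delta T) xs = map (delta T') xs"
    if "set xs \<subseteq> {1..g} - {i}" for xs
    by (rule map_cong[OF refl], rule hd, rule subsetD[OF that], assumption)+
  moreover have "set [1..<i] \<subseteq> {1..g} - {i}" "set [Suc i..<Suc g] \<subseteq> {1..g} - {i}"
    "set ([1..<i] @ [Suc i..<Suc g]) \<subseteq> {1..g} - {i}" using assms(2) by auto
  ultimately show "before T i = before T' i" "after g T i = after g T' i" "delta_rest g T i = delta_rest g T' i"
    unfolding before_def after_def delta_rest_def by metis+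
qed

lemma dt_rest: "dt (before T i) * dt (after g T i) = (delta_rest g T i)\<^sup>2"
  by (simp add: before_def after_def delta_rest_def dt_prod_hand power_mult_distrib del: upt_Suc)

lemma delta_rest_nz: "relc g e T \<Longrightarrow> i \<in> {1..g} \<Longrightarrow> delta_rest g T i \<noteq> 0"
  unfolding delta_rest_def relc_def
  by (auto simp: prod_list_zero_iff delta_def surface_gens_def simp del: upt_Suc)

text \<open>The relation prescribes handle \<open>i\<close> up to a scalar as the inverse of
  \<open>before\<close> times the inverse of \<open>after\<close>; adjugates express this
  polynomially.\<close>

definition rest_inv :: "nat \<Rightarrow> complex \<Rightarrow> (surface_gen \<Rightarrow> m2) \<Rightarrow> nat \<Rightarrow> m2" where
  "rest_inv g e T i = sc e (adj (before T i) * adj (after g T i))"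

text \<open>Multiplication by \<open>B * A\<close> on the right removes the adjugates from the
  commutator. The result is linear in \<open>A\<close> and linear in \<open>B\<close>, so it can be
  solved along a curve.\<close>

lemma handle_equation:
  assumes e: "e * e = 1" and d: "dt P * dt Q = d\<^sup>2" "d \<noteq> 0" and AB: "dt A \<noteq> 0" "dt B \<noteq> 0"
  shows "P * (A * B * adj A * adj B) * Q = cm (e * (d * (dt A * dt B))) \<longleftrightarrow>
    sc d (A * B) = sc e (adj P * adj Q) * B * A"
proof
  let ?H = "A * B * adj A * adj B" and ?k = "dt A * dt B"
  have H: "?H * (B * A) = sc ?k (A * B)" by (simp add: mult.assoc mult.commute)
  have k: "?k \<noteq> 0" using AB by simp
  have PQ: "dt P \<noteq> 0" "dt Q \<noteq> 0" using d by auto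
  {
    assume "P * ?H * Q = cm (e * (d * ?k))"
    then have "adj P * (P * ?H * Q) * adj Q = adj P * cm (e * (d * ?k)) * adj Q" by simp
    then have "sc (d\<^sup>2) ?H = sc (e * (d * ?k)) (adj P * adj Q)"
      by (simp add: mult.assoc d(1)[symmetric] mult.commute[of "dt P"])
    then have "sc (d\<^sup>2) ?H * (B * A) = sc (e * (d * ?k)) (adj P * adj Q) * (B * A)" by simp
    then have "sc (d\<^sup>2) (sc ?k (A * B)) = sc (d * ?k) (sc e (adj P * adj Q) * B * A)"
      by (simp only: sc_simps H[symmetric]) (simp add: mult.assoc mult_ac)
    then have "sc (d * ?k) (sc d (A * B)) = sc (d * ?k) (sc e (adj P * adj Q) * B * A)"
      by (simp add: power2_eq_square mult_ac)
    then show "sc d (A * B) = sc e (adj P * adj Q) * B * A" using d(2) k by (simp only: sc_cancel(1) no_zero_divisors not_False_eq_True)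
  }
  {
    assume a: "sc d (A * B) = sc e (adj P * adj Q) * B * A"
    have "sc d (?H * (B * A)) = sc ?k (sc d (A * B))" unfolding H by (simp add: mult_ac)
    also have "\<dots> = sc (?k * e) (adj P * adj Q) * (B * A)" unfolding a by (simp add: mult.assoc)
    finally have "sc d ?H * (B * A) = sc (?k * e) (adj P * adj Q) * (B * A)" by simp
    then have "sc d ?H = sc (?k * e) (adj P * adj Q)"
      by (rule mult_right_cancel_m2[THEN iffD1, rotated]) (use AB in simp)
    then have "P * (sc d ?H) * Q = P * sc (?k * e) (adj P * adj Q) * Q" by simp
    then have "sc d (P * ?H * Q) = sc d (cm (e * (d * ?k)))"
      by (simp add: mult.assoc d(1) mult_ac power2_eq_square)
    then show "P * ?H * Q = cm (e * (d * ?k))" using d(2) by (simp only: sc_cancel(1) not_False_eq_True)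
  }
qed

lemma relc_handle_iff:
  assumes i: "i \<in> {1..g}" and e: "e * e = 1" and d: "\<forall>x\<in>surface_gens g. dt (T x) \<noteq> 0" "delta_rest g T i \<noteq> 0"
  shows "relc g e T \<longleftrightarrow>
    sc (delta_rest g T i) (T (GenA i) * T (GenB i)) = rest_inv g e T i * T (GenB i) * T (GenA i)"
proof -
  have "GenA i \<in> surface_gens g" "GenB i \<in> surface_gens g" using i by (auto simp: surface_gens_def)
  then have AB: "dt (T (GenA i)) \<noteq> 0" "dt (T (GenB i)) \<noteq> 0" using d by auto
  show ?thesis
    using handle_equation[OF e dt_rest d(2) AB] d(1)
    unfolding relc_def split_at[OF i] rest_inv_def by (simp add: hand_def delta_def)
qed

text \<open>For fixed \<open>K\<close> and \<open>d\<close> the solutions of \<open>d A B = K B A\<close> are described by linear conditions: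
  \<open>B\<close> lies in the hyperplane \<open>tr ((K - d) B) = 0\<close>, and then \<open>A\<close> in the image of a linear map.\<close>

definition solB :: "m2 \<Rightarrow> complex \<Rightarrow> m2 \<Rightarrow> m2 \<Rightarrow> m2" where
  "solB K d N M = sc (tr ((K - cm d) * N)) M - sc (tr ((K - cm d) * M)) N"

definition solA :: "m2 \<Rightarrow> complex \<Rightarrow> m2 \<Rightarrow> m2 \<Rightarrow> m2" where
  "solA K d B X = K * B * X - sc d (X * adj B)"

lemma tr_solB: "tr ((K - cm d) * solB K d N M) = 0"
  by (simp add: solB_def right_diff_distrib mult.commute)

text \<open>The hypotheses give \<open>K * B\<close> and \<open>sc d B\<close> the same trace and
  determinant. By Cayley-Hamilton \<open>solA\<close> then turns every \<open>X\<close> into a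
  matrix that intertwines the two.\<close>

lemma solA_equation:
  assumes "dt K = d\<^sup>2" "tr ((K - cm d) * B) = 0"
  shows "sc d (solA K d B X * B) = K * B * solA K d B X"
proof -
  have "tr (K * B) = d * tr B" using assms(2) by (simp add: left_diff_distrib)
  then have KB: "K * B * (K * B) = sc (d * tr B) (K * B) - cm (d\<^sup>2 * dt B)"
    using cayley[of "K * B"] assms(1) by simp
  have "K * B * solA K d B X = K * B * (K * B) * X - sc d (K * B * (X * adj B))"
    by (simp add: solA_def right_diff_distrib mult.assoc)
  also have "\<dots> = sc (d * tr B) (K * B * X) - sc (d\<^sup>2 * dt B) X - sc d (K * B * (X * (cm (tr B) - B)))"
    unfolding KB by (simp add: left_diff_distrib mult.assoc adj_eq)
  also have "\<dots> = sc d (K * B * X * B) - sc (d\<^sup>2 * dt B) X"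
    by (simp add: right_diff_distrib sc_distrib mult.assoc mult.commute del: sc_simps(15))
  also have "\<dots> = sc d (solA K d B X * B)"
    by (simp add: solA_def left_diff_distrib sc_distrib mult.assoc power2_eq_square)
  finally show ?thesis ..
qed

text \<open>The equation makes \<open>K * B\<close> conjugate to \<open>sc d B\<close>, so
  \<open>B\<close> already lies in the hyperplane and the projection along \<open>N\<close> merely
  multiplies it.\<close>

lemma solB_at:
  assumes "sc d (A * B) = K * B * A" "dt A \<noteq> 0"
  shows "solB K d N B = sc (tr ((K - cm d) * N)) B"
proof -
  have "sc d (A * B * adj A) = K * B * A * adj A" using arg_cong[OF assms(1), of "\<lambda>Z. Z * adj A"] by simp
  then have "d * tr (A * B * adj A) = dt A * tr (K * B)"
    using arg_cong[of _ _ tr] by (metis adj_mult(1) mult.assoc sc_simps(2,12))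
  moreover have "tr (A * B * adj A) = dt A * tr B"
    unfolding tr_comm[of "A * B"] by (simp add: mult.assoc[symmetric])
  ultimately have "dt A * (d * tr B) = dt A * tr (K * B)" by simp
  then have "tr (K * B) = d * tr B" using assms(2) by simp
  then have "tr ((K - cm d) * B) = 0" by (simp add: left_diff_distrib)
  then show ?thesis by (simp add: solB_def)
qed

text \<open>With \<open>Y = adj B - B\<close>, which is \<open>cm (tr B) - sc 2 B\<close>, the
  expression \<open>B * Y - Y * adj B\<close> equals \<open>- Y * Y\<close>, the scalar given by the
  negated discriminant of \<open>B\<close>. This input thus returns a multiple of \<open>A\<close>,
  nonzero for nonzero \<open>n\<close> and \<open>d\<close> if \<open>B\<close> has distinct
  eigenvalues.\<close>

lemma solA_at:
  assumes "sc d (A * B) = K * B * A"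
  shows "solA K d (sc n B) (A * (cm (tr B) - sc 2 B)) = sc (n * (d * (4 * dt B - (tr B)\<^sup>2))) A"
proof -
  let ?Y = "cm (tr B) - sc 2 B"
  have Y: "B * ?Y - ?Y * adj B = cm (4 * dt B - (tr B)\<^sup>2)"
  proof -
    have "B * ?Y - ?Y * adj B = sc (tr B) B - sc 2 (B * B) - (sc (tr B) (cm (tr B) - B) - sc 2 (cm (dt B)))"
      by (simp add: right_diff_distrib left_diff_distrib adj_eq[symmetric])
    also have "\<dots> = cm (4 * dt B - (tr B)\<^sup>2)"
      unfolding cayley[of B] by (simp add: m2_eq_iff power2_eq_square algebra_simps)
    finally show ?thesis .
  qed
  have "solA K d (sc n B) (A * ?Y) = sc n (K * B * A * ?Y - sc d (A * (?Y * adj B)))"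
    by (simp add: solA_def sc_distrib mult.assoc mult.commute)
  also have "\<dots> = sc n (sc d (A * (B * ?Y - ?Y * adj B)))"
    unfolding assms[symmetric] by (simp add: right_diff_distrib sc_distrib mult_ac)
  also have "\<dots> = sc (n * (d * (4 * dt B - (tr B)\<^sup>2))) A" unfolding Y by (simp add: mult_ac)
  finally show ?thesis .
qed

text \<open>The trace form is nondegenerate, and two proper hyperplanes do not cover the space of
  matrices.\<close>

lemma trace_pairing:
  assumes "X \<noteq> 0" "Y \<noteq> 0"
  obtains N where "tr (X * N) \<noteq> 0" "tr (Y * N) \<noteq> 0"
proof -
  have ex: "\<exists>N. tr (Z * N) \<noteq> 0" if "Z \<noteq> 0" for Z
  proof (rule ccontr)
    assume "\<nexists>N. tr (Z * N) \<noteq> 0"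
    then have "tr (Z * M2 1 0 0 0) = 0" "tr (Z * M2 0 1 0 0) = 0" "tr (Z * M2 0 0 1 0) = 0" "tr (Z * M2 0 0 0 1) = 0" by auto
    then have "Z = 0" by (simp add: tr_def m2_eq_iff)
    then show False using that by simp
  qed
  obtain N M where NM: "tr (X * N) \<noteq> 0" "tr (Y * M) \<noteq> 0" using ex assms by blast
  show ?thesis
  proof (cases "tr (Y * N) = 0")
    case False
    then show ?thesis using that NM by blast
  next
    case 1: True
    show ?thesis
    proof (cases "tr (X * M) = 0")
      case False
      then show ?thesis using that NM by blast
    next
      case True
      then show ?thesis using that[of "N + M"] NM 1 by (simp add: distrib_left)
    qed
  qed
qed

section \<open>Connecting representations\<close>

lemma polym_linear: "polym (\<lambda>s. sc (1 - s) A + sc s C)"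
  by (intro polym_intros polyf_intros)

lemma linear_ends [simp]: "sc (1 - 0) A + sc 0 C = A" "sc (1 - 1) A + sc 1 C = C"
  by (simp_all add: m2_eq_iff)

lemma solB_polym: "polym K \<Longrightarrow> polyf d \<Longrightarrow> polym M \<Longrightarrow> polym (\<lambda>s. solB (K s) (d s) N (M s))"
  unfolding solB_def by (intro polym_intros polyf_tr polym_intros; assumption)

lemma solA_polym: "polym K \<Longrightarrow> polyf d \<Longrightarrow> polym B \<Longrightarrow> polym X \<Longrightarrow> polym (\<lambda>s. solA (K s) (d s) (B s) (X s))"
  unfolding solA_def by (intro polym_intros; assumption)

text \<open>Noncommutativity of handle \<open>i\<close> at both ends yields one direction
  \<open>N\<close> that serves for the projection at both; the discriminants allow \<open>A\<close>
  to be recovered there; the commutator of handle \<open>j\<close> at \<open>T1\<close> makes almost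
  all parameters irreducible.\<close>

lemma handle_link:
  assumes g: "1 \<le> g" and i: "i \<in> {1..g}" and j: "j \<in> {1..g}" "j \<noteq> i" and e: "e * e = 1"
    and R: "relc g e T0" "relc g e T1" and good: "good g T0" "good g T1"
    and nc: "T0 (GenA i) * T0 (GenB i) \<noteq> T0 (GenB i) * T0 (GenA i)" "T1 (GenA i) * T1 (GenB i) \<noteq> T1 (GenB i) * T1 (GenA i)"
    and disc: "4 * dt (T0 (GenB i)) - (tr (T0 (GenB i)))\<^sup>2 \<noteq> 0" "4 * dt (T1 (GenB i)) - (tr (T1 (GenB i)))\<^sup>2 \<noteq> 0"
    and w: "dt (T1 (GenA j) * T1 (GenB j) - T1 (GenB j) * T1 (GenA j)) \<noteq> 0"
  shows "linked g (pt g T0) (pt g T1)"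
proof -
  let ?a = "GenA i" and ?b = "GenB i"
  define b where "b s x = sc (1 - s) (T0 x) + sc s (T1 x)" for s x
  have bp: "polym (\<lambda>s. b s x)" for x unfolding b_def by (rule polym_linear)
  have b01: "b 0 = T0" "b 1 = T1" by (simp_all add: b_def fun_eq_iff)
  define K where "K s = rest_inv g e (b s) i" for s
  define d where "d s = delta_rest g (b s) i" for s
  have hp: "polym (\<lambda>s. hand (b s) k)" "polyf (\<lambda>s. delta (b s) k)" for k
    unfolding hand_def delta_def by (intro polym_intros polyf_intros polyf_dt bp)+
  have Kp: "polym K"
    unfolding K_def rest_inv_def before_def after_def by (intro polym_intros polyf_intros polym_prod_list hp)
  have dp: "polyf d"
    unfolding d_def delta_rest_def by (intro polyf_prod_list hp)
  have Kd: "dt (K s) = (d s)\<^sup>2" for s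
  proof -
    have "dt (K s) = (e * e) * (dt (before (b s) i) * dt (after g (b s) i))"
      by (simp add: K_def rest_inv_def power2_eq_square)
    then show ?thesis using e by (simp only: dt_rest d_def mult_1)
  qed
  have dets: "dt (T0 x) \<noteq> 0" "dt (T1 x) \<noteq> 0" if "x \<in> surface_gens g" for x using R that by (auto simp: relc_def)
  have ab: "?a \<in> surface_gens g" "?b \<in> surface_gens g" using i by (auto simp: surface_gens_def)
  have d01: "d 0 \<noteq> 0" "d 1 \<noteq> 0" using delta_rest_nz R i by (auto simp: d_def b01)
  have eq0: "sc (d 0) (T0 ?a * T0 ?b) = K 0 * T0 ?b * T0 ?a"
    using relc_handle_iff[OF i e, of T0] R(1) d01(1) dets unfolding d_def K_def b01 by blast
  have eq1: "sc (d 1) (T1 ?a * T1 ?b) = K 1 * T1 ?b * T1 ?a"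
    using relc_handle_iff[OF i e, of T1] R(2) d01(2) dets unfolding d_def K_def b01 by blast
  \<comment> \<open>Otherwise the handle equation would say that the pair commutes.\<close>
  have "K 0 - cm (d 0) \<noteq> 0"
  proof
    assume "K 0 - cm (d 0) = 0"
    then have "sc (d 0) (T0 ?a * T0 ?b) = sc (d 0) (T0 ?b * T0 ?a)" using eq0 by (simp add: mult.assoc)
    then show False using nc(1) d01(1) by (simp only: sc_cancel(1) not_False_eq_True)
  qed
  moreover have "K 1 - cm (d 1) \<noteq> 0"
  proof
    assume "K 1 - cm (d 1) = 0"
    then have "sc (d 1) (T1 ?a * T1 ?b) = sc (d 1) (T1 ?b * T1 ?a)" using eq1 by (simp add: mult.assoc)
    then show False using nc(2) d01(2) by (simp only: sc_cancel(1) not_False_eq_True)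
  qed
  ultimately obtain N where N: "tr ((K 0 - cm (d 0)) * N) \<noteq> 0" "tr ((K 1 - cm (d 1)) * N) \<noteq> 0"
    using trace_pairing by blast
  define Y where "Y M = cm (tr M) - sc 2 M" for M
  define B where "B s = solB (K s) (d s) N (b s ?b)" for s
  \<comment> \<open>A segment between the two inputs for which \<open>solA_at\<close> returns
    multiples of \<open>T0 ?a\<close> and \<open>T1 ?a\<close>.\<close>
  define X where "X s = sc (1 - s) (T0 ?a * Y (T0 ?b)) + sc s (T1 ?a * Y (T1 ?b))" for s
  define A where "A s = solA (K s) (d s) (B s) (X s)" for s
  have Bp: "polym B" unfolding B_def by (rule solB_polym[OF Kp dp bp])
  have Xp: "polym X" unfolding X_def by (rule polym_linear)
  have Ap: "polym A" unfolding A_def by (rule solA_polym[OF Kp dp Bp Xp])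
  have AB: "sc (d s) (A s * B s) = K s * B s * A s" for s
    unfolding A_def by (rule solA_equation[OF Kd]) (simp add: B_def tr_solB)
  define n0 n1 where "n0 = tr ((K 0 - cm (d 0)) * N)" and "n1 = tr ((K 1 - cm (d 1)) * N)"
  have B0: "B 0 = sc n0 (T0 ?b)"
    unfolding B_def b01 n0_def by (rule solB_at[OF eq0 dets(1)[OF ab(1)]])
  have B1: "B 1 = sc n1 (T1 ?b)"
    unfolding B_def b01 n1_def by (rule solB_at[OF eq1 dets(2)[OF ab(1)]])
  define m0 m1 where "m0 = n0 * (d 0 * (4 * dt (T0 ?b) - (tr (T0 ?b))\<^sup>2))" and "m1 = n1 * (d 1 * (4 * dt (T1 ?b) - (tr (T1 ?b))\<^sup>2))"
  have X01: "X 0 = T0 ?a * Y (T0 ?b)" "X 1 = T1 ?a * Y (T1 ?b)" by (simp_all add: X_def)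
  have A0: "A 0 = sc m0 (T0 ?a)"
    unfolding A_def B0 X01 Y_def m0_def by (rule solA_at[OF eq0])
  have A1: "A 1 = sc m1 (T1 ?a)"
    unfolding A_def B1 X01 Y_def m1_def by (rule solA_at[OF eq1])
  have nz: "n0 \<noteq> 0" "n1 \<noteq> 0" "m0 \<noteq> 0" "m1 \<noteq> 0" using N disc d01 by (simp_all add: n0_def n1_def m0_def m1_def)
  define F where "F s = (b s)(?a := A s, ?b := B s)" for s
  have Fp: "polym (\<lambda>s. F s x)" for x unfolding F_def fun_upd_def using Ap Bp bp by (cases "x = ?b"; cases "x = ?a") simp_all
  have F0: "\<exists>c. c \<noteq> 0 \<and> F 0 x = sc c (T0 x)" for x
    using nz A0 B0 by (auto simp: F_def b01 intro: exI[of _ 1])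
  have F1: "\<exists>c. c \<noteq> 0 \<and> F 1 x = sc c (T1 x)" for x
    using nz A1 B1 by (auto simp: F_def b01 intro: exI[of _ 1])
  obtain c0 where c0: "\<And>x. c0 x \<noteq> 0 \<and> F 0 x = sc (c0 x) (T0 x)" using F0 by metis
  obtain c1 where c1: "\<And>x. c1 x \<noteq> 0 \<and> F 1 x = sc (c1 x) (T1 x)" using F1 by metis
  have rc: "before (F s) i = before (b s) i" "after g (F s) i = after g (b s) i" "delta_rest g (F s) i = delta_rest g (b s) i" for s
    using rest_cong[of i g "F s" "b s"] i by (auto simp: F_def)
  define W where "W s = dt (F s (GenA j) * F s (GenB j) - F s (GenB j) * F s (GenA j))" for s
  \<comment> \<open>The parameter 0 is exempt from the irreducibility test: \<open>T0\<close> is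
    only assumed \<open>good\<close>, and its handle \<open>j\<close> may commute.\<close>
  define Bad where "Bad = (\<Union>x\<in>surface_gens g. {s. dt (F s x) = 0}) \<union> {s. d s = 0} \<union> ({s. W s = 0} - {0})"
  have dF: "dt (F 0 x) \<noteq> 0" "dt (F 1 x) \<noteq> 0" if "x \<in> surface_gens g" for x
    using c0[of x] c1[of x] dets[OF that] by simp_all
  have W1: "W 1 \<noteq> 0" using w j by (simp add: W_def F_def b01)
  have "finite {s. dt (F s x) = 0}" if "x \<in> surface_gens g" for x
    using polyf_finite_zeros[OF polyf_dt[OF Fp], of 0 x] dF(1)[OF that] by simp
  moreover have "finite {s. d s = 0}" using polyf_finite_zeros[OF dp d01(1)] .
  moreover have "polyf W" unfolding W_def by (intro polyf_dt polym_intros Fp)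
  then have "finite {s. W s = 0}" using polyf_finite_zeros W1 by blast
  ultimately have fin: "finite Bad" unfolding Bad_def using surface_gens_finite by simp
  have gj: "GenA j \<in> surface_gens g" "GenB j \<in> surface_gens g" using j by (auto simp: surface_gens_def)
  have v: "valid g (F s)" if s: "s \<notin> Bad" for s
  proof -
    have d: "\<forall>x\<in>surface_gens g. dt (F s x) \<noteq> 0" "delta_rest g (F s) i \<noteq> 0"
      using s by (auto simp: Bad_def rc d_def)
    have ri: "rest_inv g e (F s) i = K s" by (simp add: rest_inv_def K_def rc)
    have Fv: "F s ?a = A s" "F s ?b = B s" by (simp_all add: F_def)
    have "relc g e (F s)"
      using relc_handle_iff[OF i e d] AB[of s] unfolding ri Fv rc d_def by blast
    then show ?thesis by (rule relc_valid)
  qed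
  have gd: "good g (F s)" if s: "s \<notin> Bad" for s
  proof (cases "s = 0")
    case True
    then show ?thesis using rescale(3)[OF relc_valid[OF R(1)]] c0 good by blast
  next
    case False
    then have "W s \<noteq> 0" using s by (auto simp: Bad_def)
    then show ?thesis unfolding good_def using irr_witness[OF gj] by (simp add: W_def)
  qed
  have "0 \<notin> Bad" "1 \<notin> Bad" using dF d01 W1 by (auto simp: Bad_def)
  then have "linked g (pt g (F 0)) (pt g (F 1))"
    using linked_curve[OF g Fp fin v gd] by blast
  then show ?thesis
    using rescale(2)[OF relc_valid[OF R(1)], of c0 "F 0"] rescale(2)[OF relc_valid[OF R(2)], of c1 "F 1"] c0 c1 by simp
qed

text \<open>The centralizer of a nonscalar matrix is spanned by it and the identity, so commuting
  pairs lie in a pencil. Elements of a pencil commute whatever the coefficients and \<open>M\<close>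
  are, so such pairs can be deformed freely.\<close>

lemma commuting_pair:
  assumes "A * B = B * A"
  obtains M a b c d where "A = cm a + sc b M" "B = cm c + sc d M"
proof (cases "e12 A = 0 \<and> e21 A = 0 \<and> e11 A = e22 A")
  case True
  then have "A = cm (e11 A) + sc 0 B" "B = cm 0 + sc 1 B" by (simp_all add: m2_eq_iff)
  then show ?thesis using that by blast
next
  case False
  have c: "e12 A * e21 B = e12 B * e21 A" "e11 A * e12 B + e12 A * e22 B = e11 B * e12 A + e12 B * e22 A"
    "e21 A * e11 B + e22 A * e21 B = e21 B * e11 A + e22 B * e21 A"
  proof -
    have "e11 (A * B) = e11 (B * A)" "e12 (A * B) = e12 (B * A)" "e21 (A * B) = e21 (B * A)" by (simp_all only: assms)
    then show "e12 A * e21 B = e12 B * e21 A" "e11 A * e12 B + e12 A * e22 B = e11 B * e12 A + e12 B * e22 A"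
      "e21 A * e11 B + e22 A * e21 B = e21 B * e11 A + e22 B * e21 A" by (simp_all add: mult.commute)
  qed
  have "\<exists>q. e12 B = q * e12 A \<and> e21 B = q * e21 A \<and> e11 B - e22 B = q * (e11 A - e22 A)"
  proof -
    consider "e12 A \<noteq> 0" | "e21 A \<noteq> 0" | "e11 A \<noteq> e22 A" using False by blast
    then show ?thesis
    proof cases
      case 1
      then show ?thesis using c by (intro exI[of _ "e12 B / e12 A"]) (auto simp: field_simps)
    next
      case 2
      then show ?thesis using c by (intro exI[of _ "e21 B / e21 A"]) (auto simp: field_simps)
    next
      case 3
      then have "e11 A - e22 A \<noteq> 0" by simp
      then show ?thesis using c by (intro exI[of _ "(e11 B - e22 B) / (e11 A - e22 A)"]) (auto simp: field_simps)
    qed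
  qed
  then obtain q where "e12 B = q * e12 A" "e21 B = q * e21 A" "e11 B - e22 B = q * (e11 A - e22 A)" by blast
  then have "A = cm 0 + sc 1 A" "B = cm (e11 B - q * e11 A) + sc q A" by (auto simp: m2_eq_iff algebra_simps)
  then show ?thesis using that by blast
qed

lemma pencil_commute: "(cm a + sc b M) * (cm c + sc d M) = (cm c + sc d M) * (cm a + sc b M)"
  by (simp add: m2_eq_iff algebra_simps)

lemma hand_commuting: "T (GenA k) * T (GenB k) = T (GenB k) * T (GenA k) \<Longrightarrow> hand T k = cm (delta T k)"
  by (simp add: hand_def delta_def mult.assoc mult.commute)

lemma prod_list_cm: "(\<And>k. k \<in> set xs \<Longrightarrow> f k = cm (h k)) \<Longrightarrow> prod_list (map f xs) = cm (prod_list (map h xs))"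
  by (induction xs) auto

lemma relc_commuting:
  assumes "\<And>k. k \<in> {1..g} \<Longrightarrow> T (GenA k) * T (GenB k) = T (GenB k) * T (GenA k)" "\<forall>x\<in>surface_gens g. dt (T x) \<noteq> 0"
  shows "relc g 1 T"
proof -
  have "hand T k = cm (delta T k)" if "k \<in> set [1..<Suc g]" for k
    using that hand_commuting assms(1) by (auto simp del: upt_Suc)
  then show ?thesis unfolding relc_def using assms(2) prod_list_cm[of "[1..<Suc g]" "hand T" "delta T"] by simp
qed

text \<open>For each handle the four coefficients and the matrix of the pencil are interpolated
  linearly. Every handle keeps commuting, so the relation persists with sign 1 without any equation
  to solve.\<close>

lemma commuting_link:
  assumes g: "1 \<le> g" and c0: "\<And>k. k \<in> {1..g} \<Longrightarrow> T0 (GenA k) * T0 (GenB k) = T0 (GenB k) * T0 (GenA k)"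
    and c1: "\<And>k. k \<in> {1..g} \<Longrightarrow> T1 (GenA k) * T1 (GenB k) = T1 (GenB k) * T1 (GenA k)"
    and d: "\<And>x. x \<in> surface_gens g \<Longrightarrow> dt (T0 x) \<noteq> 0 \<and> dt (T1 x) \<noteq> 0" and good: "good g T0"
    and xy: "x \<in> surface_gens g" "y \<in> surface_gens g" "dt (T1 x * T1 y - T1 y * T1 x) \<noteq> 0"
  shows "linked g (pt g T0) (pt g T1)"
proof -
  have ex: "\<forall>k. \<exists>r. k \<in> {1..g} \<longrightarrow> T (GenA k) = cm (fst r) + sc (fst (snd r)) (snd (snd (snd (snd r)))) \<and>
      T (GenB k) = cm (fst (snd (snd r))) + sc (fst (snd (snd (snd r)))) (snd (snd (snd (snd r))))"
    if comm: "\<And>k. k \<in> {1..g} \<Longrightarrow> T (GenA k) * T (GenB k) = T (GenB k) * T (GenA k)" for T :: "surface_gen \<Rightarrow> m2"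
  proof
    fix k
    show "\<exists>r. k \<in> {1..g} \<longrightarrow> T (GenA k) = cm (fst r) + sc (fst (snd r)) (snd (snd (snd (snd r)))) \<and>
      T (GenB k) = cm (fst (snd (snd r))) + sc (fst (snd (snd (snd r)))) (snd (snd (snd (snd r))))"
    proof (cases "k \<in> {1..g}")
      case True
      obtain M a b c d where "T (GenA k) = cm a + sc b M" "T (GenB k) = cm c + sc d M"
        using commuting_pair[OF comm[OF True]] .
      then show ?thesis by (intro exI[of _ "(a, b, c, d, M)"]) simp
    next
      case False
      then show ?thesis by blast
    qed
  qed
  obtain r where r: "\<And>k. k \<in> {1..g} \<Longrightarrow> T0 (GenA k) = cm (fst (r k)) + sc (fst (snd (r k))) (snd (snd (snd (snd (r k))))) \<and>
      T0 (GenB k) = cm (fst (snd (snd (r k)))) + sc (fst (snd (snd (snd (r k))))) (snd (snd (snd (snd (r k)))))"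
    using ex[OF c0] by metis
  obtain q where q: "\<And>k. k \<in> {1..g} \<Longrightarrow> T1 (GenA k) = cm (fst (q k)) + sc (fst (snd (q k))) (snd (snd (snd (snd (q k))))) \<and>
      T1 (GenB k) = cm (fst (snd (snd (q k)))) + sc (fst (snd (snd (snd (q k))))) (snd (snd (snd (snd (q k)))))"
    using ex[OF c1] by metis
  define l where "l s a b = (1 - s) * a + s * b" for s a b :: complex
  have lp: "polyf (\<lambda>s. l s a b)" for a b unfolding l_def by (intro polyf_intros)
  define M where "M s k = sc (1 - s) (snd (snd (snd (snd (r k))))) + sc s (snd (snd (snd (snd (q k)))))" for s k
  have Mp: "polym (\<lambda>s. M s k)" for k unfolding M_def by (rule polym_linear)
  define F where "F s x = (case x of
      GenA k \<Rightarrow> cm (l s (fst (r k)) (fst (q k))) + sc (l s (fst (snd (r k))) (fst (snd (q k)))) (M s k)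
    | GenB k \<Rightarrow> cm (l s (fst (snd (snd (r k)))) (fst (snd (snd (q k))))) +
        sc (l s (fst (snd (snd (snd (r k))))) (fst (snd (snd (snd (q k)))))) (M s k))" for s x
  have Fp: "polym (\<lambda>s. F s x)" for x
    by (cases x) (simp_all add: F_def, (intro polym_intros lp Mp)+)
  have F0: "F 0 x = T0 x" if "x \<in> surface_gens g" for x
    using that r by (cases x) (auto simp: F_def M_def l_def surface_gens_def)
  have F1: "F 1 x = T1 x" if "x \<in> surface_gens g" for x
    using that q by (cases x) (auto simp: F_def M_def l_def surface_gens_def)
  have Fc: "F s (GenA k) * F s (GenB k) = F s (GenB k) * F s (GenA k)" for s k
    unfolding F_def surface_gen.case by (rule pencil_commute)
  define W where "W s = dt (F s x * F s y - F s y * F s x)" for s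
  define Bad where "Bad = (\<Union>x\<in>surface_gens g. {s. dt (F s x) = 0}) \<union> ({s. W s = 0} - {0})"
  have W1: "W 1 \<noteq> 0" using xy F1 by (simp add: W_def)
  have "finite {s. dt (F s x) = 0}" if "x \<in> surface_gens g" for x
    using polyf_finite_zeros[OF polyf_dt[OF Fp], of 0 x] d[OF that] F0[OF that] by simp
  moreover have "polyf W" unfolding W_def by (intro polyf_dt polym_intros Fp)
  then have "finite {s. W s = 0}" using polyf_finite_zeros W1 by blast
  ultimately have fin: "finite Bad" unfolding Bad_def using surface_gens_finite by simp
  have v: "valid g (F s)" if s: "s \<notin> Bad" for s
    using relc_valid[OF relc_commuting[of g "F s"]] Fc s by (auto simp: Bad_def)
  have v0: "valid g T0" using relc_valid[OF relc_commuting[of g T0]] c0 d by blast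
  have v1: "valid g T1" using relc_valid[OF relc_commuting[of g T1]] c1 d by blast
  have gd: "good g (F s)" if s: "s \<notin> Bad" for s
  proof (cases "s = 0")
    case True
    then show ?thesis using rescale(3)[OF v0, of "\<lambda>_. 1" "F 0"] F0 good by simp
  next
    case False
    then have "W s \<noteq> 0" using s by (auto simp: Bad_def)
    then show ?thesis unfolding good_def using irr_witness[OF xy(1,2)] by (simp add: W_def)
  qed
  have "0 \<notin> Bad" "1 \<notin> Bad" using d F0 F1 W1 by (auto simp: Bad_def)
  then have "linked g (pt g (F 0)) (pt g (F 1))"
    using linked_curve[OF g Fp fin v gd] by blast
  then show ?thesis
    using rescale(2)[OF v0, of "\<lambda>_. 1" "F 0"] rescale(2)[OF v1, of "\<lambda>_. 1" "F 1"] F0 F1 by simp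
qed

text \<open>If every element of the pencil spanned by \<open>B\<close> and \<open>B A\<close> had a double eigenvalue, their
  traceless parts would span an isotropic subspace of \<open>sl\<^sub>2\<close>, hence be proportional.\<close>

lemma isotropic_commute:
  assumes "(tr B)\<^sup>2 = 4 * dt B" "(tr C)\<^sup>2 = 4 * dt C" "(tr (B + C))\<^sup>2 = 4 * dt (B + C)"
  shows "B * C = C * B"
proof -
  define x y z u v w where "x = e11 B - e22 B" "y = e12 B" "z = e21 B" "u = e11 C - e22 C" "v = e12 C" "w = e21 C"
  note defs = this
  have 1: "x * x = - 4 * (y * z)" "u * u = - 4 * (v * w)"
    using assms(1,2) unfolding defs tr_def dt_def by (simp_all add: power2_eq_square algebra_simps)
  have "(x + u) * (x + u) = - 4 * ((y + v) * (z + w))"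
    using assms(3) unfolding defs tr_def dt_def by (simp add: power2_eq_square algebra_simps)
  \<comment> \<open>Polarization: the bilinear form of the discriminant vanishes on the two
    traceless parts.\<close>
  then have "2 * (x * u + 2 * (y * w + v * z)) = 0" using 1 by (simp add: algebra_simps)
  then have "x * u + 2 * (y * w + v * z) = 0" by (simp only: mult_eq_0_iff) simp
  then have 2: "x * u = - (2 * (y * w + v * z))" by (rule eq_neg_iff_add_eq_0[THEN iffD2])
  \<comment> \<open>Up to sign the three cross products are entries of \<open>B * C - C * B\<close>;
    each has square zero by the isotropy relations.\<close>
  have "(y * w - v * z)\<^sup>2 * 4 = (2 * (y * w + v * z))\<^sup>2 - 16 * (y * z) * (v * w)"
    by (simp add: power2_eq_square algebra_simps)
  also have "(2 * (y * w + v * z))\<^sup>2 = (x * u)\<^sup>2" unfolding 2 by (simp add: power2_eq_square algebra_simps)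
  also have "(x * u)\<^sup>2 = (x * x) * (u * u)" by (simp add: power2_eq_square algebra_simps)
  also have "(x * x) * (u * u) - 16 * (y * z) * (v * w) = 0" unfolding 1 by (simp add: algebra_simps)
  finally have a: "y * w = v * z" by simp
  have "(x * v - u * y)\<^sup>2 = (x * x) * (v * v) - 2 * (x * u) * (v * y) + (u * u) * (y * y)"
    by (simp add: power2_eq_square algebra_simps)
  also have "\<dots> = 0" unfolding 1 2 by (simp add: algebra_simps)
  finally have b: "x * v = u * y" by simp
  have "(x * w - u * z)\<^sup>2 = (x * x) * (w * w) - 2 * (x * u) * (w * z) + (u * u) * (z * z)"
    by (simp add: power2_eq_square algebra_simps)
  also have "\<dots> = 0" unfolding 1 2 by (simp add: algebra_simps)
  finally have c: "x * w = u * z" by simp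
  show ?thesis using a b c unfolding defs m2_eq_iff by (simp add: algebra_simps)
qed

text \<open>The discriminant is a quadratic form on matrices, so it obeys the parallelogram law.
  From the parameters 0, 1 and -1 of a pencil this recovers its value on the direction of the
  pencil.\<close>

lemma disc_parallelogram: "4 * dt (X + sc (- 1) Y) - (tr (X + sc (- 1) Y))\<^sup>2 =
    2 * (4 * dt X - (tr X)\<^sup>2) + 2 * (4 * dt Y - (tr Y)\<^sup>2) - (4 * dt (X + Y) - (tr (X + Y))\<^sup>2)"
  by (simp add: dt_def tr_def power2_eq_square algebra_simps)

text \<open>An algebraic Dehn twist: \<open>b\<close> is replaced by \<open>b (1 + s a)\<close>, and
  since the new factor commutes with \<open>a\<close>, the commutator changes only by a scalar. A
  suitable \<open>s\<close> gives the new \<open>b\<close> distinct eigenvalues, as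
  \<open>handle_link\<close> requires.\<close>

lemma twist_link:
  assumes g: "1 \<le> g" and i: "i \<in> {1..g}" and R: "relc g e T" and irr: "irr g T"
    and nc: "T (GenA i) * T (GenB i) \<noteq> T (GenB i) * T (GenA i)"
  obtains T' where "relc g e T'" "irr g T'" "linked g (pt g T) (pt g T')"
    "T' (GenA i) * T' (GenB i) \<noteq> T' (GenB i) * T' (GenA i)" "4 * dt (T' (GenB i)) - (tr (T' (GenB i)))\<^sup>2 \<noteq> 0"
proof -
  let ?A = "T (GenA i)" and ?B = "T (GenB i)"
  define V where "V s = 1 + sc s ?A" for s
  define F where "F s = T(GenB i := ?B * V s)" for s
  have gi: "GenA i \<in> surface_gens g" "GenB i \<in> surface_gens g" using i by (auto simp: surface_gens_def)
  have dT: "dt (T x) \<noteq> 0" if "x \<in> surface_gens g" for x using R that by (simp add: relc_def)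
  have Vp: "polym V" unfolding V_def by (intro polym_intros polyf_intros)
  have Fp: "polym (\<lambda>s. F s x)" for x unfolding F_def fun_upd_def using Vp by (cases "x = GenB i") auto
  have VA: "V s * adj ?A = adj ?A * V s" "?A * V s = V s * ?A" for s
    by (simp_all add: V_def distrib_left distrib_right)
  define Bad where "Bad = {s. dt (V s) = 0}"
  have V0: "V 0 = 1" by (simp add: V_def)
  have fin: "finite Bad" unfolding Bad_def using polyf_finite_zeros[OF polyf_dt[OF Vp], of 0] V0 by simp
  have rel: "relc g e (F s)" if s: "s \<notin> Bad" for s
  proof -
    have rc: "before (F s) i = before T i" "after g (F s) i = after g T i" "delta_rest g (F s) i = delta_rest g T i"
      using rest_cong[of i g "F s" T] i by (auto simp: F_def)
    have "hand (F s) i = ?A * ?B * (V s * adj ?A) * adj (V s) * adj ?B"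
      by (simp add: hand_def F_def mult.assoc)
    also have "\<dots> = sc (dt (V s)) (hand T i)" unfolding VA(1) by (simp add: hand_def mult.assoc)
    finally have h: "hand (F s) i = sc (dt (V s)) (hand T i)" .
    have de: "delta (F s) i = dt (V s) * delta T i" by (simp add: delta_def F_def)
    have "before T i * hand T i * after g T i = cm (e * (delta_rest g T i * delta T i))"
      using R unfolding relc_def split_at[OF i] by blast
    then have "before T i * sc (dt (V s)) (hand T i) * after g T i = cm (e * (delta_rest g T i * (dt (V s) * delta T i)))"
      by (simp add: mult_ac)
    moreover have "\<forall>x\<in>surface_gens g. dt (F s x) \<noteq> 0" using dT s gi by (auto simp: F_def Bad_def)
    ultimately show ?thesis unfolding relc_def split_at[OF i] rc h de by blast
  qed
  \<comment> \<open>A line invariant under \<open>a\<close> and \<open>b * V s\<close> is invariant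
    under \<open>V s\<close>, a polynomial in \<open>a\<close>, and hence under
    \<open>b\<close>.\<close>
  have ir: "irr g (F s)" if s: "s \<notin> Bad" for s
    unfolding irr_def
  proof clarify
    fix N assume N: "dt N \<noteq> 0" "\<forall>x\<in>surface_gens g. tri N (F s x)"
    have A: "tri N ?A" using N(2) gi by (auto simp: F_def)
    have BV: "tri N (?B * V s)" using N(2) gi by (auto simp: F_def)
    have "e21 (adj N * V s * N) = e21 (adj N * N) + s * e21 (adj N * ?A * N)"
      by (simp add: V_def distrib_left distrib_right del: m2_sel(19) adj_mult)
    then have "tri N (V s)" using A by (simp add: tri_def del: m2_sel(19))
    then have "tri N (?B * V s * adj (V s))" by (intro tri_mult[OF N(1) BV] tri_adj)
    then have "tri N (sc (dt (V s)) ?B)" by (simp add: mult.assoc)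
    then have "tri N ?B" using s by (simp add: Bad_def tri_def del: m2_sel)
    then have "\<forall>x\<in>surface_gens g. tri N (T x)" using N(2) by (auto simp: F_def split: if_splits)
    then show False using irr N(1) unfolding irr_def by blast
  qed
  have link: "linked g (pt g T) (pt g (F s))" if s: "s \<notin> Bad" for s
  proof -
    have "linked g (pt g (F 0)) (pt g (F s))"
      using s V0 by (intro linked_curve[OF g Fp fin]) (auto simp: relc_valid[OF rel] good_def ir Bad_def)
    moreover have "F 0 = T" by (simp add: F_def V0)
    ultimately show ?thesis by simp
  qed
  have ncs: "F s (GenA i) * F s (GenB i) \<noteq> F s (GenB i) * F s (GenA i)" if s: "s \<notin> Bad" for s
  proof
    assume "F s (GenA i) * F s (GenB i) = F s (GenB i) * F s (GenA i)"
    then have "?A * ?B * V s = ?B * ?A * V s" by (simp add: F_def mult.assoc VA(2))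
    then show False using nc mult_right_cancel_m2 s by (auto simp: Bad_def)
  qed
  define D where "D s = 4 * dt (?B * V s) - (tr (?B * V s))\<^sup>2" for s
  \<comment> \<open>Otherwise the polynomial \<open>D\<close> vanishes identically, and
    \<open>isotropic_commute\<close> for \<open>b\<close> and \<open>b a\<close> contradicts
    noncommutativity.\<close>
  have "\<exists>s. s \<notin> Bad \<and> D s \<noteq> 0"
  proof (rule ccontr)
    assume n: "\<nexists>s. s \<notin> Bad \<and> D s \<noteq> 0"
    have Dp: "polyf D" unfolding D_def power2_eq_square by (intro polyf_intros polyf_dt polyf_tr polym_intros Vp)
    have D0: "D s = 0" for s
    proof (rule ccontr)
      assume "D s \<noteq> 0"
      then have "finite {s. D s = 0}" using polyf_finite_zeros Dp by blast
      moreover have "UNIV = Bad \<union> {s. D s = 0}" using n by blast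
      ultimately show False using fin infinite_UNIV_char_0[where 'a = complex] by (metis finite_Un)
    qed
    have BV: "?B * V s = ?B + sc s (?B * ?A)" for s by (simp add: V_def distrib_left)
    define p q r where "p = 4 * dt ?B - (tr ?B)\<^sup>2" "q = 4 * dt (?B * ?A) - (tr (?B * ?A))\<^sup>2"
      "r = 4 * dt (?B + ?B * ?A) - (tr (?B + ?B * ?A))\<^sup>2"
    have "D 0 = p" "D 1 = r" unfolding D_def BV by (simp_all add: p_q_r_def)
    then have pr: "p = 0" "r = 0" using D0 by auto
    have "D (- 1) = 2 * p + 2 * q - r"
      unfolding D_def BV p_q_r_def by (rule disc_parallelogram)
    then have "q = 0" using D0[of "- 1"] pr by simp
    then have "?B * (?B * ?A) = ?B * ?A * ?B"
      using pr unfolding p_q_r_def by (intro isotropic_commute) simp_all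
    then have "?B * (?B * ?A) = ?B * (?A * ?B)" by (simp only: mult.assoc)
    then have "?B * ?A = ?A * ?B" using mult_left_cancel_m2 dT[OF gi(2)] by blast
    then show False using nc by simp
  qed
  then obtain s where s: "s \<notin> Bad" "D s \<noteq> 0" by blast
  show ?thesis
    using that[OF rel[OF s(1)] ir[OF s(1)] link[OF s(1)] ncs[OF s(1)]] s(2) by (simp add: D_def F_def)
qed

section \<open>Reference representations for the two signs\<close>

definition Zm :: m2 where "Zm = M2 \<i> 0 0 1"
definition Wm :: m2 where "Wm = M2 0 1 1 0"

lemma ZW [simp]: "dt Zm = \<i>" "dt Wm = - 1" "dt (Zm * Wm - Wm * Zm) \<noteq> 0" "dt (Wm * Zm - Zm * Wm) \<noteq> 0"
  "Zm * Wm \<noteq> Wm * Zm" "Wm * Zm \<noteq> Zm * Wm"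
  "tr Wm = 0" "(tr Zm)\<^sup>2 = 2 * \<i>"
  by (simp_all add: Zm_def Wm_def dt_def tr_def m2_eq_iff complex_eq_iff power2_eq_square)

text \<open>\<open>Zm\<close> is a quarter turn about the vertical axis and \<open>Wm\<close> a
  half-turn reversing it. Both commutators are the half-turn about the axis, and exchanging the two
  matrices changes the sign of the lift, so two such handles can be made to cancel with either
  sign.\<close>

lemma hand_ZW: "Zm * Wm * adj Zm * adj Wm = M2 1 0 0 (- 1)" "Wm * Zm * adj Wm * adj Zm = M2 (- 1) 0 0 1"
  by (simp_all add: Zm_def Wm_def m2_eq_iff)

text \<open>With lifts to \<open>SL\<^sub>2\<close> both commutators of handle \<open>i\<close> and handle \<open>j\<close> are \<open>\<plusminus> diag (\<i>, - \<i>)\<close>, so that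
  their product is \<open>e\<close>.\<close>

definition hub :: "nat \<Rightarrow> nat \<Rightarrow> complex \<Rightarrow> surface_gen \<Rightarrow> m2" where
  "hub i j e x = (case x of
      GenA k \<Rightarrow> if k = i then Zm else if k = j then (if e = - 1 then Zm else Wm) else 1
    | GenB k \<Rightarrow> if k = i then Wm else if k = j then (if e = - 1 then Wm else Zm) else 1)"

lemma prod_list_diag:
  "(\<And>k. k \<in> set xs \<Longrightarrow> f k = M2 (p k) 0 0 (q k)) \<Longrightarrow>
    prod_list (map f xs) = M2 (prod_list (map p xs)) 0 0 (prod_list (map q xs))"
  by (induction xs) (auto simp: m2_eq_iff)

lemma prod_list_two:
  fixes a b :: complex
  assumes "i \<in> {1..g}" "j \<in> {1..g}" "i \<noteq> j"
  shows "prod_list (map (\<lambda>k. if k = i then a else if k = j then b else 1) [1..<Suc g]) = a * b"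
proof -
  have "prod_list (map (\<lambda>k. if k = i then a else if k = j then b else 1) [1..<Suc g])
    = (\<Prod>k\<in>{1..g}. if k = i then a else if k = j then b else 1)"
    by (subst prod.distinct_set_conv_list[symmetric]) (auto simp: atLeastLessThanSuc_atLeastAtMost simp del: upt_Suc)
  also have "\<dots> = (\<Prod>k\<in>{1..g}. (if k = i then a else 1) * (if k = j then b else 1))"
    using assms(3) by (intro prod.cong) auto
  also have "\<dots> = a * b" using assms(1,2) by (simp add: prod.distrib)
  finally show ?thesis .
qed

lemma relc_hub:
  assumes ij: "i \<in> {1..g}" "j \<in> {1..g}" "i \<noteq> j" and e: "e = 1 \<or> e = - 1"
  shows "relc g e (hub i j e)"
proof -
  let ?T = "hub i j e"
  have h: "hand ?T k = M2 (if k = i then 1 else if k = j then - e else 1) 0 0 (if k = i then - 1 else if k = j then e else 1)" for k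
    using e ij(3) hand_ZW by (auto simp: hand_def hub_def m2_eq_iff)
  have d: "delta ?T k = (if k = i then - \<i> else if k = j then - \<i> else 1)" for k
    using ij(3) by (auto simp: delta_def hub_def)
  have "prod_list (map (hand ?T) [1..<Suc g]) = M2 (1 * - e) 0 0 (- 1 * e)"
    unfolding prod_list_diag[of "[1..<Suc g]" "hand ?T", OF h] prod_list_two[OF ij] ..
  moreover have "prod_list (map (delta ?T) [1..<Suc g]) = - \<i> * - \<i>"
    using prod_list_two[OF ij] unfolding d[abs_def] by (simp only:)
  moreover have "dt (?T x) \<noteq> 0" for x by (cases x) (auto simp: hub_def)
  ultimately show ?thesis unfolding relc_def by (simp add: cm_def)
qed

lemma gens_simps [simp]: "GenA k \<in> surface_gens g \<longleftrightarrow> k \<in> {1..g}" "GenB k \<in> surface_gens g \<longleftrightarrow> k \<in> {1..g}"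
  by (auto simp: surface_gens_def)

lemma irr_hub: "i \<in> {1..g} \<Longrightarrow> irr g (hub i j e)"
  using irr_witness[of "GenA i" g "GenB i" "hub i j e"] by (simp add: hub_def)

text \<open>\<open>handle_link\<close> wants a second noncommuting handle at its target. The detour
  through \<open>hub i g e\<close> supplies one: handle \<open>g\<close> is noncommuting there, and
  solving for it then leads on to \<open>hub 1 g e\<close>.\<close>

lemma link_hub_noncommuting:
  assumes g: "3 \<le> g" and R: "relc g e T" and good: "irr g T" and e: "e = 1 \<or> e = - 1"
    and i: "i \<in> {1..g}" and nc: "T (GenA i) * T (GenB i) \<noteq> T (GenB i) * T (GenA i)"
  shows "linked g (pt g T) (pt g (hub 1 g e))"
proof -
  have g1: "1 \<le> g" "1 \<in> {1..g}" "g \<in> {1..g}" "1 \<noteq> g" "g \<noteq> 1" using g by auto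
  have ee: "e * e = 1" using e by auto
  note r1 = relc_hub[OF g1(2,3,4) e]
  obtain T' where T': "relc g e T'" "irr g T'" "linked g (pt g T) (pt g T')"
    "T' (GenA i) * T' (GenB i) \<noteq> T' (GenB i) * T' (GenA i)" "4 * dt (T' (GenB i)) - (tr (T' (GenB i)))\<^sup>2 \<noteq> 0"
    using twist_link[OF g1(1) i R good nc] by blast
  \<comment> \<open>Here handle \<open>g\<close> is solved for, and handle 1 of the target is the
    witness of irreducibility.\<close>
  have hg: "linked g (pt g S) (pt g (hub 1 g e))"
    if S: "relc g e S" "irr g S" "S (GenA g) * S (GenB g) \<noteq> S (GenB g) * S (GenA g)"
      "4 * dt (S (GenB g)) - (tr (S (GenB g)))\<^sup>2 \<noteq> 0" for S
    using g1 S irr_hub[OF g1(2)]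
    by (intro handle_link[OF g1(1,3,2,4) ee S(1) r1]) (auto simp: good_def hub_def)
  have "linked g (pt g T') (pt g (hub 1 g e))"
  proof (cases "i = g")
    case True
    then show ?thesis using hg T' by blast
  next
    case False
    note ri = relc_hub[OF i g1(3) False e]
    have "linked g (pt g T') (pt g (hub i g e))"
      using T' irr_hub[OF i] False
      by (intro handle_link[OF g1(1) i g1(3) _ ee T'(1) ri]) (auto simp: good_def hub_def)
    moreover have "linked g (pt g (hub i g e)) (pt g (hub 1 g e))"
      using False irr_hub[OF i] by (intro hg[OF ri]) (auto simp: hub_def)
    ultimately show ?thesis by (rule linked_trans)
  qed
  then show ?thesis using T'(3) linked_trans by blast
qed

text \<open>A path from a tuple all of whose handles commute to one with noncommuting handles \<open>1\<close> and
  \<open>g\<close>: the two commutators are kept inverse to each other, and handle \<open>2\<close> provides irreducibility.\<close>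

definition bridge :: "nat \<Rightarrow> complex \<Rightarrow> surface_gen \<Rightarrow> m2" where
  "bridge g s x = (case x of
      GenA k \<Rightarrow> if k = 1 then Zm else if k = 2 then Wm else if k = g then sc (1 - s) 1 + sc s Wm else 1
    | GenB k \<Rightarrow> if k = 1 then sc (1 - s) 1 + sc s Wm else if k = g then Zm else 1)"

lemma polym_if: "polym F \<Longrightarrow> polym G \<Longrightarrow> polym (\<lambda>s. if P then F s else G s)"
  by (cases P) auto

lemma link_hub_commuting:
  assumes g: "3 \<le> g" and T: "valid g T" "good g T"
    and c: "\<And>k. k \<in> {1..g} \<Longrightarrow> T (GenA k) * T (GenB k) = T (GenB k) * T (GenA k)"
  shows "linked g (pt g T) (pt g (hub 1 g 1))"
proof -
  have g1: "1 \<le> g" using g by simp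
  define b where "b s = dt (sc (1 - s) 1 + sc s Wm)" for s
  define Bad where "Bad = {s. b s = 0}"
  have b01: "b 0 = 1" "b 1 = - 1" by (simp_all add: b_def)
  have bp: "polyf b" unfolding b_def by (intro polyf_dt polym_linear)
  have fin: "finite Bad" unfolding Bad_def using polyf_finite_zeros[OF bp, of 0] b01 by simp
  have dets: "dt (bridge g s x) \<noteq> 0" if "s \<notin> Bad" for s x
    using that by (cases x) (auto simp: bridge_def Bad_def b_def)
  have Fp: "polym (\<lambda>s. bridge g s x)" for x
    by (cases x) (simp_all only: bridge_def surface_gen.case, (intro polym_if polym_linear polym_intros(1))+)
  have split: "[1..<Suc g] = 1 # [2..<g] @ [g]"
    using g by (simp add: upt_conv_Cons numeral_2_eq_2)
  have rel: "relc g 1 (bridge g s)" if s: "s \<notin> Bad" for s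
  proof -
    let ?T = "bridge g s"
    define B where "B = sc (1 - s) 1 + sc s Wm"
    have mid: "prod_list (map (hand ?T) [2..<g]) = cm (prod_list (map (delta ?T) [2..<g]))"
      by (rule prod_list_cm, rule hand_commuting) (use g in \<open>auto simp: bridge_def\<close>)
    have ends: "?T (GenA 1) = Zm" "?T (GenB 1) = B" "?T (GenA g) = B" "?T (GenB g) = Zm"
      using g by (auto simp: bridge_def B_def)
    \<comment> \<open>The commutators of the pairs \<open>Zm\<close>, \<open>B\<close> and
      \<open>B\<close>, \<open>Zm\<close> are inverse to each other, and the handles between them
      contribute only a scalar \<open>m\<close>.\<close>
    have kq: "Zm * B * adj Zm * adj B * (cm m * (B * Zm * adj B * adj Zm)) = cm (dt Zm * dt B * (m * (dt B * dt Zm)))" for m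
      by (simp add: mult.assoc mult_ac del: ZW)
    have "prod_list (map (hand ?T) [1..<Suc g]) = cm (1 * prod_list (map (delta ?T) [1..<Suc g]))"
      unfolding split by (simp add: mid hand_def[of ?T 1] hand_def[of ?T g] delta_def[of ?T 1] delta_def[of ?T g] ends kq
          del: ZW upt_Suc sc_simps One_nat_def)
    then show ?thesis unfolding relc_def using dets[OF s] by blast
  qed
  \<comment> \<open>\<open>GenA 1\<close> and \<open>GenA 2\<close> keep the values
    \<open>Zm\<close> and \<open>Wm\<close> for every \<open>s\<close>; \<open>3 \<le> g\<close>
    keeps handle 2 apart from handle \<open>g\<close>.\<close>
  have wit: "irr g (bridge g s)" for s
    using irr_witness[of "GenA 1" g "GenA 2" "bridge g s"] g by (simp add: bridge_def)
  have 0: "0 \<notin> Bad" "1 \<notin> Bad" using b01 by (simp_all add: Bad_def)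
  have l: "linked g (pt g (bridge g 0)) (pt g (bridge g 1))"
    using wit by (intro linked_curve[OF g1 Fp fin _ _ 0]) (auto simp: relc_valid[OF rel] good_def)
  have c0: "bridge g 0 (GenA k) * bridge g 0 (GenB k) = bridge g 0 (GenB k) * bridge g 0 (GenA k)" for k
    using g by (auto simp: bridge_def)
  have "linked g (pt g T) (pt g (bridge g 0))"
    using T c c0 dets[OF 0(1)] g
    by (intro commuting_link[OF g1, of T "bridge g 0" "GenA 1" "GenA 2"]) (auto simp: valid_def bridge_def)
  moreover have "linked g (pt g (bridge g 1)) (pt g (hub 1 g 1))"
    using g by (intro link_hub_noncommuting[OF g rel[OF 0(2)] wit, of g]) (auto simp: bridge_def)
  ultimately show ?thesis using l linked_trans by blast
qed

lemma link_hub: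
  assumes g: "3 \<le> g" and e: "e = 1 \<or> e = - 1" and R: "relc g e T" and good: "good g T"
  shows "linked g (pt g T) (pt g (hub 1 g e))"
proof (cases "\<forall>k\<in>{1..g}. T (GenA k) * T (GenB k) = T (GenB k) * T (GenA k)")
  case True
  \<comment> \<open>Commuting handles satisfy the relation with sign 1, and as the determinants are
    nonzero the sign is unique.\<close>
  have "relc g 1 T" using relc_commuting[of g T] True R by (auto simp: relc_def)
  moreover have "prod_list (map (delta T) [1..<Suc g]) \<noteq> 0"
    using R by (auto simp: relc_def prod_list_zero_iff delta_def simp del: upt_Suc)
  ultimately have "e = 1" using R by (auto simp: relc_def simp del: upt_Suc)
  then show ?thesis using link_hub_commuting[OF g relc_valid[OF R] good] True by blast
next
  case False
  then obtain k where k: "k \<in> {1..g}" "T (GenA k) * T (GenB k) \<noteq> T (GenB k) * T (GenA k)" by blast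
  \<comment> \<open>Simultaneously diagonalizable matrices commute, so a noncommuting handle rules
    out the other alternative in \<open>good\<close>.\<close>
  have "irr g T"
  proof (rule ccontr)
    assume "\<not> irr g T"
    then obtain G where G: "dt G \<noteq> 0" "\<forall>x\<in>surface_gens g. e21 (adj G * T x * G) = 0 \<and> e12 (adj G * T x * G) = 0"
      using good unfolding good_def diagable_def by blast
    define X Y where "X = adj G * T (GenA k) * G" and "Y = adj G * T (GenB k) * G"
    have z: "e21 X = 0" "e12 X = 0" "e21 Y = 0" "e12 Y = 0"
      using G(2) k(1) unfolding X_def Y_def by (simp_all del: m2_sel)
    have "X * Y = Y * X" using z by (simp add: m2_eq_iff mult.commute)
    moreover have "X * Y = adj G * (sc (dt G) (T (GenA k) * T (GenB k)) * G)" "Y * X = adj G * (sc (dt G) (T (GenB k) * T (GenA k)) * G)"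
      by (simp_all add: X_def Y_def mult.assoc)
    ultimately have "adj G * (sc (dt G) (T (GenA k) * T (GenB k)) * G) = adj G * (sc (dt G) (T (GenB k) * T (GenA k)) * G)"
      by (simp only:)
    then have "sc (dt G) (T (GenA k) * T (GenB k)) = sc (dt G) (T (GenB k) * T (GenA k))"
      using G(1) by (simp only: mult_left_cancel_m2 mult_right_cancel_m2 dt_simps not_False_eq_True)
    then show False using G(1) k(2) by (simp only: sc_cancel(1) not_False_eq_True)
  qed
  then show ?thesis using link_hub_noncommuting[OF g R _ e k(1,2)] by blast
qed

section \<open>A line in the closure of both components\<close>

text \<open>\<open>a\<^sub>2\<close> translates the vertical axis by \<open>t\<close>, \<open>b\<^sub>1\<close> reverses it, and \<open>a\<^sub>1\<close> fixes it pointwise: it is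
  the identity for \<open>e = 1\<close> and the half-turn, which anticommutes with the lift of \<open>b\<^sub>1\<close>, for
  \<open>e = - 1\<close>. The action on the axis does not depend on \<open>e\<close>, and up to scale not on \<open>t\<close>.\<close>

definition dihedral :: "complex \<Rightarrow> real \<Rightarrow> surface_gen \<Rightarrow> m2" where
  "dihedral e t x = (if x = GenA 1 then M2 e 0 0 1 else if x = GenB 1 then Wm
     else if x = GenA 2 then M2 (of_real (exp t)) 0 0 1 else 1)"

lemma dt_dihedral: "e \<noteq> 0 \<Longrightarrow> dt (dihedral e t x) \<noteq> 0"
  by (auto simp: dihedral_def) (simp_all add: dt_def)

text \<open>In every handle but the first at least one generator is the identity; the two generators
  of the first commute up to the factor \<open>e\<close>, which becomes the sign.\<close>

lemma valid_dihedral: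
  assumes "e = 1 \<or> e = - 1" "1 \<le> g"
  shows "relc g e (dihedral e t)"
proof -
  let ?T = "dihedral e t"
  have h1: "hand ?T 1 = cm (e * delta ?T 1)"
    using assms(1) by (auto simp: hand_def delta_def dihedral_def Wm_def m2_eq_iff dt_def)
  have h: "hand ?T k = cm (delta ?T k)" if "k \<noteq> 1" for k
    using that by (intro hand_commuting) (auto simp: dihedral_def)
  have "[1..<Suc g] = 1 # [2..<Suc g]" using assms(2) by (simp add: upt_conv_Cons numeral_2_eq_2 del: upt_Suc)
  moreover have "prod_list (map (hand ?T) [2..<Suc g]) = cm (prod_list (map (delta ?T) [2..<Suc g]))"
    by (rule prod_list_cm, rule h) auto
  ultimately have "prod_list (map (hand ?T) [1..<Suc g]) = cm (e * prod_list (map (delta ?T) [1..<Suc g]))"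
    using h1 by (simp add: mult.assoc del: upt_Suc)
  then show ?thesis using assms(1) dt_dihedral unfolding relc_def by auto
qed

lemma irr_dihedral:
  assumes "2 \<le> g" "0 < t" shows "irr g (dihedral e t)"
proof (rule irr_witness[of "GenB 1" g "GenA 2"])
  have "dt (Wm * M2 (of_real (exp t)) 0 0 1 - M2 (of_real (exp t)) 0 0 1 * Wm) = (1 - of_real (exp t))\<^sup>2"
    by (simp add: Wm_def dt_def power2_eq_square algebra_simps)
  moreover have "complex_of_real (exp t) \<noteq> 1" using assms(2) by (simp only: of_real_eq_1_iff) simp
  ultimately show "dt (dihedral e t (GenB 1) * dihedral e t (GenA 2) - dihedral e t (GenA 2) * dihedral e t (GenB 1)) \<noteq> 0"
    by (simp add: dihedral_def)
qed (use assms in auto)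

section \<open>The action on the invariant axis\<close>

definition axis3 :: "(real^3) set" where "axis3 = vp ` {0<..}"

lemma axis3_line: "bij_betw (\<lambda>s. vp (exp s)) UNIV axis3" "hdist (vp (exp s)) (vp (exp t)) = \<bar>s - t\<bar>"
proof -
  have "vp u \<in> range (\<lambda>s. vp (exp s))" if "0 < u" for u
    using that by (intro image_eqI[of _ _ "ln u"]) auto
  then show "bij_betw (\<lambda>s. vp (exp s)) UNIV axis3"
    by (auto simp: bij_betw_def inj_on_def axis3_def)
qed (simp add: hdist_vp)

lemma axis3_cases: "x \<in> axis3 \<Longrightarrow> (\<And>s. x = vp (exp s) \<Longrightarrow> thesis) \<Longrightarrow> thesis"
  using axis3_line(1) by (auto simp: bij_betw_def)

lemma axis3_in [simp]: "vp (exp s) \<in> axis3" by (simp add: axis3_def)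

lemma axis3_sub: "axis3 \<subseteq> H3" by (auto simp: axis3_def)

lemma act_axis:
  assumes e: "e = 1 \<or> e = - 1"
  shows "act (dihedral e t (GenA 1)) (vp (exp s)) = vp (exp s)" "act (dihedral e t (GenB 1)) (vp (exp s)) = vp (exp (- s))"
    "act (dihedral e t (GenA 2)) (vp (exp s)) = vp (exp (s + t))"
    "x \<noteq> GenA 1 \<Longrightarrow> x \<noteq> GenB 1 \<Longrightarrow> x \<noteq> GenA 2 \<Longrightarrow> act (dihedral e t x) (vp (exp s)) = vp (exp s)"
proof -
  have v: "vp (exp s) \<in> H3" by simp
  show "act (dihedral e t (GenA 1)) (vp (exp s)) = vp (exp s)"
    using e act_affine[OF _ v, of e 0] by (auto simp: dihedral_def cz_eq)
  show "act (dihedral e t (GenB 1)) (vp (exp s)) = vp (exp (- s))"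
    using act_flip[OF v] by (simp add: dihedral_def Wm_def cz_eq exp_minus power2_eq_square inverse_eq_divide)
  show "act (dihedral e t (GenA 2)) (vp (exp s)) = vp (exp (s + t))"
    using act_affine[OF _ v, of "of_real (exp t)" 0] by (simp add: dihedral_def cz_eq exp_add mult.commute)
  show "x \<noteq> GenA 1 \<Longrightarrow> x \<noteq> GenB 1 \<Longrightarrow> x \<noteq> GenA 2 \<Longrightarrow> act (dihedral e t x) (vp (exp s)) = vp (exp s)"
    by (simp add: dihedral_def)
qed

text \<open>The coefficients \<sigma> and \<open>m\<close> are chosen before \<open>e\<close> and
  \<open>t\<close>. This uniformity gives both signs the same limit and reduces \<open>t\<close> to
  a change of scale.\<close>

lemma act_axis_letter:
  obtains \<sigma> m where "\<sigma> = 1 \<or> \<sigma> = (- 1 :: real)" "\<And>e t s. e = 1 \<or> e = - 1 \<Longrightarrow>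
    act (if b then adj (dihedral e t x) else dihedral e t x) (vp (exp s)) = vp (exp (\<sigma> * s + m * t))"
proof -
  have "\<exists>\<sigma> m. (\<sigma> = 1 \<or> \<sigma> = (- 1 :: real)) \<and> (\<forall>e t s. (e = 1 \<or> e = - 1) \<longrightarrow>
    act (dihedral e t x) (vp (exp s)) = vp (exp (\<sigma> * s + m * t)))"
  proof -
    consider "x = GenA 1" | "x = GenB 1" | "x = GenA 2" | "x \<noteq> GenA 1 \<and> x \<noteq> GenB 1 \<and> x \<noteq> GenA 2" by blast
    then show ?thesis
    proof cases
      case 1
      then show ?thesis using act_axis(1) by (intro exI[of _ 1] exI[of _ 0]) simp
    next
      case 2
      then show ?thesis using act_axis(2) by (intro exI[of _ "- 1"] exI[of _ 0]) simp
    next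
      case 3
      then show ?thesis using act_axis(3) by (intro exI[of _ 1] exI[of _ 1]) simp
    next
      case 4
      then show ?thesis using act_axis(4) by (intro exI[of _ 1] exI[of _ 0]) simp
    qed
  qed
  then obtain \<sigma> m where sm: "\<sigma> = 1 \<or> \<sigma> = (- 1 :: real)" "\<And>e t s. e = 1 \<or> e = - 1 \<Longrightarrow>
    act (dihedral e t x) (vp (exp s)) = vp (exp (\<sigma> * s + m * t))" by blast
  show ?thesis
  proof (cases b)
    case False
    then show ?thesis using that[OF sm(1), of m] sm(2) by simp
  next
    case True
    have ss: "\<sigma> * \<sigma> = 1" using sm(1) by auto
    \<comment> \<open>The inverse of the affine map \<open>s \<mapsto> \<sigma> * s + m * t\<close>,
      in which \<open>\<sigma>\<close> is its own inverse.\<close>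
    have "act (adj (dihedral e t x)) (vp (exp s)) = vp (exp (\<sigma> * s + - \<sigma> * m * t))" if e: "e = 1 \<or> e = - 1" for e t s
    proof -
      have d: "dt (dihedral e t x) \<noteq> 0" using e by (intro dt_dihedral) auto
      have "\<sigma> * (\<sigma> * s + - \<sigma> * m * t) + m * t = \<sigma> * \<sigma> * s + (1 - \<sigma> * \<sigma>) * m * t" by (simp add: algebra_simps)
      then have "act (dihedral e t x) (vp (exp (\<sigma> * s + - \<sigma> * m * t))) = vp (exp s)"
        unfolding sm(2)[OF e] ss by simp
      then show ?thesis using act_adj(1)[OF d, of "vp (exp (\<sigma> * s + - \<sigma> * m * t))"] by simp
    qed
    then show ?thesis using that[OF sm(1), of "- \<sigma> * m"] True by simp
  qed
qed

lemma act_axis_word: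
  "\<exists>\<sigma> m. (\<sigma> = 1 \<or> \<sigma> = (- 1 :: real)) \<and> (\<forall>e t s. (e = 1 \<or> e = - 1) \<longrightarrow>
    act (ev (dihedral e t) w) (vp (exp s)) = vp (exp (\<sigma> * s + m * t)))"
proof (induction w)
  case Nil
  then show ?case by (intro exI[of _ 1] exI[of _ 0]) simp
next
  case (Cons p w)
  then obtain \<sigma> m where sm: "\<sigma> = 1 \<or> \<sigma> = (- 1 :: real)" "\<And>e t s. e = 1 \<or> e = - 1 \<Longrightarrow>
    act (ev (dihedral e t) w) (vp (exp s)) = vp (exp (\<sigma> * s + m * t))" by blast
  obtain x b where p: "p = (x, b)" by force
  obtain \<tau> n where tn: "\<tau> = 1 \<or> \<tau> = (- 1 :: real)" "\<And>e t s. e = 1 \<or> e = - 1 \<Longrightarrow>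
    act (if b then adj (dihedral e t x) else dihedral e t x) (vp (exp s)) = vp (exp (\<tau> * s + n * t))"
    using act_axis_letter[of b x] by blast
  have "act (ev (dihedral e t) (p # w)) (vp (exp s)) = vp (exp ((\<tau> * \<sigma>) * s + (\<tau> * m + n) * t))"
    if e: "e = 1 \<or> e = - 1" for e t s
  proof -
    let ?P = "if b then adj (dihedral e t x) else dihedral e t x"
    have e0: "e \<noteq> 0" using e by auto
    have "dt ?P \<noteq> 0" using dt_dihedral[OF e0] by simp
    moreover have "dt (ev (dihedral e t) w) \<noteq> 0"
      using dt_dihedral[OF e0] by (intro dt_ev[of UNIV]) (auto simp: words_over_def)
    ultimately have "act (?P * ev (dihedral e t) w) (vp (exp s)) = act ?P (act (ev (dihedral e t) w) (vp (exp s)))"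
      by (intro act_mult) auto
    also have "\<dots> = vp (exp (\<tau> * (\<sigma> * s + m * t) + n * t))" unfolding sm(2)[OF e] tn(2)[OF e] ..
    also have "\<tau> * (\<sigma> * s + m * t) + n * t = (\<tau> * \<sigma>) * s + (\<tau> * m + n) * t" by (simp add: algebra_simps)
    also have "?P * ev (dihedral e t) w = ev (dihedral e t) (p # w)" by (simp add: p)
    finally show ?thesis .
  qed
  moreover have "\<tau> * \<sigma> = 1 \<or> \<tau> * \<sigma> = - 1" using sm(1) tn(1) by auto
  ultimately show ?case by blast
qed

text \<open>The value \<open>t = 1\<close> gives minimal displacement 1, as demanded of tree points.
  The maps are restricted to the axis because a \<open>group_action\<close> consists of extensional
  bijections.\<close>

definition axis_action :: "nat \<Rightarrow> (real^3) gamma_space" where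
  "axis_action g = (axis3, hdist, \<lambda>\<gamma>\<in>carrier (surface_group g). restrict (rep g (dihedral 1 1) \<gamma>) axis3)"

lemma dihedral_valid: "e = 1 \<or> e = - 1 \<Longrightarrow> 1 \<le> g \<Longrightarrow> valid g (dihedral e t)"
  using valid_dihedral relc_valid by blast

lemma rep_axis:
  assumes "1 \<le> g" "\<gamma> \<in> carrier (surface_group g)"
  shows "\<exists>\<sigma> m. \<forall>e t s. (e = 1 \<or> e = - 1) \<longrightarrow> rep g (dihedral e t) \<gamma> (vp (exp s)) = vp (exp (\<sigma> * s + m * t))"
proof -
  obtain w where w: "w \<in> words_over (surface_gens g)" "\<gamma> = cls g w" using assms(2) by (auto simp: surface_carrier)
  obtain \<sigma> m where sm: "\<forall>e t s. (e = 1 \<or> e = - 1) \<longrightarrow>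
    act (ev (dihedral e t) w) (vp (exp s)) = vp (exp (\<sigma> * s + m * t))" using act_axis_word[of w] by blast
  have "rep g (dihedral e t) \<gamma> (vp (exp s)) = vp (exp (\<sigma> * s + m * t))" if e: "e = 1 \<or> e = - 1" for e t s
    using rep_apply[OF dihedral_valid[OF e assms(1)] w(1), of "vp (exp s)" t] sm e w(2) by simp
  then show ?thesis by blast
qed

lemma isometric_axis_action:
  assumes g: "1 \<le> g"
  shows "isometric_action g (axis_action g)"
proof -
  let ?r = "rep g (dihedral 1 1)" and ?G = "surface_group g"
  let ?\<rho> = "\<lambda>\<gamma>\<in>carrier ?G. restrict (?r \<gamma>) axis3"
  interpret G: group ?G by (rule group_surface)
  have v: "valid g (dihedral 1 1)" using dihedral_valid g by blast
  have hom: "?r \<in> hom ?G isom_plus_H3" using rep_in_rep_space[OF v] by (simp add: rep_space_def)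
  have ax: "?r \<gamma> x \<in> axis3" if gx: "\<gamma> \<in> carrier ?G" "x \<in> axis3" for \<gamma> x
  proof -
    obtain \<sigma> m where "\<forall>e t s. (e = 1 \<or> e = - 1) \<longrightarrow> rep g (dihedral e t) \<gamma> (vp (exp s)) = vp (exp (\<sigma> * s + m * t))"
      using rep_axis[OF g gx(1)] by blast
    moreover obtain s where "x = vp (exp s)" using gx(2) by (rule axis3_cases)
    ultimately show ?thesis using axis3_in by simp
  qed
  have mult: "?r (\<gamma> \<otimes>\<^bsub>?G\<^esub> \<eta>) x = ?r \<gamma> (?r \<eta> x)" if c: "\<gamma> \<in> carrier ?G" "\<eta> \<in> carrier ?G" and x: "x \<in> H3" for \<gamma> \<eta> x
  proof -
    have "?r \<gamma> \<in> carrier isom_H3" "?r \<eta> \<in> carrier isom_H3"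
      using rep_space_acts[OF rep_in_rep_space[OF v]] c by (auto simp: acts_def)
    moreover have "?r (\<gamma> \<otimes>\<^bsub>?G\<^esub> \<eta>) = ?r \<gamma> \<otimes>\<^bsub>isom_H3\<^esub> ?r \<eta>"
      using hom_mult[OF hom c] by (simp add: isom_plus_H3_def)
    ultimately show ?thesis using x by (simp add: isom_H3_simps(5) compose_def)
  qed
  have one: "?r \<one>\<^bsub>?G\<^esub> x = x" if "x \<in> H3" for x
    using rep_apply[OF v _ that, of "[]"] that by (simp add: surface_one)
  have bij: "?\<rho> \<gamma> \<in> Bij axis3" if c: "\<gamma> \<in> carrier ?G" for \<gamma>
  proof -
    have "bij_betw (?r \<gamma>) axis3 axis3"
      using c ax mult[of "inv\<^bsub>?G\<^esub> \<gamma>" \<gamma>] mult[of \<gamma> "inv\<^bsub>?G\<^esub> \<gamma>"] one axis3_sub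
      by (intro bij_betwI[where g = "?r (inv\<^bsub>?G\<^esub> \<gamma>)"]) (auto simp: subset_iff)
    then show ?thesis using c by (simp add: Bij_def)
  qed
  have "?\<rho> \<in> hom ?G (BijGroup axis3)"
  proof (rule homI)
    fix \<gamma> \<eta> assume c: "\<gamma> \<in> carrier ?G" "\<eta> \<in> carrier ?G"
    show "?\<rho> \<gamma> \<in> carrier (BijGroup axis3)" using bij[OF c(1)] by (simp add: BijGroup_def)
    have "?\<rho> (\<gamma> \<otimes>\<^bsub>?G\<^esub> \<eta>) = compose axis3 (?\<rho> \<gamma>) (?\<rho> \<eta>)"
      using c mult[OF c] ax axis3_sub by (auto simp: compose_def restrict_def fun_eq_iff)
    then show "?\<rho> (\<gamma> \<otimes>\<^bsub>?G\<^esub> \<eta>) = ?\<rho> \<gamma> \<otimes>\<^bsub>BijGroup axis3\<^esub> ?\<rho> \<eta>"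
      using bij c by (simp add: BijGroup_def)
  qed
  then have "group_action ?G axis3 ?\<rho>"
    by (simp add: group_action_def group_hom_def group_hom_axioms_def group_BijGroup group_surface)
  moreover have "Metric_space axis3 hdist"
    using hdist_sym hdist_0 hdist_triangle axis3_sub by unfold_locales (auto simp: subset_iff)
  moreover have "hdist (?r \<gamma> x) (?r \<gamma> y) = hdist x y" if "\<gamma> \<in> carrier ?G" "x \<in> axis3" "y \<in> axis3" for \<gamma> x y
    using rep_space_acts[OF rep_in_rep_space[OF v]] that isom_H3_simps(2)[of "?r \<gamma>" x y] by (simp add: acts_def subsetD[OF axis3_sub])
  ultimately show ?thesis unfolding isometric_action_def axis_action_def prod.case by simp
qed

lemma max_displacement_axis:
  assumes g: "2 \<le> g" and x: "x \<in> axis3"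
  shows "max_displacement g (axis_action g) x = disp g (dihedral 1 1) x"
  using x generating_set_carrier unfolding max_displacement_def axis_action_def by (simp cong: image_cong)

text \<open>Every height is multiplied by \<open>exp t\<close>, and logarithms of heights are
  1-Lipschitz.\<close>

lemma translation_displacement:
  assumes "x \<in> H3" "0 \<le> t"
  shows "t \<le> hdist x (act (dihedral e t (GenA 2)) x)"
proof -
  have p: "0 < x $ 3" using assms by (simp add: H3_def)
  have m: "dihedral e t (GenA 2) = M2 (of_real (exp t)) 0 0 1" by (simp add: dihedral_def)
  have "act (dihedral e t (GenA 2)) x $ 3 = exp t * x $ 3"
    unfolding m using act_affine(2)[OF _ assms(1), of "of_real (exp t)" 0] by simp
  moreover have "ln (exp t * x $ 3) = t + ln (x $ 3)" using p by (simp add: ln_mult)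
  moreover have "act (dihedral e t (GenA 2)) x \<in> H3" unfolding m using assms(1) by (simp add: dt_def)
  ultimately show ?thesis using hdist_height[OF assms(1), of "act (dihedral e t (GenA 2)) x"] assms(2) by simp
qed

text \<open>On the axis, \<open>jpt\<close> is the fixed point of the reversal, so only the
  translation moves it, and by exactly \<open>t\<close>; the translation moves no point by
  less.\<close>

lemma dihedral_displacement:
  assumes g: "2 \<le> g" and e: "e = 1 \<or> e = - 1" and t: "0 \<le> t"
  shows "x \<in> H3 \<Longrightarrow> t \<le> disp g (dihedral e t) x"
    "disp g (dihedral e t) jpt = t"
    "min_displacement g (rep g (dihedral e t)) = t"
proof -
  have g1: "1 \<le> g" using g by simp
  note v = dihedral_valid[OF e g1, of t]
  have lower: "t \<le> disp g (dihedral e t) x" if "x \<in> H3" for x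
  proof -
    have "GenA 2 \<in> surface_gens g" using g by simp
    then have "hdist x (act (dihedral e t (GenA 2)) x) \<le> disp g (dihedral e t) x"
      using max_displacement_le[OF v that g1] by blast
    with translation_displacement[OF that t, of e] show ?thesis by (rule order_trans)
  qed
  have j: "jpt = vp (exp 0)" by (simp add: jpt_eq)
  have "hdist jpt (act (dihedral e t y) jpt) \<le> t" for y
  proof -
    consider "y = GenA 1" | "y = GenB 1" | "y = GenA 2" | "y \<noteq> GenA 1 \<and> y \<noteq> GenB 1 \<and> y \<noteq> GenA 2" by blast
    then show ?thesis
      by cases (use act_axis[OF e, where t = t and s = 0] t in \<open>simp_all add: j hdist_vp del: exp_zero\<close>)
  qed
  then have upper: "disp g (dihedral e t) jpt \<le> t"
    using max_displacement_le[OF v jpt_H3 g1] by blast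
  show "x \<in> H3 \<Longrightarrow> t \<le> disp g (dihedral e t) x" by (rule lower)
  show m: "disp g (dihedral e t) jpt = t" using upper lower[OF jpt_H3] by simp
  have "\<not> min_displacement g (rep g (dihedral e t)) < t"
    using min_displacement_less_iff[OF v g1] lower by (meson not_less)
  then show "min_displacement g (rep g (dihedral e t)) = t"
    using min_displacement_le[OF v g1 jpt_H3] m by simp
qed

lemma real_tree_segment: "real_tree X d \<Longrightarrow> x \<in> X \<Longrightarrow> y \<in> X \<Longrightarrow> \<exists>s. geodesic_segment X d x y s"
  unfolding real_tree_def
  by (elim conjE, drule (1) bspec, drule (1) bspec, elim exE conjE, rule exI, assumption)

lemma geodesic_segment_mono:
  assumes "Y \<subseteq> X" "geodesic_segment Y d x y s" shows "geodesic_segment X d x y s"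
proof -
  obtain c where "c \<in> {0..d x y} \<rightarrow> Y" "c 0 = x" "c (d x y) = y"
    "\<forall>t\<in>{0..d x y}. \<forall>u\<in>{0..d x y}. d (c t) (c u) = \<bar>t - u\<bar>" "s = c ` {0..d x y}"
    using assms(2) unfolding geodesic_segment_def by blast
  moreover have "c \<in> {0..d x y} \<rightarrow> X" using calculation(1) assms(1) by blast
  ultimately show ?thesis unfolding geodesic_segment_def by (intro exI[of _ c] conjI)
qed

text \<open>An invariant subtree contains an orbit of the translation, which is unbounded in both
  directions, and the segments joining its points exhaust the line.\<close>

lemma minimal_axis_action:
  assumes g: "2 \<le> g"
  shows "minimal_action g (axis_action g)"
proof -
  have g1: "1 \<le> g" using g by simp
  let ?r = "rep g (dihedral 1 1)"
  have "Y = axis3" if Y: "Y \<subseteq> axis3" "real_tree Y hdist"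
    and inv: "\<And>\<gamma>. \<gamma> \<in> carrier (surface_group g) \<Longrightarrow> ?r \<gamma> ` Y \<subseteq> Y" for Y
  proof (rule antisym[OF Y(1)])
    have w: "[(GenA 2, b)] \<in> words_over (surface_gens g)" for b using g by simp
    then have c: "cls g [(GenA 2, b)] \<in> carrier (surface_group g)" for b by (auto simp: surface_carrier)
    note v = dihedral_valid[of 1 g 1, OF _ g1]
    have up: "vp (exp (s + 1)) \<in> Y" if "vp (exp s) \<in> Y" for s
    proof -
      have "?r (cls g [(GenA 2, False)]) (vp (exp s)) = vp (exp (s + 1))"
        using rep_apply[OF v w, of "vp (exp s)" False] act_axis(3)[of 1 1 s] by simp
      then show ?thesis using inv[OF c, of False] that by (metis image_subset_iff)
    qed
    have down: "vp (exp (s - 1)) \<in> Y" if "vp (exp s) \<in> Y" for s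
    proof -
      have d: "dt (dihedral 1 1 (GenA 2)) \<noteq> 0" by (rule dt_dihedral) simp
      have "act (adj (dihedral 1 1 (GenA 2))) (vp (exp s)) = vp (exp (s - 1))"
        using act_adj(1)[OF d, of "vp (exp (s - 1))"] act_axis(3)[of 1 1 "s - 1"] by simp
      then have "?r (cls g [(GenA 2, True)]) (vp (exp s)) = vp (exp (s - 1))"
        using rep_apply[OF v w, of "vp (exp s)" True] by simp
      then show ?thesis using inv[OF c, of True] that by (metis image_subset_iff)
    qed
    obtain s where s: "vp (exp s) \<in> Y" using Y by (metis real_tree_def axis3_cases ex_in_conv subsetD)
    have n: "vp (exp (s + of_nat n)) \<in> Y \<and> vp (exp (s - of_nat n)) \<in> Y" for n
    proof (induction n)
      case (Suc n)
      then show ?case using up[of "s + of_nat n"] down[of "s - of_nat n"] by (simp add: algebra_simps)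
    qed (use s in simp)
    show "axis3 \<subseteq> Y"
    proof
      fix x assume "x \<in> axis3"
      then obtain u where u: "x = vp (exp u)" by (rule axis3_cases)
      obtain n :: nat where nn: "\<bar>u - s\<bar> \<le> of_nat n" using real_arch_simple by blast
      let ?a = "s - of_nat n" and ?b = "s + of_nat n"
      obtain S where S: "geodesic_segment Y hdist (vp (exp ?a)) (vp (exp ?b)) S"
        using real_tree_segment[OF Y(2)] n[of n] by blast
      then have "geodesic_segment axis3 hdist (vp (exp ?a)) (vp (exp ?b)) S"
        using geodesic_segment_mono[OF Y(1)] by blast
      then have "S = (\<lambda>s. vp (exp s)) ` {min ?a ?b..max ?a ?b}"
        using line_segment[of "\<lambda>s. vp (exp s)" axis3 hdist, OF axis3_line] by blast
      then have "x \<in> S" unfolding u using nn by (intro image_eqI[of _ _ u] \<open>S = _\<close>[THEN equalityD2, THEN subsetD]) auto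
      moreover have "S \<subseteq> Y" using S unfolding geodesic_segment_def by blast
      ultimately show "x \<in> Y" by blast
    qed
  qed
  moreover have "(\<lambda>\<gamma>\<in>carrier (surface_group g). restrict (?r \<gamma>) axis3) \<gamma> ` Y = ?r \<gamma> ` Y"
    if "\<gamma> \<in> carrier (surface_group g)" "Y \<subseteq> axis3" for \<gamma> Y
    using that by (auto simp: subset_iff image_iff)
  ultimately show ?thesis unfolding minimal_action_def axis_action_def prod.case by metis
qed

lemma axis_action_point:
  assumes g: "2 \<le> g"
  shows "isometry_class g (axis_action g) \<in> tree_points g"
proof -
  have g1: "1 \<le> g" using g by simp
  have m: "Metric_space axis3 hdist"
    using isometric_axis_action[OF g1] by (simp add: isometric_action_def axis_action_def)
  have ne: "\<exists>x\<in>axis3. \<exists>y\<in>axis3. x \<noteq> y"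
    by (rule bexI[of _ "vp (exp 0)"], rule bexI[of _ "vp (exp 1)"]) (simp_all del: exp_zero)
  have j: "jpt \<in> axis3" unfolding jpt_eq axis3_def by (rule imageI) simp
  have l: "is_line axis3 hdist" unfolding is_line_def using axis3_line by blast
  have t: "real_tree axis3 hdist" by (rule line_real_tree[OF axis3_line m])
  have 1: "max_displacement g (axis_action g) jpt = 1"
    unfolding max_displacement_axis[OF g j] by (rule dihedral_displacement(2)[OF g]) simp_all
  have 2: "1 \<le> max_displacement g (axis_action g) x" if "x \<in> axis3" for x
    unfolding max_displacement_axis[OF g that]
    by (rule dihedral_displacement(1)[OF g _ _ subsetD[OF axis3_sub that]]) simp_all
  obtain R where R: "axis_action g = (axis3, hdist, R)" unfolding axis_action_def by blast
  have "admissible_tree_action g (axis_action g)"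
    using isometric_axis_action[OF g1] minimal_axis_action[OF g] ne l t j 1 2
    unfolding R admissible_tree_action_def prod.case by blast
  then show ?thesis by (simp add: tree_points_def)
qed

text \<open>On the points \<open>vp (exp (t * c x))\<close> the rescaled distances agree exactly
  with those of the tree, for either \<open>e\<close>. Only the hyperbolicity constant, divided by
  \<open>t\<close>, has to converge.\<close>

lemma dihedral_tendsto_axis:
  assumes g: "2 \<le> g" and e: "e = 1 \<or> e = - 1"
    and V: "openin (points_topology g) V" "isometry_class g (axis_action g) \<in> V"
  shows "\<forall>\<^sub>F t in at_top. pt g (dihedral e t) \<in> V"
proof -
  have g1: "1 \<le> g" using g by simp
  let ?p = "isometry_class g (axis_action g)"
  have pp: "?p \<in> points g" using axis_action_point[OF g] by (simp add: points_def)
  have "generate_topology_on (basic_nbhds g) V"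
    using V(1) unfolding points_topology_def openin_topology_generated_by_iff .
  then show ?thesis using V(2)
  proof (induction rule: generate_topology_on.induct)
    case (Int A B)
    then show ?case by (simp add: eventually_conj)
  next
    case (UN K)
    then obtain k where "k \<in> K" "?p \<in> k" by blast
    then have "\<forall>\<^sub>F t in at_top. pt g (dihedral e t) \<in> k" using UN by blast
    then show ?case by (rule eventually_mono) (use \<open>k \<in> K\<close> in blast)
  next
    case (Basis V)
    then obtain K \<epsilon> P Y where W: "V = basic_nbhd g K \<epsilon> P Y" "0 < \<epsilon>" "finite K" "finite P" "P \<subseteq> carrier (surface_group g)"
      by (auto simp: basic_nbhds_def)
    obtain Z d \<sigma> where Y: "Y = (Z, d, \<sigma>)" by (cases Y)
    have "approximates K \<epsilon> P Y (axis_action g)"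
      using basic_nbhd_iff[OF isometric_axis_action[OF g1] pp W(5)] Basis.prems unfolding W(1) by blast
    then obtain k where k: "k \<in> K \<rightarrow> axis3" "\<And>\<gamma> \<eta> x y. \<gamma> \<in> P \<Longrightarrow> \<eta> \<in> P \<Longrightarrow> x \<in> K \<Longrightarrow> y \<in> K \<Longrightarrow>
        \<bar>d (\<sigma> \<gamma> x) (\<sigma> \<eta> y) - hdist (snd (snd (axis_action g)) \<gamma> (k x)) (snd (snd (axis_action g)) \<eta> (k y))\<bar> < \<epsilon>"
      "\<bar>hyp_const Z d - hyp_const axis3 hdist\<bar> < \<epsilon>"
      unfolding Y approximates_def axis_action_def prod.case snd_conv by blast
    have h0: "\<bar>hyp_const Z d - 0\<bar> < \<epsilon>" using k(3) line_hyp_const[OF axis3_line] by simp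
    have "((\<lambda>t. \<bar>hyp_const Z d - hyp_const H3 hdist / t\<bar>) \<longlongrightarrow> \<bar>hyp_const Z d - 0\<bar>) at_top"
      by (intro tendsto_intros tendsto_divide_0[OF tendsto_const] filterlim_at_top_imp_at_infinity filterlim_ident)
    then have ev: "\<forall>\<^sub>F t in at_top. \<bar>hyp_const Z d - hyp_const H3 hdist / t\<bar> < \<epsilon>"
      using h0 by (rule order_tendstoD(2))
    have coord: "\<exists>s. x \<in> K \<longrightarrow> k x = vp (exp s)" for x using k(1) axis3_cases[of "k x"] by (auto simp: Pi_iff)
    then obtain c where c: "\<And>x. x \<in> K \<Longrightarrow> k x = vp (exp (c x))" by metis
    \<comment> \<open>For \<open>t \<ge> 1\<close> the scale \<open>max 1 t\<close> is
      \<open>t\<close> itself.\<close>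
    show ?case using ev eventually_ge_at_top[of 1]
    proof eventually_elim
      case (elim t)
      have t: "1 \<le> t" by (rule elim)
      define f where "f x = vp (exp (t * c x))" for x
      have "hdist (rep g (dihedral e t) \<gamma> (f x)) (rep g (dihedral e t) \<eta> (f y)) / t =
        hdist (snd (snd (axis_action g)) \<gamma> (k x)) (snd (snd (axis_action g)) \<eta> (k y))"
        if H: "\<gamma> \<in> P" "\<eta> \<in> P" "x \<in> K" "y \<in> K" for \<gamma> \<eta> x y
      proof -
        have cr: "\<gamma> \<in> carrier (surface_group g)" "\<eta> \<in> carrier (surface_group g)" using W(5) H by auto
        obtain \<sigma>1 m1 where "\<forall>e t s. (e = 1 \<or> e = - 1) \<longrightarrow> rep g (dihedral e t) \<gamma> (vp (exp s)) = vp (exp (\<sigma>1 * s + m1 * t))"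
          using rep_axis[OF g1 cr(1)] by blast
        then have 1: "e = 1 \<or> e = - 1 \<Longrightarrow> rep g (dihedral e t) \<gamma> (vp (exp s)) = vp (exp (\<sigma>1 * s + m1 * t))" for e t s by blast
        obtain \<sigma>2 m2 where "\<forall>e t s. (e = 1 \<or> e = - 1) \<longrightarrow> rep g (dihedral e t) \<eta> (vp (exp s)) = vp (exp (\<sigma>2 * s + m2 * t))"
          using rep_axis[OF g1 cr(2)] by blast
        then have 2: "e = 1 \<or> e = - 1 \<Longrightarrow> rep g (dihedral e t) \<eta> (vp (exp s)) = vp (exp (\<sigma>2 * s + m2 * t))" for e t s by blast
        have "\<sigma>1 * (t * c x) + m1 * t - (\<sigma>2 * (t * c y) + m2 * t) = t * (\<sigma>1 * c x + m1 - (\<sigma>2 * c y + m2))"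
          by (simp add: algebra_simps)
        then have "hdist (rep g (dihedral e t) \<gamma> (f x)) (rep g (dihedral e t) \<eta> (f y)) = t * \<bar>\<sigma>1 * c x + m1 - (\<sigma>2 * c y + m2)\<bar>"
          unfolding f_def 1[OF e] 2[OF e] axis3_line(2) using t by (simp add: abs_mult)
        moreover have "hdist (snd (snd (axis_action g)) \<gamma> (k x)) (snd (snd (axis_action g)) \<eta> (k y)) = \<bar>\<sigma>1 * c x + m1 - (\<sigma>2 * c y + m2)\<bar>"
          using cr c H 1[of 1 1 "c x"] 2[of 1 1 "c y"] by (simp add: axis_action_def axis3_line(2))
        ultimately show ?thesis using t by simp
      qed
      then have "approximates K \<epsilon> P Y (rescaled_H3 g (rep g (dihedral e t)))"
        unfolding Y approximates_def rescaled_H3_def prod.case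
        using t k(2) elim(1) dihedral_displacement(3)[OF g e, of t] hyp_const_H3_scale[of t]
        by (intro conjI bexI[of _ f]) (auto simp: f_def max_def)
      then show ?case
        using pt_nbhd_iff[OF dihedral_valid[OF e g1] _ W(5)] irr_dihedral[OF g, of t e] t
        unfolding W(1) good_def by simp
    qed
  qed simp
qed

section \<open>Connectedness of the closure\<close>

lemma dihedral_mlim: "mlim (at s within U) (\<lambda>s. dihedral e s x) (dihedral e s x)"
  by (auto simp: mlim_def dihedral_def intro!: tendsto_intros)

theorem corollary1p3:
  fixes g :: nat
  assumes "g \<ge> 3"
  shows "connected_space (compactification g)"
proof -
  let ?X = "points_topology g" and ?H = "hyperbolic_points g"
  define \<tau> where "\<tau> = isometry_class g (axis_action g)"
  have g: "1 \<le> g" "2 \<le> g" "3 \<le> g" using assms by auto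
  have \<tau>X: "\<tau> \<in> topspace ?X"
    using points_in_nbhds[of \<tau> g] axis_action_point[OF g(2)]
    by (auto simp: points_topology_def points_def \<tau>_def topology_generated_by_topspace)
  have good: "good g (dihedral e t)" if "1 \<le> t" for e t using irr_dihedral[OF g(2)] that by (simp add: good_def)
  \<comment> \<open>For each sign the dihedral family over \<open>t \<ge> 1\<close> is connected,
    and it stays so when its limit \<tau> is added.\<close>
  have ray: "\<exists>C. connectedin ?X C \<and> C \<subseteq> insert \<tau> ?H \<and> \<tau> \<in> C \<and> pt g (dihedral e 1) \<in> C" if e: "e = 1 \<or> e = - 1" for e
  proof -
    let ?R = "(\<lambda>t. pt g (dihedral e t)) ` {1..}"
    have c: "connectedin ?X ?R"
      using dihedral_valid[OF e g(1)] good
      by (intro connected_pt[OF _ g(1)] dihedral_mlim) (auto intro: connected_Ici)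
    have "\<tau> \<in> ?X closure_of ?R"
      unfolding in_closure_of
    proof (intro conjI allI impI \<tau>X, elim conjE)
      fix V assume "\<tau> \<in> V" "openin ?X V"
      then have "\<forall>\<^sub>F t in at_top. pt g (dihedral e t) \<in> V \<and> 1 \<le> t"
        using dihedral_tendsto_axis[OF g(2) e] eventually_ge_at_top unfolding \<tau>_def by (intro eventually_conj) auto
      then obtain t where "pt g (dihedral e t) \<in> V" "1 \<le> t" using eventually_happens' trivial_limit_at_top_linorder by blast
      then show "\<exists>y. y \<in> ?R \<and> y \<in> V" by auto
    qed
    moreover have "?R \<subseteq> topspace ?X" using c by (rule connectedin_subset_topspace)
    ultimately have "connectedin ?X (insert \<tau> ?R)"
      using closure_of_subset[of ?R ?X] by (intro connectedin_intermediate_closure_of[OF c]) auto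
    moreover have "?R \<subseteq> ?H" using dihedral_valid[OF e g(1)] good by (auto simp: hyperbolic_points_eq)
    ultimately show ?thesis by (intro exI[of _ "insert \<tau> ?R"]) auto
  qed
  \<comment> \<open>A point is first linked within its own sign to the dihedral family of that sign
    and then follows it to \<tau>.\<close>
  have to_\<tau>: "\<exists>C. connectedin ?X C \<and> C \<subseteq> insert \<tau> ?H \<and> \<tau> \<in> C \<and> p \<in> C" if p: "p \<in> ?H" for p
  proof -
    obtain T where T: "valid g T" "good g T" "p = pt g T" using p by (auto simp: hyperbolic_points_eq)
    obtain e where e: "e = 1 \<or> e = - 1" "relc g e T" using valid_relc[OF T(1)] .
    have "linked g p (pt g (dihedral e 1))"
      using link_hub[OF g(3) e(1,2) T(2)] link_hub[OF g(3) e(1) valid_dihedral[OF e(1) g(1)] good, of 1]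
        linked_sym linked_trans T(3) by blast
    then obtain D where D: "connectedin ?X D" "D \<subseteq> ?H" "p \<in> D" "pt g (dihedral e 1) \<in> D" unfolding linked_def by blast
    obtain C where C: "connectedin ?X C" "C \<subseteq> insert \<tau> ?H" "\<tau> \<in> C" "pt g (dihedral e 1) \<in> C" using ray[OF e(1)] by blast
    have "connectedin ?X (C \<union> D)" using C D by (intro connectedin_Un) auto
    then show ?thesis using C D by (intro exI[of _ "C \<union> D"]) auto
  qed
  \<comment> \<open>All members share the point \<tau>, so their union is connected.\<close>
  define F where "F = {C. connectedin ?X C \<and> C \<subseteq> insert \<tau> ?H \<and> \<tau> \<in> C}"
  have s: "{\<tau>} \<in> F" using \<tau>X by (auto simp: F_def)
  have "connectedin ?X (\<Union>F)" by (rule connectedin_Union) (use s in \<open>auto simp: F_def\<close>)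
  moreover have "\<Union>F = insert \<tau> ?H"
  proof
    show "\<Union>F \<subseteq> insert \<tau> ?H" unfolding F_def by (rule Union_least) simp
    show "insert \<tau> ?H \<subseteq> \<Union>F"
    proof
      fix p assume "p \<in> insert \<tau> ?H"
      then consider "p = \<tau>" | "p \<in> ?H" by auto
      then show "p \<in> \<Union>F"
      proof cases
        case 1
        then show ?thesis using s by (intro UnionI[OF s]) simp
      next
        case 2
        then obtain C where "connectedin ?X C" "C \<subseteq> insert \<tau> ?H" "\<tau> \<in> C" "p \<in> C" using to_\<tau> by metis
        then show ?thesis by (intro UnionI[of C]) (simp_all add: F_def)
      qed
    qed
  qed
  ultimately have conn: "connectedin ?X (insert \<tau> ?H)" by simp
  have HX: "?H \<subseteq> topspace ?X" using connectedin_subset_topspace[OF conn] by simp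
  have "\<tau> \<in> ?X closure_of ?H"
    unfolding in_closure_of
  proof (intro conjI allI impI \<tau>X, elim conjE)
    fix V assume "\<tau> \<in> V" "openin ?X V"
    then have "\<forall>\<^sub>F t in at_top. pt g (dihedral 1 t) \<in> V \<and> 1 \<le> t"
      using dihedral_tendsto_axis[OF g(2), of 1] eventually_ge_at_top unfolding \<tau>_def by (intro eventually_conj) auto
    then obtain t where "pt g (dihedral 1 t) \<in> V" "1 \<le> t" using eventually_happens' trivial_limit_at_top_linorder by blast
    then show "\<exists>y. y \<in> ?H \<and> y \<in> V"
      using dihedral_valid[of 1 g t, OF _ g(1)] good by (auto simp: hyperbolic_points_eq)
  qed
  \<comment> \<open>Since \<tau> is a limit of hyperbolic points, adding it leaves the closure
    unchanged, and closures of connected sets are connected.\<close>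
  then have "?X closure_of insert \<tau> ?H = ?X closure_of ?H"
    using closure_of_subset[OF HX] by (intro antisym closure_of_minimal closure_of_mono) auto
  then have "connectedin ?X (?X closure_of ?H)" using connectedin_closure_of[OF conn] by simp
  then show ?thesis by (simp add: compactification_def connectedin_def)
qed

end
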